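(* Let $p\in(1,2]$, $q\in(1,\infty)$, $a>0$ with $a>\frac dp-\frac d2$, and $r=\max\{2,p,q\}$. Let $\mathcal X=B^0_{p,q}(\mathbb T^d)$, $\mathcal Y=L^2(\mathbb T^d)$, $\mathcal R=\frac1r\|\cdot\|_{B^0_{p,q},\mathcal W}^r$, and let $F_a:\mathcal D\subset\mathcal X\to\mathcal Y$ satisfy, for some $L>0$ and all $f_1,f_2\in\mathcal D$, $$\|F_a(f_1)-F_a(f_2)\|_{B^a_{p,q}}\le L\|f_1-f_2\|_{B^0_{p,q}},$$ $$\tfrac1L\|f_1-f_2\|_{B^{-a}_{2,2}}\le\|F_a(f_1)-F_a(f_2)\|_{L^2}\le L\|f_1-f_2\|_{B^{-a}_{2,2}}.$$ Let $f^\dagger\in\mathcal D\cap B^s_{p,\infty}$ for some $s\in(0,\frac a{q-1})$ with $\|f^\dagger\|_{B^s_{p,\infty}}\le\varrho$, and let $g^{\mathrm{obs}}=F_a(f^\dagger)+\xi$ with $\|\xi\|_{L^2}\le\delta$, $\delta>0$. Then there exists a constant $c>0$ such that the variational source condition $$\langle f^*,f^\dagger-f\rangle\le\tfrac12\Delta_{\mathcal R}(f,f^\dagger)+\psi\big(\|F_a(f^\dagger)-F_a(f)\|_{L^2}^2\big)\qquad\text{for all } f\in\mathcal D$$ holds with $$\psi(\tau)=c\,\varrho^\nu\tau^\mu,\qquad \nu=\begin{cases}\frac{qa}{a+s},&q\ge2,\\ \frac{2a}{a+s(q-1)},&q\le2,\end{cases}\qquad \mu=\begin{cases}\frac q2\,\frac{s}{a+s},&q\ge2,\\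 \frac{s(q-1)}{a+s(q-1)},&q\le2.\end{cases}$$ Moreover, for every $\alpha>0$ the Tikhonov functional $f\mapsto\frac12\|F_a(f)\|_{L^2}^2-\langle g^{\mathrm{obs}},F_a(f)\rangle+\alpha\mathcal R(f)$ has a minimizer $\widehat f_\alpha$ over $\mathcal D$, and $\widehat f_\alpha$ is unique if $F_a$ is linear. If $\alpha$ is chosen such that $-\frac1{4\alpha}\in\partial(-\psi)(4\delta^2)$, then every minimizer $\widehat f_\alpha$ satisfies $$\|\widehat f_\alpha-f^\dagger\|_{B^0_{p,q}}\le\begin{cases}c\,\varrho^{\frac a{a+s}}\,\delta^{\frac s{a+s}},&q\ge2,\\ c\,\varrho^{\frac a{a+s(q-1)}}\,\delta^{\frac{s(q-1)}{a+s(q-1)}},&q\le2,\end{cases}$$ with a constant $c$ (possibly different from the one in $\psi$) independent of $f^\dagger$, $\widehat f_\alpha$, $\varrho$ and $\delta$.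
   Context: $\mathbb T^d=\mathbb R^d/\mathbb Z^d$; $B^s_{p,q}=B^s_{p,q}(\mathbb T^d)$ are the Besov spaces; $\mathcal D\subset\mathcal X$ is nonempty, closed and convex. $f^*\in\partial\mathcal R(f^\dagger)$ (a singleton), and $\Delta_{\mathcal R}(f,f^\dagger)=\mathcal R(f)-\mathcal R(f^\dagger)-\langle f^*,f-f^\dagger\rangle$. $\|\cdot\|_{B^s_{p,q},\mathcal W}$ is the wavelet norm: a fixed orthonormal system $(\phi_{j,l})_{j\in\mathbb N_0,\,l\in I_j}$ of $L^2(\mathbb T^d)$, $\phi_{j,l}\in C^\sigma(\mathbb T^d,\mathbb R)$ (e.g. periodized Daubechies or Meyer wavelets), is assumed to generate the Besov spaces, i.e. for $p,q\in[1,\infty]$ and $|s|<\sigma$ a distribution $f$ lies in $B^s_{p,q}$ iff $$\|f\|_{B^s_{p,q},\mathcal W}=\Big[\sum_{j\in\mathbb N_0}2^{jsq}2^{jd(\frac12-\frac1p)q}\Big(\sum_{l\in I_j}|\langle f,\phi_{j,l}\rangle|^p\Big)^{q/p}\Big]^{1/q}<\infty$$ (usual modifications for $\infty$), this is an equivalent norm, and $f=\sum_{j,l}\langle f,\phi_{j,l}\rangle\phi_{j,l}$ uniquely. $\sigma$ is assumed to be larger than all absolute values of smoothness indices that occur. All other Besov norms may be any fixed equivalent norms; constants may depend on the wavelet system and on $p,q,a,s,d,L$. The parameter choice uses the convex subdifferential of $-\psi$ (with $\psi$ extended by $-\infty$ to negative arguments). It is the general rule $-\frac1{2C_{\mathrm{err}}\alpha}\in\partial(-\psi)(2C_{\mathrm{err}}\overline{\mathbf{err}})$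 with $C_{\mathrm{err}}=2$ and $\overline{\mathbf{err}}=\delta^2$. *)

theory Defs
  imports "HOL-Analysis.Analysis"
begin

section \<open>Functions and distributions on the torus\<close>

text \<open>Functions on the torus \<open>\<real>\<^sup>d / \<int>\<^sup>d\<close>, with \<open>d = CARD('d)\<close>, are 1-periodic functions on
  \<open>\<real>\<^sup>d\<close>; integration over the torus is integration over the unit cube. All functions and
  distributions are real-valued.\<close>

definition periodic :: "(real^'d \<Rightarrow> real) \<Rightarrow> bool" where
  "periodic f \<longleftrightarrow> (\<forall>i x. f (x + axis i 1) = f x)"

abbreviation torus :: "(real^'d) measure" where
  "torus \<equiv> lebesgue_on (cbox 0 1)"

definition partial :: "'d \<Rightarrow> (real^'d \<Rightarrow> real) \<Rightarrow> real^'d \<Rightarrow> real" where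
  "partial i f x = deriv (\<lambda>t. f (x + t *\<^sub>R axis i 1)) 0"

definition partials :: "'d list \<Rightarrow> (real^'d \<Rightarrow> real) \<Rightarrow> real^'d \<Rightarrow> real" where
  "partials is f = foldr partial is f"

definition C_k :: "nat \<Rightarrow> (real^'d \<Rightarrow> real) \<Rightarrow> bool" where
  "C_k m f \<longleftrightarrow>
     (\<forall>is i x. length is < m \<longrightarrow>
        (\<lambda>t::real. partials is f (x + t *\<^sub>R axis i 1)) differentiable at 0) \<and>
     (\<forall>is. length is \<le> m \<longrightarrow> continuous_on UNIV (partials is f))"

text \<open>The space \<open>C\<^sup>\<sigma>\<close> for real \<open>\<sigma> > 0\<close>. For \<open>\<sigma> \<notin> \<nat>\<close> this is the Hoelder space; for \<open>\<sigma> \<in> \<nat>\<close> the last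
  condition only says that the derivatives of order \<open>\<sigma>\<close> have bounded oscillation, which is
  automatic for periodic functions.\<close>

definition C_sigma :: "real \<Rightarrow> (real^'d \<Rightarrow> real) set" where
  "C_sigma \<sigma> = {f. periodic f \<and> C_k (nat \<lfloor>\<sigma>\<rfloor>) f \<and>
     (\<forall>is. length is = nat \<lfloor>\<sigma>\<rfloor> \<longrightarrow>
        (\<exists>C. \<forall>x y. \<bar>partials is f x - partials is f y\<bar> \<le> C * dist x y powr (\<sigma> - \<lfloor>\<sigma>\<rfloor>)))}"

definition test_functions :: "(real^'d \<Rightarrow> real) set" where
  "test_functions = {\<eta>. periodic \<eta> \<and> (\<forall>m. C_k m \<eta>)}"

text \<open>Periodic distributions: the linear functionals on the test functions that are continuous
  for the seminorms given by the suprema of the derivatives. Off the test functions the functional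
  is set to 0, so that equality of distributions is equality on test functions.\<close>

definition is_distribution :: "((real^'d \<Rightarrow> real) \<Rightarrow> real) \<Rightarrow> bool" where
  "is_distribution u \<longleftrightarrow>
     (\<forall>\<eta>. \<eta> \<notin> test_functions \<longrightarrow> u \<eta> = 0) \<and>
     (\<forall>\<eta>\<in>test_functions. \<forall>\<zeta>\<in>test_functions. \<forall>b c.
        u (\<lambda>x. b * \<eta> x + c * \<zeta> x) = b * u \<eta> + c * u \<zeta>) \<and>
     (\<exists>n C. \<forall>\<eta>\<in>test_functions. \<forall>B.
        (\<forall>is x. length is \<le> n \<longrightarrow> \<bar>partials is \<eta> x\<bar> \<le> B) \<longrightarrow> \<bar>u \<eta>\<bar> \<le> C * B)"

lemma is_distribution_0: "is_distribution (\<lambda>_. 0)"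
  unfolding is_distribution_def by (auto intro!: exI[of _ 0])

lemma is_distribution_lincomb:
  assumes "is_distribution u" "is_distribution v"
  shows "is_distribution (\<lambda>\<eta>. b * u \<eta> + c * v \<eta>)"
proof -
  obtain m C where C: "\<And>\<eta> B. \<eta> \<in> test_functions \<Longrightarrow>
      (\<And>is x. length is \<le> m \<Longrightarrow> \<bar>partials is \<eta> x\<bar> \<le> B) \<Longrightarrow> \<bar>u \<eta>\<bar> \<le> C * B"
    using assms(1) unfolding is_distribution_def by blast
  obtain n D where D: "\<And>\<eta> B. \<eta> \<in> test_functions \<Longrightarrow>
      (\<And>is x. length is \<le> n \<Longrightarrow> \<bar>partials is \<eta> x\<bar> \<le> B) \<Longrightarrow> \<bar>v \<eta>\<bar> \<le> D * B"
    using assms(2) unfolding is_distribution_def by blast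
  have "\<bar>b * u \<eta> + c * v \<eta>\<bar> \<le> (\<bar>b\<bar> * C + \<bar>c\<bar> * D) * B"
    if "\<eta> \<in> test_functions" "\<And>is x. length is \<le> max m n \<Longrightarrow> \<bar>partials is \<eta> x\<bar> \<le> B" for \<eta> B
  proof -
    have "\<bar>u \<eta>\<bar> \<le> C * B" "\<bar>v \<eta>\<bar> \<le> D * B"
      using that by (auto intro!: C D)
    then have "\<bar>b\<bar> * \<bar>u \<eta>\<bar> + \<bar>c\<bar> * \<bar>v \<eta>\<bar> \<le> \<bar>b\<bar> * (C * B) + \<bar>c\<bar> * (D * B)"
      by (intro add_mono mult_left_mono) auto
    then show ?thesis
      using abs_triangle_ineq[of "b * u \<eta>" "c * v \<eta>"] by (simp add: abs_mult algebra_simps)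
  qed
  then have "\<exists>n C. \<forall>\<eta>\<in>test_functions. \<forall>B.
      (\<forall>is x. length is \<le> n \<longrightarrow> \<bar>partials is \<eta> x\<bar> \<le> B) \<longrightarrow> \<bar>b * u \<eta> + c * v \<eta>\<bar> \<le> C * B"
    by blast
  with assms show ?thesis
    unfolding is_distribution_def by (auto simp: algebra_simps)
qed

typedef ('d::finite) distribution = "{u :: (real^'d \<Rightarrow> real) \<Rightarrow> real. is_distribution u}"
  morphisms dapply Abs_distribution
  using is_distribution_0 by blast

setup_lifting type_definition_distribution

instantiation distribution :: (finite) real_vector
begin

lift_definition zero_distribution :: "'a distribution" is "\<lambda>_. 0"
  by (rule is_distribution_0)

lift_definition plus_distribution :: "'a distribution \<Rightarrow> 'a distribution \<Rightarrow> 'a distribution"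
  is "\<lambda>u v \<eta>. u \<eta> + v \<eta>"
  using is_distribution_lincomb[where b = 1 and c = 1] by simp

lift_definition minus_distribution :: "'a distribution \<Rightarrow> 'a distribution \<Rightarrow> 'a distribution"
  is "\<lambda>u v \<eta>. u \<eta> - v \<eta>"
  using is_distribution_lincomb[where b = 1 and c = "-1"] by simp

lift_definition uminus_distribution :: "'a distribution \<Rightarrow> 'a distribution"
  is "\<lambda>u \<eta>. - u \<eta>"
  using is_distribution_lincomb[where b = "-1" and c = 0] by simp

lift_definition scaleR_distribution :: "real \<Rightarrow> 'a distribution \<Rightarrow> 'a distribution"
  is "\<lambda>b u \<eta>. b * u \<eta>"
  using is_distribution_lincomb[where c = 0] by simp

instance
  by standard (transfer; simp add: algebra_simps)+

end

lemma dapply_simps: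
  "dapply 0 \<eta> = 0"
  "dapply (u + v) \<eta> = dapply u \<eta> + dapply v \<eta>"
  "dapply (u - v) \<eta> = dapply u \<eta> - dapply v \<eta>"
  "dapply (- u) \<eta> = - dapply u \<eta>"
  "dapply (b *\<^sub>R u) \<eta> = b * dapply u \<eta>"
  by (transfer; simp)+

text \<open>The distribution given by an integrable function on the torus.\<close>

definition distr_of :: "(real^'d \<Rightarrow> real) \<Rightarrow> 'd distribution" where
  "distr_of g = Abs_distribution
     (\<lambda>\<eta>. if \<eta> \<in> test_functions then LINT x|torus. g x * \<eta> x else 0)"

lemma dapply_distr_of:
  fixes g \<eta> :: "real^'d \<Rightarrow> real"
  assumes "integrable torus g" "\<eta> \<in> test_functions"
  shows "dapply (distr_of g) \<eta> = (LINT x|torus. g x * \<eta> x)"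
proof -
  have cont: "continuous_on UNIV \<zeta>" if "\<zeta> \<in> test_functions" for \<zeta> :: "real^'d \<Rightarrow> real"
  proof -
    have "C_k 0 \<zeta>"
      using that by (auto simp: test_functions_def)
    then show ?thesis
      by (auto simp: C_k_def partials_def)
  qed
  have meas: "\<zeta> \<in> borel_measurable torus" if "\<zeta> \<in> test_functions" for \<zeta> :: "real^'d \<Rightarrow> real"
    using cont[OF that]
    by (intro continuous_imp_measurable_on_sets_lebesgue) (auto intro: continuous_on_subset)
  have int: "integrable torus (\<lambda>x. g x * \<zeta> x)" if "\<zeta> \<in> test_functions" for \<zeta> :: "real^'d \<Rightarrow> real"
  proof -
    have "compact (\<zeta> ` cbox 0 1)"
      using cont[OF that] by (intro compact_continuous_image) (auto intro: continuous_on_subset)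
    then obtain B where B: "\<And>x. x \<in> cbox 0 1 \<Longrightarrow> norm (\<zeta> x) \<le> B"
      using compact_imp_bounded[of "\<zeta> ` cbox 0 1"] unfolding bounded_iff by blast
    have 1: "integrable torus (\<lambda>x. B * norm (g x))"
      by (intro integrable_mult_right integrable_norm assms(1))
    have 2: "(\<lambda>x. g x * \<zeta> x) \<in> borel_measurable torus"
      by (intro borel_measurable_times borel_measurable_integrable assms(1) meas that)
    have "AE x in torus. norm (g x * \<zeta> x) \<le> norm (B * norm (g x))"
    proof (rule AE_I2)
      fix x :: "real^'d" assume "x \<in> space torus"
      then have "norm (\<zeta> x) \<le> B"
        by (intro B) (auto simp: space_restrict_space)
      then have "\<bar>g x\<bar> * \<bar>\<zeta> x\<bar> \<le> \<bar>g x\<bar> * \<bar>B\<bar>"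
        by (intro mult_left_mono) auto
      then show "norm (g x * \<zeta> x) \<le> norm (B * norm (g x))"
        by (simp add: abs_mult mult.commute)
    qed
    then show ?thesis
      by (rule Bochner_Integration.integrable_bound[OF 1 2])
  qed
  have lin: "(\<lambda>x. b * \<zeta> x + c * \<xi> x) \<in> test_functions"
    if "\<zeta> \<in> test_functions" "\<xi> \<in> test_functions" for b c and \<zeta> \<xi> :: "real^'d \<Rightarrow> real"
  proof -
    have part: "partial i (\<lambda>x. b * f x + c * h x) = (\<lambda>x. b * partial i f x + c * partial i h x)"
      if "\<And>x. (\<lambda>t. f (x + t *\<^sub>R axis i 1)) differentiable at (0::real)"
         "\<And>x. (\<lambda>t. h (x + t *\<^sub>R axis i 1)) differentiable at (0::real)"
      for i and f h :: "real^'d \<Rightarrow> real"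
    proof
      fix x
      have "((\<lambda>t. f (x + t *\<^sub>R axis i 1)) has_field_derivative partial i f x) (at 0)"
           "((\<lambda>t. h (x + t *\<^sub>R axis i 1)) has_field_derivative partial i h x) (at 0)"
        using that unfolding partial_def
        by (metis DERIV_deriv_iff_real_differentiable)+
      then have "((\<lambda>t. b * f (x + t *\<^sub>R axis i 1) + c * h (x + t *\<^sub>R axis i 1))
          has_field_derivative b * partial i f x + c * partial i h x) (at 0)"
        by (intro DERIV_add DERIV_cmult)
      then show "partial i (\<lambda>x. b * f x + c * h x) x = b * partial i f x + c * partial i h x"
        unfolding partial_def[of i "\<lambda>x. b * f x + c * h x"] by (rule DERIV_imp_deriv)
    qed
    have diff: "(\<lambda>t. partials is f (x + t *\<^sub>R axis i 1)) differentiable at (0::real)"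
      if "f \<in> test_functions" for f :: "real^'d \<Rightarrow> real" and "is" i x
      using that unfolding test_functions_def C_k_def by blast
    have eq: "partials is (\<lambda>x. b * \<zeta> x + c * \<xi> x) = (\<lambda>x. b * partials is \<zeta> x + c * partials is \<xi> x)"
      for "is"
    proof (induction "is")
      case (Cons i "is")
      have "partial i (\<lambda>x. b * partials is \<zeta> x + c * partials is \<xi> x) =
          (\<lambda>x. b * partial i (partials is \<zeta>) x + c * partial i (partials is \<xi>) x)"
        by (rule part) (use that diff in auto)
      with Cons show ?case
        by (simp add: partials_def)
    qed (simp add: partials_def)
    have c0: "continuous_on UNIV (partials is f)" if "f \<in> test_functions"
      for f :: "real^'d \<Rightarrow> real" and "is"
      using that unfolding test_functions_def C_k_def by blast
    show ?thesis
      using that unfolding test_functions_def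
      by (auto simp: C_k_def eq periodic_def
          intro!: continuous_intros derivative_intros diff[unfolded test_functions_def]
            c0[unfolded test_functions_def])
  qed
  have "is_distribution (\<lambda>\<eta>. if \<eta> \<in> test_functions then LINT x|torus. g x * \<eta> x else 0)"
    unfolding is_distribution_def
  proof (intro conjI ballI allI impI exI)
    fix \<zeta> \<xi> :: "real^'d \<Rightarrow> real" and b c
    assume *: "\<zeta> \<in> test_functions" "\<xi> \<in> test_functions"
    have "(LINT x|torus. g x * (b * \<zeta> x + c * \<xi> x)) =
        (LINT x|torus. b * (g x * \<zeta> x) + c * (g x * \<xi> x))"
      by (simp add: algebra_simps)
    also have "\<dots> = b * (LINT x|torus. g x * \<zeta> x) + c * (LINT x|torus. g x * \<xi> x)"
      using int[OF *(1)] int[OF *(2)] by simp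
    finally show "(if (\<lambda>x. b * \<zeta> x + c * \<xi> x) \<in> test_functions
         then LINT x|torus. g x * (b * \<zeta> x + c * \<xi> x) else 0) =
        b * (if \<zeta> \<in> test_functions then LINT x|torus. g x * \<zeta> x else 0) +
        c * (if \<xi> \<in> test_functions then LINT x|torus. g x * \<xi> x else 0)"
      using * lin by simp
  next
    fix \<zeta> :: "real^'d \<Rightarrow> real" and B
    assume *: "\<zeta> \<in> test_functions" "\<forall>is x. length is \<le> 0 \<longrightarrow> \<bar>partials is \<zeta> x\<bar> \<le> B"
    then have B: "\<bar>\<zeta> x\<bar> \<le> B" for x
      by (auto simp: partials_def)
    have "\<bar>LINT x|torus. g x * \<zeta> x\<bar> \<le> (LINT x|torus. \<bar>g x * \<zeta> x\<bar>)"
      by (rule integral_abs_bound)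
    also have "\<dots> \<le> (LINT x|torus. \<bar>g x\<bar> * B)"
    proof (rule integral_mono)
      show "integrable torus (\<lambda>x. \<bar>g x * \<zeta> x\<bar>)"
        by (intro integrable_abs int *(1))
      show "integrable torus (\<lambda>x. \<bar>g x\<bar> * B)"
        by (intro integrable_mult_left integrable_abs assms(1))
      show "\<bar>g x * \<zeta> x\<bar> \<le> \<bar>g x\<bar> * B" for x
        unfolding abs_mult by (intro mult_left_mono B abs_ge_zero)
    qed
    also have "\<dots> = (LINT x|torus. \<bar>g x\<bar>) * B"
      by (rule integral_mult_left_zero)
    finally show "\<bar>if \<zeta> \<in> test_functions then LINT x|torus. g x * \<zeta> x else 0\<bar>
        \<le> (LINT x|torus. \<bar>g x\<bar>) * B"
      by (simp only: *(1) if_True)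
  qed simp
  then show ?thesis
    using assms(2) by (simp add: distr_of_def Abs_distribution_inverse)
qed

definition L2 :: "(real^'d \<Rightarrow> real) set" where
  "L2 = {g. g \<in> borel_measurable torus \<and> integrable torus (\<lambda>x. (g x)\<^sup>2)}"

definition L2_inner :: "(real^'d \<Rightarrow> real) \<Rightarrow> (real^'d \<Rightarrow> real) \<Rightarrow> real" where
  "L2_inner g h = (LINT x|torus. g x * h x)"

definition L2_norm :: "(real^'d \<Rightarrow> real) \<Rightarrow> real" where
  "L2_norm g = sqrt (L2_inner g g)"


section \<open>Besov spaces\<close>

definition epowr :: "ennreal \<Rightarrow> real \<Rightarrow> ennreal" where
  "epowr x t = (if x = \<infinity> then \<infinity> else ennreal (enn2real x powr t))"

text \<open>The (possibly infinite) \<open>L\<^sup>p\<close> norm of a non-negative function, \<open>p \<in> [1,\<infinity>]\<close>; for \<open>p = \<infinity>\<close> it is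
  the essential supremum. With \<^term>\<open>M = count_space A\<close> it is the norm of \<open>\<ell>\<^sup>p(A)\<close>.\<close>

definition eLp_norm :: "'a measure \<Rightarrow> ennreal \<Rightarrow> ('a \<Rightarrow> ennreal) \<Rightarrow> ennreal" where
  "eLp_norm M p f =
     (if p = \<infinity> then Inf {C. AE x in M. f x \<le> C}
      else epowr (\<integral>\<^sup>+x. epowr (f x) (enn2real p) \<partial>M) (1 / enn2real p))"

text \<open>Generator of a smooth dyadic resolution of unity. Evenness makes the Littlewood--Paley blocks
  of real distributions real.\<close>

definition lp_cutoff :: "(real^'d \<Rightarrow> real) \<Rightarrow> bool" where
  "lp_cutoff \<theta> \<longleftrightarrow> (\<forall>m. C_k m \<theta>) \<and>
     (\<forall>x. 0 \<le> \<theta> x \<and> \<theta> x \<le> 1 \<and> \<theta> (- x) = \<theta> x \<and>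
       (norm x \<le> 1 \<longrightarrow> \<theta> x = 1) \<and> (2 \<le> norm x \<longrightarrow> \<theta> x = 0))"

definition dyadic :: "(real^'d \<Rightarrow> real) \<Rightarrow> nat \<Rightarrow> real^'d \<Rightarrow> real" where
  "dyadic \<theta> j x =
     (if j = 0 then \<theta> x else \<theta> (x /\<^sub>R 2 ^ j) - \<theta> (x /\<^sub>R 2 ^ (j - 1)))"

text \<open>The block \<open>\<Sum>\<^sub>k \<rho>\<^sub>j(k) f\<^sup>^(k) e\<^bsup>2\<pi>i k\<bullet>x\<^esup>\<close> (sum over \<open>k \<in> \<int>\<^sup>d\<close>) of a real distribution \<open>f\<close>,
  in real form: \<open>\<rho>\<^sub>j\<close> is even and vanishes outside the ball of radius \<open>2\<^bsup>j+1\<^esup>\<close>.\<close>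

definition lp_block :: "(real^'d \<Rightarrow> real) \<Rightarrow> nat \<Rightarrow> 'd distribution \<Rightarrow> real^'d \<Rightarrow> real" where
  "lp_block \<theta> j f x =
     (\<Sum>k | (\<forall>i. k $ i \<in> \<int>) \<and> norm k \<le> 2 ^ (j + 1).
        dyadic \<theta> j k * dapply f (\<lambda>y. cos (2 * pi * (k \<bullet> (x - y)))))"

definition besov_enorm ::
    "(real^'d \<Rightarrow> real) \<Rightarrow> real \<Rightarrow> ennreal \<Rightarrow> ennreal \<Rightarrow> 'd distribution \<Rightarrow> ennreal" where
  "besov_enorm \<theta> s p q f =
     eLp_norm (count_space UNIV) q
       (\<lambda>j. ennreal (2 powr (j * s)) * eLp_norm torus p (\<lambda>x. ennreal \<bar>lp_block \<theta> j f x\<bar>))"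

definition besov ::
    "(real^'d \<Rightarrow> real) \<Rightarrow> real \<Rightarrow> ennreal \<Rightarrow> ennreal \<Rightarrow> 'd distribution set" where
  "besov \<theta> s p q = {f. besov_enorm \<theta> s p q f < \<infinity>}"

definition norm_on :: "'v::real_vector set \<Rightarrow> ('v \<Rightarrow> real) \<Rightarrow> bool" where
  "norm_on V n \<longleftrightarrow>
     (\<forall>f\<in>V. 0 \<le> n f \<and> (n f = 0 \<longleftrightarrow> f = 0) \<and> (\<forall>b. n (b *\<^sub>R f) = \<bar>b\<bar> * n f)) \<and>
     (\<forall>f\<in>V. \<forall>g\<in>V. n (f + g) \<le> n f + n g)"

text \<open>A choice of one of the equivalent norms on each Besov space.\<close>

definition besov_norms ::
    "(real^'d \<Rightarrow> real) \<Rightarrow> (real \<Rightarrow> ennreal \<Rightarrow> ennreal \<Rightarrow> 'd distribution \<Rightarrow> real) \<Rightarrow> bool" where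
  "besov_norms \<theta> N \<longleftrightarrow> (\<forall>s p q. 1 \<le> p \<and> 1 \<le> q \<longrightarrow>
     norm_on (besov \<theta> s p q) (N s p q) \<and>
     (\<exists>C>0. \<forall>f\<in>besov \<theta> s p q.
        N s p q f \<le> C * enn2real (besov_enorm \<theta> s p q f) \<and>
        enn2real (besov_enorm \<theta> s p q f) \<le> C * N s p q f))"


section \<open>Wavelet systems\<close>

text \<open>The pairing \<open>\<langle>f, \<phi>\<rangle>\<close> of a distribution with a function \<open>\<phi>\<close> that need not be a test function,
  through the Littlewood--Paley decomposition of \<open>f\<close>. The series converges if \<open>\<phi> \<in> C\<^sup>\<sigma>\<close> and \<open>f\<close> lies
  in a Besov space of smoothness larger than \<open>-\<sigma>\<close>, and it gives \<^term>\<open>dapply f \<phi>\<close> if \<open>\<phi>\<close> is a test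
  function.\<close>

definition pairing ::
    "(real^'d \<Rightarrow> real) \<Rightarrow> 'd distribution \<Rightarrow> (real^'d \<Rightarrow> real) \<Rightarrow> real" where
  "pairing \<theta> f \<phi> = (\<Sum>j. LINT x|torus. lp_block \<theta> j f x * \<phi> x)"

text \<open>The sequence space norm; the weight uses \<open>1 / enn2real \<infinity> = 0\<close>.\<close>

definition seq_enorm ::
    "'d::finite itself \<Rightarrow> (nat \<Rightarrow> 'i set) \<Rightarrow> real \<Rightarrow> ennreal \<Rightarrow> ennreal \<Rightarrow> (nat \<Rightarrow> 'i \<Rightarrow> real) \<Rightarrow> ennreal"
  where
  "seq_enorm _ I s p q c =
     eLp_norm (count_space UNIV) q
       (\<lambda>j. ennreal (2 powr (j * s) * 2 powr (j * CARD('d) * (1 / 2 - 1 / enn2real p))) *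
            eLp_norm (count_space (I j)) p (\<lambda>l. ennreal \<bar>c j l\<bar>))"

definition wavelet_enorm ::
    "(real^'d \<Rightarrow> real) \<Rightarrow> (nat \<Rightarrow> 'i set) \<Rightarrow> (nat \<Rightarrow> 'i \<Rightarrow> real^'d \<Rightarrow> real) \<Rightarrow>
     real \<Rightarrow> ennreal \<Rightarrow> ennreal \<Rightarrow> 'd distribution \<Rightarrow> ennreal" where
  "wavelet_enorm \<theta> I \<phi> s p q f = seq_enorm TYPE('d) I s p q (\<lambda>j l. pairing \<theta> f (\<phi> j l))"

text \<open>\<open>f = \<Sum>\<^sub>j\<^sub>l c\<^sub>j\<^sub>l \<phi>\<^sub>j\<^sub>l\<close> in the sense of distributions.\<close>

definition expands ::
    "(nat \<Rightarrow> 'i set) \<Rightarrow> (nat \<Rightarrow> 'i \<Rightarrow> real^'d \<Rightarrow> real) \<Rightarrow>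
     'd distribution \<Rightarrow> (nat \<Rightarrow> 'i \<Rightarrow> real) \<Rightarrow> bool" where
  "expands I \<phi> f c \<longleftrightarrow> (\<forall>\<eta>\<in>test_functions.
     ((\<lambda>(j, l). c j l * L2_inner (\<phi> j l) \<eta>) has_sum dapply f \<eta>) (SIGMA j:UNIV. I j))"

text \<open>The characterization of \<open>B\<^sup>s\<^sub>p\<^sub>q\<close> by finiteness of the wavelet norm is required of those
  distributions whose wavelet coefficients are defined, namely those in some Besov space of
  smoothness larger than \<open>-\<sigma>\<close>; on the torus \<open>B\<^sup>t\<^sub>1\<^sub>\<infinity>\<close> is the largest one of smoothness \<open>t\<close>.\<close>

definition wavelet_system ::
    "(real^'d \<Rightarrow> real) \<Rightarrow> real \<Rightarrow> (nat \<Rightarrow> 'i set) \<Rightarrow> (nat \<Rightarrow> 'i \<Rightarrow> real^'d \<Rightarrow> real) \<Rightarrow> bool" where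
  "wavelet_system \<theta> \<sigma> I \<phi> \<longleftrightarrow>
     (\<forall>j. \<forall>l\<in>I j. \<phi> j l \<in> C_sigma \<sigma>) \<and>
     (\<forall>j j'. \<forall>l\<in>I j. \<forall>l'\<in>I j'.
        L2_inner (\<phi> j l) (\<phi> j' l') = (if j = j' \<and> l = l' then 1 else 0)) \<and>
     (\<forall>s p q. \<bar>s\<bar> < \<sigma> \<and> 1 \<le> p \<and> 1 \<le> q \<longrightarrow>
        (\<forall>t f. \<bar>t\<bar> < \<sigma> \<and> f \<in> besov \<theta> t 1 \<infinity> \<longrightarrow>
           (f \<in> besov \<theta> s p q \<longleftrightarrow> wavelet_enorm \<theta> I \<phi> s p q f < \<infinity>)) \<and>
        (\<exists>C>0. \<forall>f\<in>besov \<theta> s p q.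
           wavelet_enorm \<theta> I \<phi> s p q f \<le> ennreal C * besov_enorm \<theta> s p q f \<and>
           besov_enorm \<theta> s p q f \<le> ennreal C * wavelet_enorm \<theta> I \<phi> s p q f) \<and>
        (\<forall>f\<in>besov \<theta> s p q.
           expands I \<phi> f (\<lambda>j l. pairing \<theta> f (\<phi> j l)) \<and>
           (\<forall>c. seq_enorm TYPE('d) I s p q c < \<infinity> \<and> expands I \<phi> f c \<longrightarrow>
              (\<forall>j. \<forall>l\<in>I j. c j l = pairing \<theta> f (\<phi> j l)))))"


section \<open>Regularization\<close>

definition penalty ::
    "(real^'d \<Rightarrow> real) \<Rightarrow> (nat \<Rightarrow> 'i set) \<Rightarrow> (nat \<Rightarrow> 'i \<Rightarrow> real^'d \<Rightarrow> real) \<Rightarrow>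
     real \<Rightarrow> real \<Rightarrow> real \<Rightarrow> 'd distribution \<Rightarrow> real" where
  "penalty \<theta> I \<phi> p q r f =
     1 / r * enn2real (wavelet_enorm \<theta> I \<phi> 0 (ennreal p) (ennreal q) f) powr r"

definition closed_in_norm :: "'v::real_vector set \<Rightarrow> ('v \<Rightarrow> real) \<Rightarrow> 'v set \<Rightarrow> bool" where
  "closed_in_norm V n D \<longleftrightarrow>
     (\<forall>g f. (\<forall>k. g k \<in> D) \<and> f \<in> V \<and> (\<lambda>k::nat. n (g k - f)) \<longlonglongrightarrow> 0 \<longrightarrow> f \<in> D)"

text \<open>Subdifferential of \<open>R : V \<rightarrow> \<real>\<close> as a set of bounded linear functionals on \<open>(V, n)\<close>; only the
  values of the functionals on \<open>V\<close> matter.\<close>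

definition subdifferential ::
    "'v::real_vector set \<Rightarrow> ('v \<Rightarrow> real) \<Rightarrow> ('v \<Rightarrow> real) \<Rightarrow> 'v \<Rightarrow> ('v \<Rightarrow> real) set" where
  "subdifferential V n R f = {u.
     (\<forall>g\<in>V. \<forall>h\<in>V. \<forall>b c. u (b *\<^sub>R g + c *\<^sub>R h) = b * u g + c * u h) \<and>
     (\<exists>C. \<forall>g\<in>V. \<bar>u g\<bar> \<le> C * n g) \<and>
     (\<forall>g\<in>V. R f + u (g - f) \<le> R g)}"

definition bregman :: "('v::real_vector \<Rightarrow> real) \<Rightarrow> ('v \<Rightarrow> real) \<Rightarrow> 'v \<Rightarrow> 'v \<Rightarrow> real" where
  "bregman R u f g = R f - R g - u (f - g)"

text \<open>\<open>F : D \<subseteq> V \<rightarrow> L\<^sup>2\<close> is the restriction to \<open>D\<close> of a linear map \<open>V \<rightarrow> L\<^sup>2\<close>; elements of \<open>L\<^sup>2\<close> are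
  compared almost everywhere.\<close>

definition linear_into_L2 ::
    "'v::real_vector set \<Rightarrow> 'v set \<Rightarrow> ('v \<Rightarrow> real^'d \<Rightarrow> real) \<Rightarrow> bool" where
  "linear_into_L2 V D F \<longleftrightarrow> (\<exists>A.
     (\<forall>f\<in>V. A f \<in> L2) \<and>
     (\<forall>f\<in>V. \<forall>g\<in>V. \<forall>b c. AE x in torus. A (b *\<^sub>R f + c *\<^sub>R g) x = b * A f x + c * A g x) \<and>
     (\<forall>f\<in>D. AE x in torus. F f x = A f x))"

definition tikhonov ::
    "('v \<Rightarrow> real^'d \<Rightarrow> real) \<Rightarrow> ('v \<Rightarrow> real) \<Rightarrow> (real^'d \<Rightarrow> real) \<Rightarrow> real \<Rightarrow> 'v \<Rightarrow> real" where
  "tikhonov F R g \<alpha> f = 1 / 2 * (L2_norm (F f))\<^sup>2 - L2_inner g (F f) + \<alpha> * R f"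

text \<open>\<open>-\<psi>\<close>, where \<open>\<psi>\<close> is extended by \<open>-\<infinity>\<close> to negative arguments.\<close>

definition neg_ext :: "(real \<Rightarrow> real) \<Rightarrow> real \<Rightarrow> ereal" where
  "neg_ext \<psi> t = (if t < 0 then \<infinity> else ereal (- \<psi> t))"

definition ereal_subdifferential :: "(real \<Rightarrow> ereal) \<Rightarrow> real \<Rightarrow> real set" where
  "ereal_subdifferential h t = {m. \<bar>h t\<bar> \<noteq> \<infinity> \<and> (\<forall>u. h t + ereal (m * (u - t)) \<le> h u)}"

definition \<nu>_exp :: "real \<Rightarrow> real \<Rightarrow> real \<Rightarrow> real" where
  "\<nu>_exp q a s = (if 2 \<le> q then q * a / (a + s) else 2 * a / (a + s * (q - 1)))"

definition \<mu>_exp :: "real \<Rightarrow> real \<Rightarrow> real \<Rightarrow> real" where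
  "\<mu>_exp q a s = (if 2 \<le> q then q / 2 * (s / (a + s)) else s * (q - 1) / (a + s * (q - 1)))"

definition \<psi>_fun :: "real \<Rightarrow> real \<Rightarrow> real \<Rightarrow> real \<Rightarrow> real \<Rightarrow> real \<Rightarrow> real" where
  "\<psi>_fun q a s c \<rho> t = c * \<rho> powr \<nu>_exp q a s * t powr \<mu>_exp q a s"

definition rate :: "real \<Rightarrow> real \<Rightarrow> real \<Rightarrow> real \<Rightarrow> real \<Rightarrow> real" where
  "rate q a s \<rho> \<delta> =
     (if 2 \<le> q then \<rho> powr (a / (a + s)) * \<delta> powr (s / (a + s))
      else \<rho> powr (a / (a + s * (q - 1))) * \<delta> powr (s * (q - 1) / (a + s * (q - 1))))"

end

theory Submission
  imports Defs "HOL-Complex_Analysis.Great_Picard"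
begin

text \<open>
The penalty is the \<open>r\<close>-th power of an \<open>\<ell>\<^sup>q(\<ell>\<^sup>p)\<close> norm of wavelet coefficients, which is uniformly convex of
power type \<open>r\<close>; hence the Bregman distance dominates \<open>\<parallel>f - f\<^sup>\<dagger>\<parallel>\<^sup>r\<close>. The one-sided derivative of the penalty
bounds every subgradient by \<open>\<langle>f\<^sup>*, g\<rangle> \<lesssim> \<parallel>f\<^sup>\<dagger>\<parallel>\<^bsup>r-q\<^esup> \<Sum>\<^sub>j \<parallel>f\<^sup>\<dagger>\<^sub>j\<parallel>\<^bsup>q-1\<^esup> \<parallel>g\<^sub>j\<parallel>\<close>, with weighted level norms, so that the
smoothness of \<open>f\<^sup>\<dagger>\<close> becomes decay of \<open>f\<^sup>*\<close>. Splitting \<open>f\<^sup>\<dagger> - f\<close> at a level \<open>J\<close>, measuring the low part in the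
weak norm \<open>B\<^bsup>-a\<^esup>\<^sub>2\<^sub>2\<close> (level \<open>j\<close> has \<open>O(2\<^bsup>jd\<^esup>)\<close> wavelets) and balancing \<open>J\<close> gives the variational source condition,
from which the rate follows by the choice of \<open>\<alpha>\<close>.

Bounded sequences in \<open>B\<^sup>0\<^sub>p\<^sub>q\<close> have subsequences that are Cauchy in \<open>B\<^bsup>-a\<^esup>\<^sub>2\<^sub>2\<close>, and convex combinations of the
tails that nearly minimize the penalty converge in \<open>B\<^sup>0\<^sub>p\<^sub>q\<close> by uniform convexity. This yields minimizers from
completeness alone. Completeness is proved on the Fourier side: the Fourier coefficients of a Cauchy sequence
converge, their limits grow at most logarithmically, and such coefficients define a distribution.
\<close>

section \<open>Inequalities in sequence spaces\<close>

text \<open>The power r = max {2,q} is the convexity type of the norm: for p \<le> 2 each level is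
  2-convex, and an l^q sum of 2-convex levels is convex of type max {2,q}. Subgradients decay across
  the levels at the rate s(q-1); writing this rate as \<gamma>(r-1) lets one exponent \<gamma>
  govern both cases q \<ge> 2 and q \<le> 2. Two hypotheses fix the geometry: a > d/p - d/2 leaves a
  positive gap \<open>\<epsilon>0\<close>, which makes B^0_{p,q} embed compactly into B^{-a}_{2,2};
  s < a/(q-1) makes the low-level part of the subgradient pairing a growing geometric sum, dominated
  by the cutoff level. The obstacle on the wavelet side is that coefficients are given by a
  Littlewood--Paley series and are not visibly linear. Linearity and the coefficients of finite sums
  come from uniqueness of the expansion. The obstacle for existence is that F may be nonlinear, so
  nothing is known about F on convex combinations. It suffices that these converge in norm to the
  limit that the sequence itself has in B^{-a}_{2,2}, where the data term is continuous.\<close>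

lemma weighted_am_gm:
  fixes x y \<theta> :: real
  assumes "0 \<le> x" "0 \<le> y" "0 \<le> \<theta>" "\<theta> \<le> 1"
  shows "x powr \<theta> * y powr (1 - \<theta>) \<le> \<theta> * x + (1 - \<theta>) * y"
proof (cases "x = 0 \<or> y = 0")
  case True
  then show ?thesis using assms by auto
next
  case False
  then show ?thesis using assms Youngs_inequality_0[of \<theta> "1 - \<theta>" x y] by simp
qed

text \<open>Young's inequality with weights 1/q and 1 - 1/q for t^q and m^q, rearranged. The point
  of tangency m = 0 is allowed because \<open>0 powr x\<close> is 0 for every x.\<close>

lemma powr_above_tangent:
  fixes t m q :: real
  assumes "0 \<le> t" "0 \<le> m" "1 \<le> q"
  shows "m powr q + q * m powr (q - 1) * (t - m) \<le> t powr q"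
proof (cases "m = 0 \<or> q = 1")
  case True
  then show ?thesis using assms by (auto simp: powr_one)
next
  case False
  then have m: "0 < m" and q: "1 < q" using assms by auto
  have "(t powr q) powr (1 / q) * (m powr q) powr (1 - 1 / q)
      \<le> 1 / q * t powr q + (1 - 1 / q) * m powr q"
    using q by (intro weighted_am_gm) auto
  moreover have "(t powr q) powr (1 / q) = t"
    using q assms by (simp add: powr_powr)
  moreover have "(m powr q) powr (1 - 1 / q) = m powr (q - 1)"
    using q by (simp add: powr_powr right_diff_distrib)
  ultimately have "q * (t * m powr (q - 1)) \<le> q * (1 / q * t powr q + (1 - 1 / q) * m powr q)"
    using q by (intro mult_left_mono) auto
  also have "\<dots> = t powr q + (q - 1) * m powr q"
    using q by (simp add: field_simps)
  finally have "q * (t * m powr (q - 1)) \<le> t powr q + (q - 1) * m powr q" .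
  moreover have "m powr q = m powr (q - 1) * m"
    using m by (simp add: powr_mult_base mult.commute)
  ultimately show ?thesis by (simp add: algebra_simps)
qed

text \<open>Concave counterpart: the weighted mean inequality for x^\<theta> y^(1-\<theta>),
  multiplied by y^(\<theta>-1). The slope is a nonpositive power of y, so y must be
  positive.\<close>

lemma powr_below_tangent:
  fixes x y \<theta> :: real
  assumes "0 \<le> x" "0 < y" "0 \<le> \<theta>" "\<theta> \<le> 1"
  shows "x powr \<theta> \<le> y powr \<theta> + \<theta> * y powr (\<theta> - 1) * (x - y)"
proof -
  have "x powr \<theta> = (x powr \<theta> * y powr (1 - \<theta>)) * y powr (\<theta> - 1)"
    using assms by (simp add: mult.assoc flip: powr_add)
  also have "\<dots> \<le> (\<theta> * x + (1 - \<theta>) * y) * y powr (\<theta> - 1)"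
    using assms by (intro mult_right_mono weighted_am_gm) auto
  also have "\<dots> = y powr \<theta> + \<theta> * y powr (\<theta> - 1) * (x - y)"
  proof -
    have "y powr \<theta> = y powr (\<theta> - 1) * y"
      using assms by (simp add: powr_mult_base mult.commute)
    then show ?thesis by (simp add: algebra_simps)
  qed
  finally show ?thesis .
qed

text \<open>Average of the tangent inequalities at the mean m, whose linear terms cancel.\<close>

lemma powr_convex_comb:
  fixes x y q w :: real
  assumes "0 \<le> x" "0 \<le> y" "1 \<le> q" "0 \<le> w" "w \<le> 1"
  shows "(w * x + (1 - w) * y) powr q \<le> w * x powr q + (1 - w) * y powr q"
proof -
  define m where "m = w * x + (1 - w) * y"
  have m: "0 \<le> m" using assms by (simp add: m_def)
  have "w * (m powr q + q * m powr (q - 1) * (x - m)) + (1 - w) * (m powr q + q * m powr (q - 1) * (y - m))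
     \<le> w * x powr q + (1 - w) * y powr q"
    using assms m by (intro add_mono mult_left_mono powr_above_tangent) auto
  moreover have "w * (m powr q + q * m powr (q - 1) * (x - m)) + (1 - w) * (m powr q + q * m powr (q - 1) * (y - m))
     = m powr q + q * m powr (q - 1) * (w * x + (1 - w) * y - m)"
    by (simp add: algebra_simps)
  ultimately show ?thesis by (simp add: m_def)
qed

lemma powr_midpoint:
  fixes x y q :: real
  assumes "0 \<le> x" "0 \<le> y" "1 \<le> q"
  shows "((x + y) / 2) powr q \<le> (x powr q + y powr q) / 2"
  using powr_convex_comb[of x y q "1/2"] assms by (simp add: field_simps)

text \<open>Each summand z satisfies z^s \<le> z (x+y)^(s-1).\<close>

lemma powr_superadd:
  fixes x y s :: real
  assumes "0 \<le> x" "0 \<le> y" "1 \<le> s"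
  shows "x powr s + y powr s \<le> (x + y) powr s"
proof (cases "x + y = 0")
  case True
  then have "x = 0" "y = 0" using assms by auto
  then show ?thesis by simp
next
  case False
  have *: "z powr s \<le> z * (x + y) powr (s - 1)" if "0 \<le> z" "z \<le> x + y" for z
  proof -
    have "z powr s = z * z powr (s - 1)" using that by (cases "z = 0") (auto simp: powr_mult_base)
    also have "\<dots> \<le> z * (x + y) powr (s - 1)"
      using that assms by (intro mult_left_mono powr_mono2) auto
    finally show ?thesis .
  qed
  have "x powr s + y powr s \<le> x * (x + y) powr (s - 1) + y * (x + y) powr (s - 1)"
    using assms by (intro add_mono *) auto
  also have "\<dots> = (x + y) * (x + y) powr (s - 1)" by (simp add: algebra_simps)
  also have "\<dots> = (x + y) powr s" using False assms by (simp add: powr_mult_base)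
  finally show ?thesis .
qed

lemma powr_add_le:
  fixes x y s :: real
  assumes "0 \<le> x" "0 \<le> y" "0 \<le> s"
  shows "(x + y) powr s \<le> 2 powr s * (x powr s + y powr s)"
proof -
  have "(x + y) powr s \<le> (2 * max x y) powr s"
    using assms by (intro powr_mono2) auto
  also have "\<dots> = 2 powr s * max x y powr s" using assms by (simp add: powr_mult)
  also have "\<dots> \<le> 2 powr s * (x powr s + y powr s)"
    by (intro mult_left_mono) (auto simp: max_def)
  finally show ?thesis .
qed

text \<open>Sensible only for finite A, because \<open>sum\<close> over an infinite set is 0;
  finiteness of the wavelet levels is established in \<open>finite_I\<close>.\<close>

definition lpn :: "real \<Rightarrow> 'l set \<Rightarrow> ('l \<Rightarrow> real) \<Rightarrow> real" where
  "lpn p A x = (\<Sum>l\<in>A. \<bar>x l\<bar> powr p) powr (1 / p)"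

lemma lpn_nonneg: "0 \<le> lpn p A x"
  by (simp add: lpn_def)

lemma lpn_powr: "0 < p \<Longrightarrow> lpn p A x powr p = (\<Sum>l\<in>A. \<bar>x l\<bar> powr p)"
  by (simp add: lpn_def powr_powr sum_nonneg)

lemma lpn_eq_0: "0 < p \<Longrightarrow> finite A \<Longrightarrow> lpn p A x = 0 \<longleftrightarrow> (\<forall>l\<in>A. x l = 0)"
  by (auto simp: lpn_def sum_nonneg_eq_0_iff)

lemma lpn_scale: "0 < p \<Longrightarrow> lpn p A (\<lambda>l. b * x l) = \<bar>b\<bar> * lpn p A x"
  by (simp add: lpn_def abs_mult powr_mult powr_powr flip: sum_distrib_left)

text \<open>After normalizing x and y by their norms a and b, the sum is (a+b) times a convex
  combination with weight a/(a+b); convexity of the power is then summed over A.\<close>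

lemma lpn_minkowski:
  assumes "1 \<le> p" "finite A"
  shows "lpn p A (\<lambda>l. x l + y l) \<le> lpn p A x + lpn p A y"
proof (cases "lpn p A x = 0 \<or> lpn p A y = 0")
  case True
  then show ?thesis
  proof
    assume "lpn p A x = 0"
    then have "\<forall>l\<in>A. x l = 0" using assms by (simp add: lpn_eq_0)
    then have "lpn p A (\<lambda>l. x l + y l) = lpn p A y" by (simp add: lpn_def)
    then show ?thesis using lpn_nonneg[of p A x] by linarith
  next
    assume "lpn p A y = 0"
    then have "\<forall>l\<in>A. y l = 0" using assms by (simp add: lpn_eq_0)
    then have "lpn p A (\<lambda>l. x l + y l) = lpn p A x" by (simp add: lpn_def)
    then show ?thesis using lpn_nonneg[of p A y] by linarith
  qed
next
  case False
  define a b where "a = lpn p A x" and "b = lpn p A y"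
  have ab: "0 < a" "0 < b"
    using False lpn_nonneg[of p A x] lpn_nonneg[of p A y] by (auto simp: a_def b_def)
  define w where "w = a / (a + b)"
  have w: "0 \<le> w" "w \<le> 1" and w1: "1 - w = b / (a + b)"
    using ab by (auto simp: w_def field_simps)
  have "\<bar>x l + y l\<bar> powr p \<le> (a + b) powr p * (w * (\<bar>x l\<bar> / a) powr p + (1 - w) * (\<bar>y l\<bar> / b) powr p)" for l
  proof -
    have "\<bar>x l + y l\<bar> powr p \<le> (\<bar>x l\<bar> + \<bar>y l\<bar>) powr p"
      using assms by (intro powr_mono2) auto
    also have "\<bar>x l\<bar> + \<bar>y l\<bar> = (a + b) * (w * (\<bar>x l\<bar> / a) + (1 - w) * (\<bar>y l\<bar> / b))"
      unfolding w1 using ab by (simp add: w_def add_pos_pos less_imp_neq[symmetric] distrib_left)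
    also have "\<dots> powr p = (a + b) powr p * (w * (\<bar>x l\<bar> / a) + (1 - w) * (\<bar>y l\<bar> / b)) powr p"
      using ab w by (simp add: powr_mult)
    also have "\<dots> \<le> (a + b) powr p * (w * (\<bar>x l\<bar> / a) powr p + (1 - w) * (\<bar>y l\<bar> / b) powr p)"
      using ab w assms by (intro mult_left_mono powr_convex_comb) auto
    finally show ?thesis .
  qed
  then have "(\<Sum>l\<in>A. \<bar>x l + y l\<bar> powr p)
      \<le> (\<Sum>l\<in>A. (a + b) powr p * (w * (\<bar>x l\<bar> / a) powr p + (1 - w) * (\<bar>y l\<bar> / b) powr p))"
    by (intro sum_mono)
  also have "\<dots> = (a + b) powr p * (w * ((\<Sum>l\<in>A. \<bar>x l\<bar> powr p) / a powr p)
       + (1 - w) * ((\<Sum>l\<in>A. \<bar>y l\<bar> powr p) / b powr p))"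
    using ab by (simp add: powr_divide sum_distrib_left sum.distrib sum_divide_distrib algebra_simps)
  also have "(\<Sum>l\<in>A. \<bar>x l\<bar> powr p) = a powr p"
    using assms by (simp add: a_def lpn_powr)
  also have "(\<Sum>l\<in>A. \<bar>y l\<bar> powr p) = b powr p"
    using assms by (simp add: b_def lpn_powr)
  finally have "(\<Sum>l\<in>A. \<bar>x l + y l\<bar> powr p) \<le> (a + b) powr p"
    using ab by simp
  then have "(\<Sum>l\<in>A. \<bar>x l + y l\<bar> powr p) powr (1 / p) \<le> ((a + b) powr p) powr (1 / p)"
    using assms by (intro powr_mono2 sum_nonneg) auto
  also have "\<dots> = a + b" using ab assms by (simp add: powr_powr)
  finally show ?thesis by (simp add: lpn_def a_def b_def)
qed

section \<open>Uniform convexity of sequence norms\<close>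

lemma powr_two_point_unit:
  fixes q t :: real
  assumes q: "1 < q" "q \<le> 2" and t: "0 \<le> t" "t \<le> 1"
  shows "1 + q * (q - 1) / 4 * t\<^sup>2 \<le> ((1 + t) powr q + (1 - t) powr q) / 2"
proof -
  define g where "g t = ((1 + t) powr q + (1 - t) powr q) / 2 - q * (q - 1) / 4 * t\<^sup>2" for t :: real
  have "g 0 \<le> g t"
  proof (rule DERIV_nonneg_imp_increasing_open[of 0 t g])
    show "0 \<le> t" by fact
    fix x assume x: "0 < x" "x < t"
    have "(g has_real_derivative (q * (1 + x) powr (q - 1) - q * (1 - x) powr (q - 1)) / 2
         - q * (q - 1) / 4 * (2 * x)) (at x)"
      unfolding g_def using x t by (auto intro!: derivative_eq_intros)
    \<comment> \<open>This crude bound gives up half of the Taylor coefficient q(q-1)/2; hence the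
      constant q(q-1)/4.\<close>
    moreover have "1 \<le> (1 + x) powr (q - 1)"
      using x q by (intro ge_one_powr_ge_zero) auto
    moreover have "(1 - x) powr (q - 1) \<le> 1 - (q - 1) * x"
      using powr_below_tangent[of "1 - x" 1 "q - 1"] x t q by simp
    ultimately have "(g has_real_derivative (q * (1 + x) powr (q - 1) - q * (1 - x) powr (q - 1)) / 2
         - q * (q - 1) / 4 * (2 * x)) (at x)" and
       "q * ((q - 1) * x) \<le> q * ((1 + x) powr (q - 1) - (1 - x) powr (q - 1))"
      using q by (auto intro!: mult_left_mono)
    then show "\<exists>y. (g has_real_derivative y) (at x) \<and> 0 \<le> y"
      by (intro exI[of _ "(q * (1 + x) powr (q - 1) - q * (1 - x) powr (q - 1)) / 2
         - q * (q - 1) / 4 * (2 * x)"] conjI) (simp_all add: field_simps)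
  next
    show "continuous_on {0..t} g"
      unfolding g_def using t q by (intro continuous_intros continuous_on_powr') auto
  qed
  then show ?thesis by (simp add: g_def field_simps)
qed

text \<open>Reduction to \<open>powr_two_point_unit\<close> by homogeneity: \<alpha> = m(1+t) and
  \<beta> = m(1-t), after exchanging \<alpha> and \<beta> if necessary.\<close>

lemma powr_two_point:
  fixes q \<alpha> \<beta> :: real
  assumes q: "1 < q" "q \<le> 2" and "0 \<le> \<alpha>" "0 \<le> \<beta>"
  defines "m \<equiv> (\<alpha> + \<beta>) / 2"
  shows "m powr q + q * (q - 1) / 4 * m powr (q - 2) * ((\<alpha> - \<beta>) / 2)\<^sup>2 \<le> (\<alpha> powr q + \<beta> powr q) / 2"
proof -
  have *: "m powr q + q * (q - 1) / 4 * m powr (q - 2) * ((\<alpha> - \<beta>) / 2)\<^sup>2 \<le> (\<alpha> powr q + \<beta> powr q) / 2"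
    if "\<beta> \<le> \<alpha>" "0 \<le> \<beta>" "m = (\<alpha> + \<beta>) / 2" for \<alpha> \<beta> m
  proof (cases "m = 0")
    case True
    then show ?thesis using that by auto
  next
    case False
    then have m: "0 < m" using that by auto
    define t where "t = (\<alpha> - \<beta>) / 2 / m"
    have t: "0 \<le> t" "t \<le> 1" using that m by (auto simp: t_def field_simps)
    have ab: "\<alpha> = m * (1 + t)" "\<beta> = m * (1 - t)" "(\<alpha> - \<beta>) / 2 = m * t"
      using that m by (auto simp: t_def field_simps)
    have m2: "m powr (q - 2) * m\<^sup>2 = m powr q"
      using m powr_add[of m "q - 2" 2] by simp
    have "m powr q * (1 + q * (q - 1) / 4 * t\<^sup>2) \<le> m powr q * (((1 + t) powr q + (1 - t) powr q) / 2)"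
      by (intro mult_left_mono powr_two_point_unit q t) auto
    also have "\<dots> = (\<alpha> powr q + \<beta> powr q) / 2"
      unfolding ab(1,2) using m t by (simp only: powr_mult) (simp add: algebra_simps)
    also have "m powr q * (1 + q * (q - 1) / 4 * t\<^sup>2) = m powr q + q * (q - 1) / 4 * (m powr (q - 2) * m\<^sup>2) * t\<^sup>2"
      unfolding m2 by (simp add: algebra_simps)
    also have "\<dots> = m powr q + q * (q - 1) / 4 * m powr (q - 2) * ((\<alpha> - \<beta>) / 2)\<^sup>2"
      unfolding ab(3) by (simp add: power_mult_distrib)
    finally show ?thesis .
  qed
  show ?thesis
  proof (cases "\<beta> \<le> \<alpha>")
    case True
    then show ?thesis using *[of \<beta> \<alpha> m] assms by simp
  next
    case False
    then show ?thesis using *[of \<alpha> \<beta> m] assms power2_commute[of "\<alpha> / 2" "\<beta> / 2"]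
      by (simp add: diff_divide_distrib add.commute)
  qed
qed

text \<open>A and D stand for the norms of the half sum and of the difference of two vectors with
  norms \<alpha> and \<beta>. Their 2-convexity is lowered to the power q: concavity of t^(q/2) at
  m^2 accounts for m^2 - A^2, and \<open>powr_two_point\<close> for the spread of \<alpha> and
  \<beta>.\<close>

lemma two_convex_powr:
  fixes q \<alpha> \<beta> A D \<kappa> :: real
  assumes q: "1 < q" "q \<le> 2" and nn: "0 \<le> \<alpha>" "0 \<le> \<beta>" "0 \<le> A" "0 < \<kappa>"
  defines "m \<equiv> (\<alpha> + \<beta>) / 2"
  assumes A: "A \<le> m" and AD: "A\<^sup>2 + \<kappa> * D\<^sup>2 \<le> (\<alpha>\<^sup>2 + \<beta>\<^sup>2) / 2"
  shows "A powr q + \<kappa> * (q * (q - 1) / 4) * (m powr (q - 2) * D\<^sup>2) \<le> (\<alpha> powr q + \<beta> powr q) / 2"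
proof (cases "m = 0")
  case True
  then show ?thesis using assms by auto
next
  case False
  then have m: "0 < m" using nn by (auto simp: m_def)
  define \<delta> where "\<delta> = (\<alpha> - \<beta>) / 2"
  define c where "c = q * (q - 1) / 4"
  have md: "(\<alpha>\<^sup>2 + \<beta>\<^sup>2) / 2 = m\<^sup>2 + \<delta>\<^sup>2"
    by (simp add: m_def \<delta>_def power2_eq_square field_simps)
  have "A powr q = (A\<^sup>2) powr (q / 2)"
    using nn by (cases "A = 0") (auto simp: powr_powr simp flip: powr_numeral)
  also have "\<dots> \<le> (m\<^sup>2) powr (q / 2) + q / 2 * (m\<^sup>2) powr (q / 2 - 1) * (A\<^sup>2 - m\<^sup>2)"
    using m q by (intro powr_below_tangent) auto
  also have "(m\<^sup>2) powr (q / 2) = m powr q"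
    using m by (simp add: powr_powr flip: powr_numeral)
  also have "(m\<^sup>2) powr (q / 2 - 1) = m powr (q - 2)"
    using m by (simp add: powr_powr right_diff_distrib flip: powr_numeral)
  finally have 1: "A powr q \<le> m powr q - q / 2 * (m powr (q - 2) * (m\<^sup>2 - A\<^sup>2))"
    by (simp add: right_diff_distrib)
  have c2: "c \<le> q / 2" "0 \<le> c"
    using q mult_left_mono[of "q - 1" 1 q] by (auto simp: c_def)
  have m2: "A\<^sup>2 \<le> m\<^sup>2" using A nn by (intro power_mono) auto
  \<comment> \<open>Lowering q/2 to c gives m^2 - A^2 and \<delta>^2 the same coefficient; by
    \<open>AD\<close> their sum dominates \<kappa> D^2.\<close>
  have "c * (m powr (q - 2) * (m\<^sup>2 - A\<^sup>2)) \<le> q / 2 * (m powr (q - 2) * (m\<^sup>2 - A\<^sup>2))"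
    using c2 m2 by (intro mult_right_mono) auto
  with 1 have "A powr q + c * (m powr (q - 2) * (m\<^sup>2 - A\<^sup>2 + \<delta>\<^sup>2))
      \<le> m powr q + c * m powr (q - 2) * \<delta>\<^sup>2"
    by (simp add: algebra_simps)
  also have "\<dots> \<le> (\<alpha> powr q + \<beta> powr q) / 2"
    using powr_two_point[OF q nn(1,2)] by (simp add: m_def \<delta>_def c_def)
  finally have 2: "A powr q + c * (m powr (q - 2) * (m\<^sup>2 - A\<^sup>2 + \<delta>\<^sup>2)) \<le> (\<alpha> powr q + \<beta> powr q) / 2" .
  have "c * (m powr (q - 2) * (\<kappa> * D\<^sup>2)) \<le> c * (m powr (q - 2) * (m\<^sup>2 - A\<^sup>2 + \<delta>\<^sup>2))"
    using AD md c2 by (intro mult_left_mono) auto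
  with 2 have "A powr q + c * (m powr (q - 2) * (\<kappa> * D\<^sup>2)) \<le> (\<alpha> powr q + \<beta> powr q) / 2"
    by linarith
  then show ?thesis by (simp only: c_def mult_ac)
qed

text \<open>Hoelder's inequality with the exponents \<open>2/q\<close> and \<open>2/(2-q)\<close>, applied to
  \<open>D\<^sup>q = (m\<^bsup>q-2\<^esup> D\<^sup>2)\<^bsup>q/2\<^esup> (m\<^sup>q)\<^bsup>1-q/2\<^esup>\<close>.\<close>

lemma holder_weighted:
  fixes m D :: "'l \<Rightarrow> real" and q :: real
  assumes fin: "finite A" and q: "1 < q" "q \<le> 2"
    and nn: "\<And>l. l \<in> A \<Longrightarrow> 0 \<le> m l" "\<And>l. l \<in> A \<Longrightarrow> 0 \<le> D l" "\<And>l. l \<in> A \<Longrightarrow> D l \<le> 2 * m l"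
  shows "(\<Sum>l\<in>A. D l powr q) \<le> (\<Sum>l\<in>A. m l powr (q - 2) * (D l)\<^sup>2) powr (q / 2) * (\<Sum>l\<in>A. m l powr q) powr (1 - q / 2)"
proof -
  define G where "G = (\<Sum>l\<in>A. m l powr (q - 2) * (D l)\<^sup>2)"
  define M where "M = (\<Sum>l\<in>A. m l powr q)"
  have G0: "0 \<le> G" unfolding G_def by (intro sum_nonneg) auto
  have M0: "0 \<le> M" unfolding M_def by (intro sum_nonneg) auto
  show ?thesis
  proof (cases "G = 0 \<or> M = 0")
    case True
    have "D l = 0" if "l \<in> A" for l
    proof -
      have "m l powr (q - 2) * (D l)\<^sup>2 = 0 \<or> m l powr q = 0"
        using True that fin by (auto simp: G_def M_def sum_nonneg_eq_0_iff)
      \<comment> \<open>Where m vanishes, so does D, because D \<le> 2m.\<close>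
      then show ?thesis using nn[OF that] by auto
    qed
    then show ?thesis by simp
  next
    case False
    then have GM: "0 < G" "0 < M" using G0 M0 by auto
    have "D l powr q \<le> G powr (q / 2) * M powr (1 - q / 2) *
        (q / 2 * (m l powr (q - 2) * (D l)\<^sup>2 / G) + (1 - q / 2) * (m l powr q / M))" if "l \<in> A" for l
    proof (cases "m l = 0")
      case True
      then have "D l = 0" using nn[OF that] by auto
      then show ?thesis using GM True by simp
    next
      case F: False
      then have ml: "0 < m l" using nn[OF that] by auto
      have "D l powr q = (m l powr (q - 2) * (D l)\<^sup>2) powr (q / 2) * (m l powr q) powr (1 - q / 2)"
      proof (cases "D l = 0")
        case False
        then have Dl: "0 < D l" using nn(2)[OF that] by auto
        have "(m l powr (q - 2) * (D l)\<^sup>2) powr (q / 2) = m l powr ((q - 2) * (q / 2)) * D l powr q"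
          using Dl ml by (simp add: powr_mult powr_powr flip: powr_numeral)
        moreover have "m l powr ((q - 2) * (q / 2)) * (m l powr q) powr (1 - q / 2) = 1"
          using ml by (simp add: powr_powr field_simps flip: powr_add)
        ultimately show ?thesis by (simp add: mult.assoc mult.commute mult.left_commute)
      qed (use q in auto)
      also have "\<dots> = G powr (q / 2) * M powr (1 - q / 2) *
          ((m l powr (q - 2) * (D l)\<^sup>2 / G) powr (q / 2) * (m l powr q / M) powr (1 - q / 2))"
        using GM by (simp add: powr_divide)
      also have "\<dots> \<le> G powr (q / 2) * M powr (1 - q / 2) *
        (q / 2 * (m l powr (q - 2) * (D l)\<^sup>2 / G) + (1 - q / 2) * (m l powr q / M))"
        using GM q by (intro mult_left_mono weighted_am_gm) auto
      finally show ?thesis .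
    qed
    then have "(\<Sum>l\<in>A. D l powr q) \<le> (\<Sum>l\<in>A. G powr (q / 2) * M powr (1 - q / 2) *
        (q / 2 * (m l powr (q - 2) * (D l)\<^sup>2 / G) + (1 - q / 2) * (m l powr q / M)))"
      by (rule sum_mono)
    also have "\<dots> = G powr (q / 2) * M powr (1 - q / 2) * (q / 2 * (G / G) + (1 - q / 2) * (M / M))"
      unfolding G_def M_def
      by (simp only: sum_distrib_left[symmetric] sum.distrib sum_divide_distrib[symmetric])
    also have "\<dots> = G powr (q / 2) * M powr (1 - q / 2)"
      using GM by simp
    finally show ?thesis by (simp add: G_def M_def)
  qed
qed

text \<open>Summing \<open>two_convex_powr\<close> gives SA + cG \<le> T. Hoelder turns G into SD
  through SD^(2/q) \<le> G T^(2/q-1), and since SA \<le> T the whole left side is at most (SA + cG)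
  T^(2/q-1). The lemma is used twice: on coefficients, to pass from scalars to l^p, and on level
  norms, to pass from l^p to l^q(l^p).\<close>

lemma two_convex_sum:
  fixes \<alpha> \<beta> A D :: "'l \<Rightarrow> real" and q \<kappa> :: real
  assumes fin: "finite S" and q: "1 < q" "q \<le> 2" and \<kappa>: "0 < \<kappa>"
    and nn: "\<And>l. l \<in> S \<Longrightarrow> 0 \<le> \<alpha> l" "\<And>l. l \<in> S \<Longrightarrow> 0 \<le> \<beta> l" "\<And>l. l \<in> S \<Longrightarrow> 0 \<le> A l" "\<And>l. l \<in> S \<Longrightarrow> 0 \<le> D l"
    and A: "\<And>l. l \<in> S \<Longrightarrow> A l \<le> (\<alpha> l + \<beta> l) / 2"
    and D: "\<And>l. l \<in> S \<Longrightarrow> D l \<le> \<alpha> l + \<beta> l"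
    and AD: "\<And>l. l \<in> S \<Longrightarrow> (A l)\<^sup>2 + \<kappa> * (D l)\<^sup>2 \<le> ((\<alpha> l)\<^sup>2 + (\<beta> l)\<^sup>2) / 2"
  shows "(\<Sum>l\<in>S. A l powr q) powr (2 / q) + \<kappa> * (q * (q - 1) / 4) * (\<Sum>l\<in>S. D l powr q) powr (2 / q)
    \<le> ((\<Sum>l\<in>S. \<alpha> l powr q) powr (2 / q) + (\<Sum>l\<in>S. \<beta> l powr q) powr (2 / q)) / 2"
proof -
  define c where "c = \<kappa> * (q * (q - 1) / 4)"
  define m where "m l = (\<alpha> l + \<beta> l) / 2" for l
  define G where "G = (\<Sum>l\<in>S. m l powr (q - 2) * (D l)\<^sup>2)"
  define M where "M = (\<Sum>l\<in>S. m l powr q)"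
  define SA where "SA = (\<Sum>l\<in>S. A l powr q)"
  define SD where "SD = (\<Sum>l\<in>S. D l powr q)"
  define Sa where "Sa = (\<Sum>l\<in>S. \<alpha> l powr q)"
  define Sb where "Sb = (\<Sum>l\<in>S. \<beta> l powr q)"
  define T where "T = (Sa + Sb) / 2"
  have nns: "0 \<le> G" "0 \<le> M" "0 \<le> SA" "0 \<le> SD" "0 \<le> Sa" "0 \<le> Sb"
    unfolding G_def M_def SA_def SD_def Sa_def Sb_def by (intro sum_nonneg; simp)+
  have c: "0 < c" using q \<kappa> by (simp add: c_def)
  have "(\<Sum>l\<in>S. A l powr q + c * (m l powr (q - 2) * (D l)\<^sup>2)) \<le> (\<Sum>l\<in>S. (\<alpha> l powr q + \<beta> l powr q) / 2)"
    unfolding c_def m_def using nn A AD by (intro sum_mono two_convex_powr q \<kappa>) auto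
  then have 1: "SA + c * G \<le> T"
    by (simp add: SA_def G_def T_def Sa_def Sb_def sum.distrib sum_distrib_left flip: sum_divide_distrib)
  have "M \<le> (\<Sum>l\<in>S. (\<alpha> l powr q + \<beta> l powr q) / 2)"
    unfolding M_def m_def using nn q by (intro sum_mono powr_midpoint) auto
  then have MT: "M \<le> T"
    by (simp add: T_def Sa_def Sb_def sum.distrib flip: sum_divide_distrib)
  have Dm: "D l \<le> 2 * m l" if "l \<in> S" for l
    using D[OF that] by (simp add: m_def)
  have "SD \<le> G powr (q / 2) * M powr (1 - q / 2)"
    unfolding SD_def G_def M_def using nn Dm by (intro holder_weighted fin q) (auto simp: m_def)
  also have "\<dots> \<le> G powr (q / 2) * T powr (1 - q / 2)"
    using nns MT q by (intro mult_left_mono powr_mono2) auto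
  finally have "SD powr (2 / q) \<le> (G powr (q / 2) * T powr (1 - q / 2)) powr (2 / q)"
    using nns q by (intro powr_mono2) auto
  also have "\<dots> = G * T powr (2 / q - 1)"
    using nns q by (simp add: powr_mult powr_powr diff_divide_distrib)
  finally have 2: "SD powr (2 / q) \<le> G * T powr (2 / q - 1)" .
  have T0: "0 \<le> T" using nns by (simp add: T_def)
  have pw: "z powr (2 / q) = z * z powr (2 / q - 1)" if "0 \<le> z" for z
    using that by (cases "z = 0") (auto simp: powr_mult_base)
  have "c * G \<ge> 0" using c nns by simp
  then have SAT: "SA \<le> T" using 1 by simp
  have "SA powr (2 / q) + c * SD powr (2 / q) \<le> SA * T powr (2 / q - 1) + c * (G * T powr (2 / q - 1))"
  proof (intro add_mono mult_left_mono 2)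
    show "SA powr (2 / q) \<le> SA * T powr (2 / q - 1)"
      unfolding pw[OF nns(3)] using nns SAT q by (intro mult_left_mono powr_mono2) auto
  qed (use c in auto)
  also have "\<dots> = (SA + c * G) * T powr (2 / q - 1)" by (simp add: algebra_simps)
  also have "\<dots> \<le> T * T powr (2 / q - 1)" using 1 by (intro mult_right_mono) auto
  also have "\<dots> = T powr (2 / q)" using pw[OF T0] by simp
  also have "\<dots> \<le> (Sa powr (2 / q) + Sb powr (2 / q)) / 2"
    unfolding T_def using nns q by (intro powr_midpoint) auto
  finally show ?thesis by (simp add: SA_def SD_def Sa_def Sb_def c_def)
qed

text \<open>The scalar identity ((x+y)/2)^2 + (x-y)^2/4 = (x^2+y^2)/2 gives \<kappa> = 1/4 in
  \<open>two_convex_sum\<close>, hence the constant p(p-1)/16.\<close>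

lemma lpn_two_convex:
  assumes "finite S" and p: "1 < p" "p \<le> 2"
  shows "(lpn p S (\<lambda>l. (x l + y l) / 2))\<^sup>2 + p * (p - 1) / 16 * (lpn p S (\<lambda>l. x l - y l))\<^sup>2
    \<le> ((lpn p S x)\<^sup>2 + (lpn p S y)\<^sup>2) / 2"
proof -
  have sq: "(lpn p S z)\<^sup>2 = (\<Sum>l\<in>S. \<bar>z l\<bar> powr p) powr (2 / p)" for z
    using p by (simp add: lpn_def powr_powr sum_nonneg flip: powr_numeral)
  have "(\<Sum>l\<in>S. \<bar>(x l + y l) / 2\<bar> powr p) powr (2 / p)
      + (1 / 4) * (p * (p - 1) / 4) * (\<Sum>l\<in>S. \<bar>x l - y l\<bar> powr p) powr (2 / p)
    \<le> ((\<Sum>l\<in>S. \<bar>x l\<bar> powr p) powr (2 / p) + (\<Sum>l\<in>S. \<bar>y l\<bar> powr p) powr (2 / p)) / 2"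
  proof (rule two_convex_sum)
    show "\<bar>(x l + y l) / 2\<bar>\<^sup>2 + 1 / 4 * \<bar>x l - y l\<bar>\<^sup>2 \<le> (\<bar>x l\<bar>\<^sup>2 + \<bar>y l\<bar>\<^sup>2) / 2" for l
      by (simp add: power2_eq_square field_simps)
  qed (use assms in auto)
  then show ?thesis unfolding sq by simp
qed

lemma suminf_powr_limit:
  fixes f :: "nat \<Rightarrow> real"
  assumes "summable f" "\<And>j. 0 \<le> f j" "0 < s"
  shows "(\<lambda>n. (\<Sum>j<n. f j) powr s) \<longlonglongrightarrow> (\<Sum>j. f j) powr s"
  using assms by (intro tendsto_powr' summable_LIMSEQ tendsto_const) (auto intro!: always_eventually sum_nonneg)

text \<open>The constant of uniform convexity of \<open>\<ell>\<^sup>q(\<ell>\<^sup>p)\<close>, given the constant \<open>\<kappa>\<close> of \<open>\<ell>\<^sup>p\<close>.\<close>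

definition conv_const :: "real \<Rightarrow> real \<Rightarrow> real" where
  "conv_const q \<kappa> = (if 2 \<le> q then \<kappa> powr (q / 2) else \<kappa> * (q * (q - 1) / 4))"

lemma conv_const_pos: "1 < q \<Longrightarrow> 0 < \<kappa> \<Longrightarrow> 0 < conv_const q \<kappa>"
  by (auto simp: conv_const_def)

text \<open>\<alpha>, \<beta>, A, D are the level norms of two sequences, of their mean and of their
  difference. For q \<ge> 2 the exponent r/q is 1 and the levels simply add up, by superadditivity
  and Jensen for the power q/2; for q < 2 the partial sums obey \<open>two_convex_sum\<close>. In
  both cases the partial sums pass to the limit.\<close>

lemma uniformly_convex_series:
  fixes \<alpha> \<beta> A D :: "nat \<Rightarrow> real" and q \<kappa> r :: real
  assumes q: "1 < q" and r: "r = max 2 q" and \<kappa>: "0 < \<kappa>"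
    and nn: "\<And>l. 0 \<le> \<alpha> l" "\<And>l. 0 \<le> \<beta> l" "\<And>l. 0 \<le> A l" "\<And>l. 0 \<le> D l"
    and A: "\<And>l. A l \<le> (\<alpha> l + \<beta> l) / 2"
    and D: "\<And>l. D l \<le> \<alpha> l + \<beta> l"
    and AD: "\<And>l. (A l)\<^sup>2 + \<kappa> * (D l)\<^sup>2 \<le> ((\<alpha> l)\<^sup>2 + (\<beta> l)\<^sup>2) / 2"
    and sm: "summable (\<lambda>j. \<alpha> j powr q)" "summable (\<lambda>j. \<beta> j powr q)"
  shows "(\<Sum>j. A j powr q) powr (r / q) + conv_const q \<kappa> * (\<Sum>j. D j powr q) powr (r / q)
    \<le> ((\<Sum>j. \<alpha> j powr q) powr (r / q) + (\<Sum>j. \<beta> j powr q) powr (r / q)) / 2"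
proof -
  have sA: "summable (\<lambda>j. A j powr q)"
  proof (rule summable_comparison_test')
    show "summable (\<lambda>j. (\<alpha> j powr q + \<beta> j powr q) / 2)"
      using sm by (intro summable_divide summable_add)
    show "norm (A j powr q) \<le> (\<alpha> j powr q + \<beta> j powr q) / 2" for j
      using powr_mono2[OF _ nn(3) A[of j], of q] powr_midpoint[OF nn(1,2)[of j], of q] q by simp
  qed
  have sD: "summable (\<lambda>j. D j powr q)"
  proof (rule summable_comparison_test')
    show "summable (\<lambda>j. 2 powr q * (\<alpha> j powr q + \<beta> j powr q))"
      using sm by (intro summable_mult summable_add)
    show "norm (D j powr q) \<le> 2 powr q * (\<alpha> j powr q + \<beta> j powr q)" for j
      using powr_mono2[OF _ nn(4) D[of j], of q] powr_add_le[OF nn(1,2)[of j], of q] q by simp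
  qed
  have "(\<Sum>j<n. A j powr q) powr (r / q) + conv_const q \<kappa> * (\<Sum>j<n. D j powr q) powr (r / q)
    \<le> ((\<Sum>j<n. \<alpha> j powr q) powr (r / q) + (\<Sum>j<n. \<beta> j powr q) powr (r / q)) / 2" for n
  proof (cases "2 \<le> q")
    case True
    have *: "A j powr q + \<kappa> powr (q / 2) * D j powr q \<le> (\<alpha> j powr q + \<beta> j powr q) / 2" for j
    proof -
      have sq: "(z\<^sup>2) powr (q / 2) = z powr q" if "0 \<le> z" for z :: real
        using that by (cases "z = 0") (auto simp: powr_powr simp flip: powr_numeral)
      have "A j powr q + \<kappa> powr (q / 2) * D j powr q = ((A j)\<^sup>2) powr (q / 2) + (\<kappa> * (D j)\<^sup>2) powr (q / 2)"
        using nn \<kappa> by (simp add: powr_mult sq)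
      also have "\<dots> \<le> ((A j)\<^sup>2 + \<kappa> * (D j)\<^sup>2) powr (q / 2)"
        using \<kappa> True by (intro powr_superadd) auto
      also have "\<dots> \<le> (((\<alpha> j)\<^sup>2 + (\<beta> j)\<^sup>2) / 2) powr (q / 2)"
        using \<kappa> True AD by (intro powr_mono2) auto
      also have "\<dots> \<le> (((\<alpha> j)\<^sup>2) powr (q / 2) + ((\<beta> j)\<^sup>2) powr (q / 2)) / 2"
        using True by (intro powr_midpoint) auto
      finally show ?thesis using nn by (simp add: sq)
    qed
    have "(\<Sum>j<n. A j powr q + \<kappa> powr (q / 2) * D j powr q) \<le> (\<Sum>j<n. (\<alpha> j powr q + \<beta> j powr q) / 2)"
      by (intro sum_mono *)
    then show ?thesis
      using True q r by (simp add: conv_const_def sum.distrib sum_nonneg flip: sum_divide_distrib sum_distrib_left)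
  next
    case False
    then show ?thesis
      using two_convex_sum[of "{..<n}" q \<kappa> \<alpha> \<beta> A D] q \<kappa> nn A D AD r by (simp add: conv_const_def)
  qed
  then have le: "\<exists>N. \<forall>n\<ge>N. (\<Sum>j<n. A j powr q) powr (r / q) + conv_const q \<kappa> * (\<Sum>j<n. D j powr q) powr (r / q)
    \<le> ((\<Sum>j<n. \<alpha> j powr q) powr (r / q) + (\<Sum>j<n. \<beta> j powr q) powr (r / q)) / 2"
    by blast
  have rq: "0 < r / q" using q r by simp
  show ?thesis
    by (rule LIMSEQ_le[OF _ _ le]; intro tendsto_add tendsto_mult tendsto_divide tendsto_const
        suminf_powr_limit sA sD sm rq; simp)
qed

text \<open>The tangent at the shifted point u + tv bounds the increment by t q v (u+tv)^(q-1);
  splitting this power by \<open>powr_add_le\<close> costs the factor 2^(q-1). The remainder carries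
  t^(q-1) and vanishes as t tends to 0.\<close>

lemma suminf_powr_shift_le:
  fixes u v :: "nat \<Rightarrow> real" and q t :: real
  assumes q: "1 < q" and nn: "\<And>j. 0 \<le> u j" "\<And>j. 0 \<le> v j"
    and sm: "summable (\<lambda>j. u j powr q)" "summable (\<lambda>j. v j powr q)" and t: "0 \<le> t"
  shows "summable (\<lambda>j. u j powr (q - 1) * v j)"
    and "summable (\<lambda>j. (u j + t * v j) powr q)"
    and "(\<Sum>j. (u j + t * v j) powr q) \<le> (\<Sum>j. u j powr q) +
      t * (q * 2 powr (q - 1) * ((\<Sum>j. u j powr (q - 1) * v j) + t powr (q - 1) * (\<Sum>j. v j powr q)))"
proof -
  have vq: "v j powr q = v j powr (q - 1) * v j" for j
    using nn(2)[of j] by (cases "v j = 0") (auto simp: powr_mult_base mult.commute)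
  show 1: "summable (\<lambda>j. u j powr (q - 1) * v j)"
  proof (rule summable_comparison_test')
    show "summable (\<lambda>j. u j powr q + v j powr q)" by (intro summable_add sm)
    fix j
    have "u j powr (q - 1) * v j \<le> max (u j) (v j) powr (q - 1) * max (u j) (v j)"
      using nn q by (intro mult_mono powr_mono2) (auto simp: le_max_iff_disj)
    also have "\<dots> = max (u j) (v j) powr q"
      using nn(1)[of j] powr_mult_base[of "max (u j) (v j)" "q - 1"] q
      by (cases "max (u j) (v j) = 0") (auto simp: mult.commute)
    also have "\<dots> \<le> u j powr q + v j powr q" by (auto simp: max_def)
    finally show "norm (u j powr (q - 1) * v j) \<le> u j powr q + v j powr q" using nn by simp
  qed
  define E where "E j = q * 2 powr (q - 1) * (u j powr (q - 1) * v j + t powr (q - 1) * v j powr q)" for j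
  have sE: "summable E"
    unfolding E_def by (intro summable_mult summable_add 1 sm)
  have *: "(u j + t * v j) powr q \<le> u j powr q + t * E j" for j
  proof -
    have z: "0 \<le> u j + t * v j" using nn t by simp
    have "(u j + t * v j) powr q + q * (u j + t * v j) powr (q - 1) * (u j - (u j + t * v j)) \<le> u j powr q"
      using nn z q by (intro powr_above_tangent) auto
    then have "(u j + t * v j) powr q \<le> u j powr q + t * (q * (v j * (u j + t * v j) powr (q - 1)))"
      by (simp add: algebra_simps)
    also have "\<dots> \<le> u j powr q + t * (q * (v j * (2 powr (q - 1) * (u j powr (q - 1) + (t * v j) powr (q - 1)))))"
      using nn t q by (intro add_left_mono mult_left_mono powr_add_le) auto
    also have "\<dots> = u j powr q + t * E j"
      unfolding E_def vq using nn t by (simp add: powr_mult algebra_simps)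
    finally show ?thesis .
  qed
  show 2: "summable (\<lambda>j. (u j + t * v j) powr q)"
    by (rule summable_comparison_test'[OF summable_add[OF sm(1) summable_mult[OF sE]]])
      (use * in simp)
  have "(\<Sum>j. (u j + t * v j) powr q) \<le> (\<Sum>j. u j powr q + t * E j)"
    by (intro suminf_le * 2 summable_add sm summable_mult sE)
  also have "\<dots> = (\<Sum>j. u j powr q) + t * (\<Sum>j. E j)"
    by (simp add: suminf_add[symmetric] suminf_mult sm sE summable_mult)
  also have "(\<Sum>j. E j) = q * 2 powr (q - 1) * ((\<Sum>j. u j powr (q - 1) * v j) + t powr (q - 1) * (\<Sum>j. v j powr q))"
    unfolding E_def by (simp add: suminf_add[symmetric] suminf_mult sm 1 summable_mult summable_add)
  finally show "(\<Sum>j. (u j + t * v j) powr q) \<le> (\<Sum>j. u j powr q) +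
      t * (q * 2 powr (q - 1) * ((\<Sum>j. u j powr (q - 1) * v j) + t powr (q - 1) * (\<Sum>j. v j powr q)))" .
qed

text \<open>Up to the factor \<open>2\<^bsup>q-1\<^esup>\<close> the right-hand side is the derivative at 0 of the function
  of \<open>t\<close> in the hypothesis.\<close>

lemma directional_derivative_bound:
  fixes u v :: "nat \<Rightarrow> real" and q r x :: real
  assumes q: "1 < q" "q \<le> r" and nn: "\<And>j. 0 \<le> u j" "\<And>j. 0 \<le> v j"
    and sm: "summable (\<lambda>j. u j powr q)" "summable (\<lambda>j. v j powr q)"
    and x: "\<And>t. 0 < t \<Longrightarrow> t \<le> 1 \<Longrightarrow> 1 / r * (\<Sum>j. u j powr q) powr (r / q) + t * x
      \<le> 1 / r * (\<Sum>j. (u j + t * v j) powr q) powr (r / q)"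
  shows "x \<le> 2 powr (q - 1) * ((\<Sum>j. u j powr q) powr ((r - q) / q) * (\<Sum>j. u j powr (q - 1) * v j))"
proof -
  define U V P where "U = (\<Sum>j. u j powr q)" and "V = (\<Sum>j. v j powr q)"
    and "P = (\<Sum>j. u j powr (q - 1) * v j)"
  define E where "E t = q * 2 powr (q - 1) * (P + t powr (q - 1) * V)" for t
  have nnU: "0 \<le> U" "0 \<le> V" "0 \<le> P"
    unfolding U_def V_def P_def using nn suminf_powr_shift_le(1)[OF q(1) nn sm, of 0]
    by (auto intro!: suminf_nonneg sm)
  have r0: "0 < r" using q by auto
  have limR: "((\<lambda>t. t powr b) \<longlongrightarrow> 0) (at_right 0)" if "0 < b" for b :: real
  proof -
    have "((\<lambda>t. t powr b) \<longlongrightarrow> 0 powr b) (at_right 0)"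
      using that by (intro tendsto_powr' tendsto_intros)
        (auto simp: eventually_at_right_field intro!: exI[of _ 1])
    then show ?thesis using that by simp
  qed
  have limE: "(E \<longlongrightarrow> q * 2 powr (q - 1) * P) (at_right 0)"
  proof -
    have "(E \<longlongrightarrow> q * 2 powr (q - 1) * (P + 0 * V)) (at_right 0)"
      unfolding E_def using q by (intro tendsto_mult tendsto_add tendsto_const limR) auto
    then show ?thesis by simp
  qed
  show ?thesis
  proof (cases "U = 0")
    case True
    then have "u j = 0" for j
      using sm(1) suminf_eq_zero_iff[of "\<lambda>j. u j powr q"] nn by (auto simp: U_def)
    then have u0: "u = (\<lambda>_. 0)" by auto
    \<comment> \<open>At u = 0 the claim reads x \<le> 0; it holds because the function of t is of
      order t^r with r > 1.\<close>
    have *: "x \<le> 1 / r * V powr (r / q) * t powr (r - 1)" if "0 < t" "t \<le> 1" for t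
    proof -
      have "(\<Sum>j. (t * v j) powr q) = t powr q * V"
        unfolding V_def using sm(2) nn that by (simp add: powr_mult suminf_mult)
      then have "t * x \<le> 1 / r * (t powr q * V) powr (r / q)"
        using x[OF that] q u0 by simp
      also have "\<dots> = t * (1 / r * V powr (r / q) * t powr (r - 1))"
        using that nnU q powr_mult_base[of t "r - 1"] by (simp add: powr_mult powr_powr)
      finally show ?thesis using that(1) by (rule mult_left_le_imp_le)
    qed
    have "x \<le> 1 / r * V powr (r / q) * 0"
    proof (rule tendsto_lowerbound)
      show "((\<lambda>t. 1 / r * V powr (r / q) * t powr (r - 1)) \<longlongrightarrow> 1 / r * V powr (r / q) * 0) (at_right 0)"
        using q by (intro tendsto_intros limR) auto
      show "\<forall>\<^sub>F t in at_right 0. x \<le> 1 / r * V powr (r / q) * t powr (r - 1)"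
        by (rule eventually_at_rightI[of 0 1]) (use * in auto)
    qed auto
    then show ?thesis using u0 q by simp
  next
    case False
    then have U: "0 < U" using nnU by auto
    have *: "x \<le> 1 / q * (E t * (U + t * E t) powr (r / q - 1))" if t: "0 < t" "t \<le> 1" for t
    proof -
      have E0: "0 \<le> E t" unfolding E_def using nnU q by simp
      define Z where "Z = U + t * E t"
      have Z: "0 \<le> Z" using U E0 t by (simp add: Z_def)
      have "(\<Sum>j. (u j + t * v j) powr q) \<le> Z"
        unfolding Z_def U_def E_def P_def V_def
        using t by (intro suminf_powr_shift_le(3) q nn sm) auto
      then have "(\<Sum>j. (u j + t * v j) powr q) powr (r / q) \<le> Z powr (r / q)"
        using q nn t by (intro powr_mono2 suminf_nonneg suminf_powr_shift_le(2) sm) auto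
      \<comment> \<open>Tangent at the larger point Z, evaluated at U and read as an upper bound for
        the power of Z; here Z - U = t E(t).\<close>
      also have "\<dots> \<le> U powr (r / q) + r / q * (t * (E t * Z powr (r / q - 1)))"
        using powr_above_tangent[of U Z "r / q"] U Z q by (simp add: Z_def algebra_simps)
      finally have "1 / r * U powr (r / q) + t * x \<le> 1 / r * (U powr (r / q) + r / q * (t * (E t * Z powr (r / q - 1))))"
        using x[OF t] mult_left_mono[of _ _ "1 / r"] r0 unfolding U_def by (smt (verit) divide_nonneg_pos)
      also have "\<dots> = 1 / r * U powr (r / q) + t * (1 / q * (E t * Z powr (r / q - 1)))"
        using r0 by (simp add: field_simps)
      finally have "t * x \<le> t * (1 / q * (E t * Z powr (r / q - 1)))" by simp
      then have "x \<le> 1 / q * (E t * Z powr (r / q - 1))"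
        using t(1) by (rule mult_left_le_imp_le)
      then show ?thesis by (simp add: Z_def)
    qed
    have "x \<le> 1 / q * (q * 2 powr (q - 1) * P * (U + 0 * (q * 2 powr (q - 1) * P)) powr (r / q - 1))"
    proof (rule tendsto_lowerbound)
      show "((\<lambda>t. 1 / q * (E t * (U + t * E t) powr (r / q - 1))) \<longlongrightarrow>
        1 / q * (q * 2 powr (q - 1) * P * (U + 0 * (q * 2 powr (q - 1) * P)) powr (r / q - 1))) (at_right 0)"
        using U by (intro tendsto_intros limE) auto
      show "\<forall>\<^sub>F t in at_right 0. x \<le> 1 / q * (E t * (U + t * E t) powr (r / q - 1))"
        by (rule eventually_at_rightI[of 0 1]) (use * in auto)
    qed auto
    also have "\<dots> = 2 powr (q - 1) * (U powr ((r - q) / q) * P)"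
      using q by (simp add: diff_divide_distrib)
    finally show ?thesis by (simp add: U_def P_def)
  qed
qed

text \<open>Young's inequality for (kn)(Kb/k), with k chosen so that (kn)^r/r is exactly c0 n^r. The
  summand 1 in C keeps it positive when K = 0.\<close>

lemma powr_young:
  fixes r c0 K :: real
  assumes r: "1 < r" and c: "0 < c0" and K: "0 \<le> K"
  obtains C where "0 < C" "\<And>b n. 0 \<le> b \<Longrightarrow> 0 \<le> n \<Longrightarrow> K * (b * n) \<le> c0 * n powr r + C * b powr (r / (r - 1))"
proof -
  define k where "k = (c0 * r) powr (1 / r)"
  define r' where "r' = r / (r - 1)"
  have k: "0 < k" using r c by (simp add: k_def)
  have r': "1 < r'" "1 / r + 1 / r' = 1"
    using r by (auto simp: r'_def field_simps)
  define C where "C = (K / k) powr r' + 1"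
  have C: "0 < C" unfolding C_def by (smt (verit) powr_ge_zero)
  have "K * (b * n) \<le> c0 * n powr r + C * b powr r'" if "0 \<le> b" "0 \<le> n" for b n
  proof -
    have "(k * n) * (K / k * b) \<le> (k * n) powr r / r + (K / k * b) powr r' / r'"
      using that k K r r' by (intro Youngs_inequality) auto
    also have "(k * n) powr r / r = c0 * n powr r"
      using that k r c by (simp add: powr_mult k_def powr_powr)
    also have "(K / k * b) powr r' / r' \<le> (K / k * b) powr r'"
    proof -
      have "z / r' \<le> z / 1" if "0 \<le> z" for z
        using r' that by (intro divide_left_mono) auto
      then show ?thesis by simp
    qed
    also have "\<dots> \<le> C * b powr r'"
      unfolding C_def powr_mult by (simp add: algebra_simps)
    finally show ?thesis using k by (simp add: algebra_simps)
  qed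
  with C show ?thesis using that r'_def by blast
qed

text \<open>The cutoff level \<open>J\<close> is chosen with \<open>2\<^bsup>J(a+\<gamma>)\<^esup>\<close> of the order of \<open>\<rho>/e\<close>.\<close>

lemma balance_cutoff:
  fixes a \<gamma> r K c0 :: real
  assumes r: "1 < r" and \<gamma>: "0 < \<gamma>" "\<gamma> * (r - 1) < a" and K: "0 < K" and c0: "0 < c0"
  obtains c where "0 < c" "\<And>\<rho> e n x. 0 < \<rho> \<Longrightarrow> 0 < e \<Longrightarrow> 0 \<le> n \<Longrightarrow> x \<le> K * (\<rho> powr (r - 1) * n) \<Longrightarrow>
    (\<And>J. x \<le> K * (\<rho> powr (r - 1) * (2 powr (real J * (a - \<gamma> * (r - 1))) * e + 2 powr (- real J * (\<gamma> * (r - 1))) * n))) \<Longrightarrow>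
    x \<le> c0 * n powr r + c * \<rho> powr (r * a / (a + \<gamma>)) * e powr (r * \<gamma> / (a + \<gamma>))"
proof -
  obtain C where C: "0 < C" "\<And>b n. 0 \<le> b \<Longrightarrow> 0 \<le> n \<Longrightarrow> K * (b * n) \<le> c0 * n powr r + C * b powr (r / (r - 1))"
    using powr_young[OF r c0, of K] K by auto
  have a: "0 < a" using \<gamma> r mult_pos_pos[of \<gamma> "r - 1"] by linarith
  define c where "c = K + C * 2 powr (\<gamma> * r)"
  have "0 < c" using K C by (simp add: c_def add_pos_pos)
  moreover have "x \<le> c0 * n powr r + c * \<rho> powr (r * a / (a + \<gamma>)) * e powr (r * \<gamma> / (a + \<gamma>))"
    if \<rho>: "0 < \<rho>" and e: "0 < e" and n: "0 \<le> n" and x0: "x \<le> K * (\<rho> powr (r - 1) * n)"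
    and xJ: "\<And>J. x \<le> K * (\<rho> powr (r - 1) * (2 powr (real J * (a - \<gamma> * (r - 1))) * e + 2 powr (- real J * (\<gamma> * (r - 1))) * n))"
    for \<rho> e n x
  proof (cases "e \<le> \<rho>")
    case False
    have "x \<le> c0 * n powr r + C * (\<rho> powr (r - 1)) powr (r / (r - 1))"
      using x0 C(2)[of "\<rho> powr (r - 1)" n] n by simp
    also have "(\<rho> powr (r - 1)) powr (r / (r - 1)) = \<rho> powr r"
      using r by (simp add: powr_powr)
    also have "\<dots> = \<rho> powr (r * a / (a + \<gamma>)) * \<rho> powr (r * \<gamma> / (a + \<gamma>))"
    proof -
      have "r * a / (a + \<gamma>) + r * \<gamma> / (a + \<gamma>) = r * (a + \<gamma>) / (a + \<gamma>)"
        by (simp only: distrib_left add_divide_distrib)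
      then have "r * a / (a + \<gamma>) + r * \<gamma> / (a + \<gamma>) = r" using a \<gamma> by simp
      then show ?thesis by (simp flip: powr_add)
    qed
    also have "\<dots> \<le> \<rho> powr (r * a / (a + \<gamma>)) * e powr (r * \<gamma> / (a + \<gamma>))"
      using False \<rho> a \<gamma> r by (intro mult_left_mono powr_mono2) auto
    also have "C * \<dots> \<le> c * \<dots>"
    proof (intro mult_right_mono)
      have "C * 1 \<le> C * 2 powr (\<gamma> * r)"
        using C r \<gamma> by (intro mult_left_mono ge_one_powr_ge_zero) auto
      then show "C \<le> c" using K by (simp add: c_def)
    qed auto
    finally show ?thesis using C(1) by (simp add: mult.assoc)
  next
    case True
    \<comment> \<open>At the real level T both terms are, after Young, of the order \<rho>^r
      2^(-T\<gamma>r), because \<gamma>(r-1) + \<gamma> = \<gamma>r. Rounding down to J only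
      decreases the growing term and costs the decaying one the factor 2^(\<gamma>r).\<close>
    define T where "T = log 2 (\<rho> / e) / (a + \<gamma>)"
    have T0: "0 \<le> T" using True e \<rho> a \<gamma> by (simp add: T_def)
    define J where "J = nat \<lfloor>T\<rfloor>"
    have J: "real J \<le> T" "T \<le> real J + 1" using T0 by (auto simp: J_def)
    have \<rho>e: "\<rho> = e * 2 powr (T * (a + \<gamma>))"
      using a \<gamma> e \<rho> by (simp add: T_def)
    define \<beta> where "\<beta> = \<gamma> * (r - 1)"
    define Q where "Q = \<rho> powr (r * a / (a + \<gamma>)) * e powr (r * \<gamma> / (a + \<gamma>))"
    have eQ: "e = \<rho> * 2 powr (- (T * (a + \<gamma>)))"
      using \<rho>e by (simp add: powr_minus)
    have Q: "Q = \<rho> powr r * 2 powr (- (T * (\<gamma> * r)))"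
    proof -
      have "Q = \<rho> powr (r * a / (a + \<gamma>)) * (\<rho> powr (r * \<gamma> / (a + \<gamma>)) * 2 powr (- (T * (\<gamma> * r))))"
      proof -
        have "r * \<gamma> / (a + \<gamma>) * (a + \<gamma>) = \<gamma> * r" using a \<gamma> by simp
        then have "- (T * (a + \<gamma>)) * (r * \<gamma> / (a + \<gamma>)) = - (T * (\<gamma> * r))"
          by (metis mult.assoc mult.commute mult_minus_left)
        then show ?thesis
          unfolding Q_def by (subst eQ) (simp only: powr_mult powr_powr)
      qed
      also have "\<dots> = \<rho> powr (r * a / (a + \<gamma>) + r * \<gamma> / (a + \<gamma>)) * 2 powr (- (T * (\<gamma> * r)))"
        by (simp add: powr_add)
      also have "r * a / (a + \<gamma>) + r * \<gamma> / (a + \<gamma>) = r * (a + \<gamma>) / (a + \<gamma>)"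
        by (simp only: distrib_left add_divide_distrib)
      also have "\<dots> = r" using a \<gamma> by simp
      finally show ?thesis .
    qed
    have 1: "\<rho> powr (r - 1) * (2 powr (real J * (a - \<beta>)) * e) \<le> Q"
    proof -
      have "\<rho> powr (r - 1) * (2 powr (real J * (a - \<beta>)) * e) \<le> \<rho> powr (r - 1) * (2 powr (T * (a - \<beta>)) * e)"
        using J \<gamma> e by (intro mult_left_mono mult_right_mono powr_mono) (auto simp: \<beta>_def)
      also have "\<dots> = (\<rho> powr (r - 1) * \<rho>) * (2 powr (T * (a - \<beta>)) * 2 powr (- (T * (a + \<gamma>))))"
        by (subst eQ) (simp only: mult_ac)
      also have "\<rho> powr (r - 1) * \<rho> = \<rho> powr r"
        using \<rho> by (simp add: powr_mult_base mult.commute)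
      also have "2 powr (T * (a - \<beta>)) * 2 powr (- (T * (a + \<gamma>))) = 2 powr (- (T * (\<gamma> * r)))"
        unfolding powr_add[symmetric] by (simp add: \<beta>_def algebra_simps)
      finally show ?thesis by (simp add: Q)
    qed
    have 2: "K * (\<rho> powr (r - 1) * 2 powr (- real J * \<beta>) * n) \<le> c0 * n powr r + C * 2 powr (\<gamma> * r) * Q"
    proof -
      have "K * (\<rho> powr (r - 1) * 2 powr (- real J * \<beta>) * n)
         \<le> c0 * n powr r + C * (\<rho> powr (r - 1) * 2 powr (- real J * \<beta>)) powr (r / (r - 1))"
        using n by (intro C(2)) auto
      also have "(\<rho> powr (r - 1) * 2 powr (- real J * \<beta>)) powr (r / (r - 1)) = \<rho> powr r * 2 powr (- (real J * (\<gamma> * r)))"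
        using r by (simp add: powr_mult powr_powr \<beta>_def mult_ac)
      also have "\<dots> \<le> \<rho> powr r * 2 powr (\<gamma> * r - T * (\<gamma> * r))"
      proof (intro mult_left_mono powr_mono)
        have "(T - real J) * (\<gamma> * r) \<le> 1 * (\<gamma> * r)"
          using J \<gamma> r by (intro mult_right_mono) auto
        then show "- (real J * (\<gamma> * r)) \<le> \<gamma> * r - T * (\<gamma> * r)" by (simp add: algebra_simps)
      qed auto
      also have "\<dots> = 2 powr (\<gamma> * r) * Q"
        by (simp add: Q powr_diff powr_minus field_simps)
      finally show ?thesis using C(1) by (simp add: mult.assoc)
    qed
    have "x \<le> K * (\<rho> powr (r - 1) * (2 powr (real J * (a - \<beta>)) * e)) + K * (\<rho> powr (r - 1) * 2 powr (- real J * \<beta>) * n)"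
      using xJ[of J] by (simp add: \<beta>_def algebra_simps)
    also have "\<dots> \<le> K * Q + (c0 * n powr r + C * 2 powr (\<gamma> * r) * Q)"
      using K by (intro add_mono mult_left_mono 1 2) auto
    finally show ?thesis by (simp add: c_def Q_def algebra_simps)
  qed
  ultimately show ?thesis using that by blast
qed

section \<open>Fourier analysis on the torus\<close>

lemma torus_integrable:
  fixes f :: "real^'d \<Rightarrow> real"
  shows "continuous_on UNIV f \<Longrightarrow> integrable torus f"
  by (intro continuous_imp_integrable) (auto intro: continuous_on_subset)

lemma torus_integral:
  fixes f :: "real^'d \<Rightarrow> real"
  shows "continuous_on UNIV f \<Longrightarrow> (LINT x|torus. f x) = integral (cbox 0 1) f"
  by (intro lebesgue_integral_eq_integral torus_integrable) auto

lemma emeasure_torus [simp]: "emeasure (torus :: (real^'d) measure) (cbox 0 1) = 1"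
proof -
  have "(1 :: real^'d) \<bullet> b = 1" if "b \<in> Basis" for b
    using that by (auto simp: Basis_vec_def inner_axis)
  then have "emeasure lborel (cbox 0 (1 :: real^'d)) = 1"
    by (subst emeasure_lborel_cbox) auto
  then show ?thesis
    by (simp add: emeasure_restrict_space)
qed

lemma measure_torus [simp]: "measure (torus :: (real^'d) measure) (cbox 0 1) = 1"
  by (simp add: measure_def)

text \<open>The box elongated to [0,1+t] in direction i is cut once at height t and once at height
  1. The pieces [0,t] and [1,1+t] differ by a period, so the remaining unit boxes have equal
  integrals.\<close>

lemma cube_integral_shift:
  fixes h :: "real^'d \<Rightarrow> real"
  assumes h: "continuous_on UNIV h" and per: "\<And>x. h (x + axis i 1) = h x" and t: "0 \<le> t" "t \<le> 1"
  shows "integral (cbox 0 1) (\<lambda>x. h (x + t *\<^sub>R axis i 1)) = integral (cbox 0 1) h"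
proof -
  define e :: "real^'d" where "e = axis i 1"
  have e: "e \<in> Basis" by (simp add: e_def axis_in_Basis_iff)
  have xe: "x \<bullet> e = x $ i" for x :: "real^'d" by (simp add: e_def inner_axis)
  have ej: "e $ j = (if j = i then 1 else 0)" for j by (simp add: e_def axis_def)
  have int: "h integrable_on cbox u v" for u v
    by (intro integrable_continuous continuous_on_subset[OF h]) auto
  have sp: "integral (cbox u v) h = integral (cbox u v \<inter> {x. x \<bullet> e \<le> c}) h + integral (cbox u v \<inter> {x. x \<bullet> e \<ge> c}) h" for u v c
    by (intro integral_split int e)
  \<comment> \<open>Upper corners are written 1 + \<beta> e: \<beta> = t is the elongated box,
    \<beta> = t - 1 the slab of height t.\<close>
  have box: "cbox (\<alpha> *\<^sub>R e) (1 + \<beta> *\<^sub>R e) =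
      {x. \<alpha> \<le> x $ i \<and> x $ i \<le> 1 + \<beta> \<and> (\<forall>j. j \<noteq> i \<longrightarrow> 0 \<le> x $ j \<and> x $ j \<le> 1)}" for \<alpha> \<beta>
  proof (intro set_eqI)
    fix x :: "real^'d"
    have "(\<forall>j. P j) \<longleftrightarrow> P i \<and> (\<forall>j. j \<noteq> i \<longrightarrow> P j)" for P by auto
    from this[of "\<lambda>j. (\<alpha> *\<^sub>R e) $ j \<le> x $ j \<and> x $ j \<le> (1 + \<beta> *\<^sub>R e) $ j"]
    show "x \<in> cbox (\<alpha> *\<^sub>R e) (1 + \<beta> *\<^sub>R e) \<longleftrightarrow> x \<in> {x. \<alpha> \<le> x $ i \<and> x $ i \<le> 1 + \<beta> \<and> (\<forall>j. j \<noteq> i \<longrightarrow> 0 \<le> x $ j \<and> x $ j \<le> 1)}"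
      by (simp add: mem_box_cart ej)
  qed
  note box0 = box[of 0, simplified] box[of 0 0, simplified] box[of 1, simplified] box
  have "cbox 0 (1 + t *\<^sub>R e) \<inter> {x. x \<bullet> e \<le> t} = cbox 0 (1 + (t - 1) *\<^sub>R e)"
    unfolding box0 using t by (auto simp: xe)
  moreover have "cbox 0 (1 + t *\<^sub>R e) \<inter> {x. x \<bullet> e \<ge> t} = cbox (t *\<^sub>R e) (1 + t *\<^sub>R e)"
    unfolding box0 using t by (auto simp: xe)
  ultimately have 1: "integral (cbox 0 (1 + t *\<^sub>R e)) h =
     integral (cbox 0 (1 + (t - 1) *\<^sub>R e)) h + integral (cbox (t *\<^sub>R e) (1 + t *\<^sub>R e)) h"
    using sp[of 0 "1 + t *\<^sub>R e" t] by simp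
  have "cbox 0 (1 + t *\<^sub>R e) \<inter> {x. x \<bullet> e \<le> 1} = cbox 0 1"
    unfolding box0 using t by (auto simp: xe)
  moreover have "cbox 0 (1 + t *\<^sub>R e) \<inter> {x. x \<bullet> e \<ge> 1} = cbox e (1 + t *\<^sub>R e)"
    unfolding box0 using t by (auto simp: xe)
  ultimately have 2: "integral (cbox 0 (1 + t *\<^sub>R e)) h = integral (cbox 0 1) h + integral (cbox e (1 + t *\<^sub>R e)) h"
    using sp[of 0 "1 + t *\<^sub>R e" 1] by simp
  have "integral (cbox e (1 + t *\<^sub>R e)) h = integral (cbox (e - e) (1 + t *\<^sub>R e - e)) (\<lambda>x. h (x + e))"
    by (rule integral_shift_cbox[symmetric])
  also have "\<dots> = integral (cbox 0 (1 + (t - 1) *\<^sub>R e)) h"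
    by (simp add: per e_def scaleR_diff_left add_diff_eq)
  finally have 3: "integral (cbox e (1 + t *\<^sub>R e)) h = integral (cbox 0 (1 + (t - 1) *\<^sub>R e)) h" .
  have "integral (cbox 0 1) (\<lambda>x. h (x + t *\<^sub>R e)) = integral (cbox (t *\<^sub>R e) (1 + t *\<^sub>R e)) h"
    using integral_shift_cbox[of "t *\<^sub>R e" "t *\<^sub>R e" "1 + t *\<^sub>R e" h] by simp
  then show ?thesis using 1 2 3 by (simp add: e_def)
qed

text \<open>By periodicity the integral of \<open>h\<close> over the shifted cube is constant in the shift;
  differentiate under the integral sign.\<close>

lemma cube_integral_partial:
  fixes h h' :: "real^'d \<Rightarrow> real"
  assumes h: "continuous_on UNIV h" and h': "continuous_on UNIV h'"
    and per: "\<And>x. h (x + axis i 1) = h x"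
    and d: "\<And>x. ((\<lambda>t. h (x + t *\<^sub>R axis i 1)) has_real_derivative h' x) (at 0)"
  shows "integral (cbox 0 1) h' = 0"
proof -
  define e :: "real^'d" where "e = axis i 1"
  define H where "H t = integral (cbox 0 1) (\<lambda>x. h (x + t *\<^sub>R e))" for t :: real
  \<comment> \<open>A derivative within {0..1} is enough, and H is known to be constant only for
    shifts in that interval.\<close>
  have "(H has_field_derivative integral (cbox 0 1) (\<lambda>x. h' (x + 0 *\<^sub>R e))) (at 0 within {0..1})"
    unfolding H_def
  proof (rule leibniz_rule_field_derivative)
    fix t :: real and x :: "real^'d"
    have "((\<lambda>s. h ((x + t *\<^sub>R e) + s *\<^sub>R e)) has_real_derivative h' (x + t *\<^sub>R e)) (at 0)"
      using d by (simp add: e_def)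
    then have "((\<lambda>s. h (x + (s + t) *\<^sub>R e)) has_real_derivative h' (x + t *\<^sub>R e)) (at 0)"
      by (simp add: scaleR_add_left add_ac)
    then have "((\<lambda>t. h (x + t *\<^sub>R e)) has_real_derivative h' (x + t *\<^sub>R e)) (at (0 + t))"
      by (subst DERIV_shift)
    then show "((\<lambda>t. h (x + t *\<^sub>R e)) has_real_derivative h' (x + t *\<^sub>R e)) (at t within {0..1})"
      by (simp add: has_field_derivative_at_within)
  next
    show "(\<lambda>x. h (x + t *\<^sub>R e)) integrable_on cbox 0 1" for t
      by (intro integrable_continuous continuous_on_compose2[OF h] continuous_intros) auto
    show "continuous_on ({0..1} \<times> cbox 0 1) (\<lambda>(t, x). h' (x + t *\<^sub>R e))"
      unfolding case_prod_beta
      by (intro continuous_on_compose2[OF h'] continuous_intros) auto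
  qed auto
  then have 1: "(H has_vector_derivative integral (cbox 0 1) h') (at 0 within cbox 0 1)"
    by (simp add: has_real_derivative_iff_has_vector_derivative)
  have "H t = integral (cbox 0 1) h" if "t \<in> {0..1}" for t
    using cube_integral_shift[OF h per] that by (simp add: H_def e_def)
  then have 2: "(H has_vector_derivative 0) (at 0 within cbox 0 1)"
    using has_vector_derivative_transform[of 0 "{0..1::real}" H "\<lambda>_. integral (cbox 0 1) h" 0] by simp
  show ?thesis
    by (rule vector_derivative_unique_within_closed_interval[OF _ _ 1 2]) auto
qed

text \<open>Cosines with a phase: differentiation shifts the phase by pi/2, so scalar multiples of
  these functions are closed under partial derivatives. Sine and cosine are both instances.\<close>

definition tr :: "real^'d \<Rightarrow> real \<Rightarrow> real^'d \<Rightarrow> real" where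
  "tr k c x = cos (2 * pi * (k \<bullet> x) + c)"

lemma tr_deriv:
  "((\<lambda>t. A * tr k c (x + t *\<^sub>R axis i 1)) has_real_derivative
     A * (2 * pi * k $ i) * tr k (c + pi / 2) x) (at 0)"
proof -
  have "cos (z + (c + pi / 2)) = - sin (z + c)" for z
    by (simp add: cos_add sin_add)
  then show ?thesis
    unfolding tr_def by (auto intro!: derivative_eq_intros simp: inner_add_right inner_axis)
qed

lemma continuous_on_tr [continuous_intros]: "continuous_on S (tr k c)"
  unfolding tr_def by (intro continuous_intros)

lemma partial_tr: "partial i (\<lambda>x. A * tr k c x) = (\<lambda>x. A * (2 * pi * k $ i) * tr k (c + pi / 2) x)"
  unfolding partial_def by (intro ext DERIV_imp_deriv tr_deriv)

lemma partials_tr: "\<exists>A' c'. partials is (\<lambda>x. A * tr k c x) = (\<lambda>x. A' * tr k c' x)"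
proof (induction "is")
  case Nil
  then show ?case by (auto simp: partials_def)
next
  case (Cons i "is")
  then obtain A' c' where "partials is (\<lambda>x. A * tr k c x) = (\<lambda>x. A' * tr k c' x)" by blast
  then have "partials (i # is) (\<lambda>x. A * tr k c x) = partial i (\<lambda>x. A' * tr k c' x)"
    by (simp add: partials_def)
  then show ?case unfolding partial_tr by blast
qed

definition Zd :: "(real^'d) set" where
  "Zd = {k. \<forall>i. k $ i \<in> \<int>}"

lemma periodic_tr:
  assumes "k \<in> Zd" shows "tr k c (x + axis i 1) = tr k c x"
proof -
  obtain n where n: "k $ i = of_int n" using assms by (auto simp: Zd_def Ints_def)
  have "cos (2 * pi * (k \<bullet> (x + axis i 1)) + c) = cos ((2 * pi * (k \<bullet> x) + c) + 2 * pi * of_int n)"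
    by (simp add: inner_add_right inner_axis n algebra_simps)
  also have "\<dots> = cos (2 * pi * (k \<bullet> x) + c)"
    by (simp add: cos_add sin_int_2pin cos_int_2pin)
  finally show ?thesis by (simp add: tr_def)
qed

lemma tr_test: "k \<in> Zd \<Longrightarrow> tr k c \<in> test_functions"
proof -
  assume k: "k \<in> Zd"
  have "C_k m (\<lambda>x. 1 * tr k c x)" for m
    unfolding C_k_def
  proof (intro conjI allI impI)
    fix "is" :: "'a list" and i x
    obtain A' c' where *: "partials is (\<lambda>x. 1 * tr k c x) = (\<lambda>x. A' * tr k c' x)"
      using partials_tr by blast
    show "continuous_on UNIV (partials is (\<lambda>x. 1 * tr k c x))"
      unfolding * by (intro continuous_intros)
    show "(\<lambda>t. partials is (\<lambda>x. 1 * tr k c x) (x + t *\<^sub>R axis i 1)) differentiable at 0"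
      unfolding * using tr_deriv real_differentiable_def by blast
  qed
  then show "tr k c \<in> test_functions"
    using k by (simp add: test_functions_def periodic_def periodic_tr)
qed

lemma test_cont: "\<eta> \<in> test_functions \<Longrightarrow> continuous_on UNIV (partials is \<eta>)"
  unfolding test_functions_def C_k_def by blast

lemma test_cont0: "\<eta> \<in> test_functions \<Longrightarrow> continuous_on UNIV \<eta>"
  using test_cont[of \<eta> "[]"] by (simp add: partials_def)

lemma test_deriv:
  "\<eta> \<in> test_functions \<Longrightarrow> ((\<lambda>t. \<eta> (x + t *\<^sub>R axis i 1)) has_real_derivative partial i \<eta> x) (at 0)"
proof -
  assume "\<eta> \<in> test_functions"
  then have "(\<lambda>t::real. partials [] \<eta> (x + t *\<^sub>R axis i 1)) differentiable at 0"
    unfolding test_functions_def C_k_def by blast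
  then show ?thesis
    unfolding partial_def by (simp add: partials_def DERIV_deriv_iff_real_differentiable)
qed

lemma partials_partial: "partials is (partial i \<eta>) = partials (is @ [i]) \<eta>"
  by (simp add: partials_def)

lemma test_partial: "\<eta> \<in> test_functions \<Longrightarrow> partial i \<eta> \<in> test_functions"
proof -
  assume \<eta>: "\<eta> \<in> test_functions"
  have "\<eta> ((x + axis j 1) + t *\<^sub>R axis i 1) = \<eta> (x + t *\<^sub>R axis i 1)" for j t x
  proof -
    have eq: "(x + axis j 1) + t *\<^sub>R axis i 1 = (x + t *\<^sub>R axis i 1) + axis j 1" by simp
    show ?thesis unfolding eq using \<eta> by (simp add: test_functions_def periodic_def)
  qed
  then have "periodic (partial i \<eta>)"
    unfolding periodic_def partial_def by simp
  moreover have "C_k m (partial i \<eta>)" for m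
  proof -
    have C: "C_k (Suc m) \<eta>" using \<eta> by (simp add: test_functions_def)
    show ?thesis
      unfolding C_k_def partials_partial
    proof (intro conjI allI impI)
      fix "is" :: "'a list" and ia x assume "length is < m"
      then have "length (is @ [i]) < Suc m" by simp
      then show "(\<lambda>t. partials (is @ [i]) \<eta> (x + t *\<^sub>R axis ia 1)) differentiable at 0"
        using C unfolding C_k_def by blast
    next
      fix "is" :: "'a list"
      show "continuous_on UNIV (partials (is @ [i]) \<eta>)" by (rule test_cont[OF \<eta>])
    qed
  qed
  ultimately show ?thesis by (simp add: test_functions_def)
qed

text \<open>Product rule, with \<open>cube_integral_partial\<close> in place of boundary
  terms.\<close>

lemma torus_by_parts:
  fixes \<eta> :: "real^'d \<Rightarrow> real"
  assumes \<eta>: "\<eta> \<in> test_functions" and k: "k \<in> Zd"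
  shows "(LINT x|torus. partial i \<eta> x * tr k c x) = - (2 * pi * k $ i) * (LINT x|torus. \<eta> x * tr k (c + pi / 2) x)"
proof -
  have c1: "continuous_on UNIV \<eta>" and c2: "continuous_on UNIV (partial i \<eta>)"
    using test_cont0[OF \<eta>] test_cont0[OF test_partial[OF \<eta>]] by auto
  define h' where "h' x = partial i \<eta> x * tr k c x + \<eta> x * ((2 * pi * k $ i) * tr k (c + pi / 2) x)" for x
  have "integral (cbox 0 1) h' = 0"
  proof (rule cube_integral_partial)
    show "continuous_on UNIV (\<lambda>x. \<eta> x * tr k c x)" "continuous_on UNIV h'"
      unfolding h'_def by (intro continuous_intros c1 c2)+
    show "\<eta> (x + axis i 1) * tr k c (x + axis i 1) = \<eta> x * tr k c x" for x
      using \<eta> k by (simp add: periodic_tr) (simp add: test_functions_def periodic_def)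
    show "((\<lambda>t. \<eta> (x + t *\<^sub>R axis i 1) * tr k c (x + t *\<^sub>R axis i 1)) has_real_derivative h' x) (at 0)" for x
      unfolding h'_def using tr_deriv[of 1 k c x i]
      by (auto intro!: derivative_eq_intros test_deriv[OF \<eta>])
  qed
  moreover have "continuous_on UNIV h'" unfolding h'_def by (intro continuous_intros c1 c2)
  ultimately have "0 = (LINT x|torus. h' x)" by (simp add: torus_integral)
  also have "\<dots> = (LINT x|torus. partial i \<eta> x * tr k c x) + (LINT x|torus. (2 * pi * k $ i) * (\<eta> x * tr k (c + pi / 2) x))"
  proof -
    have i: "integrable torus (\<lambda>x. partial i \<eta> x * tr k c x)"
      "integrable torus (\<lambda>x. (2 * pi * k $ i) * (\<eta> x * tr k (c + pi / 2) x))"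
      by (intro torus_integrable continuous_intros c1 c2)+
    show ?thesis
      unfolding Bochner_Integration.integral_add[OF i, symmetric] h'_def by (simp only: mult_ac)
  qed
  finally show ?thesis by simp
qed

lemma tr_integral:
  assumes "k \<in> Zd"
  shows "(LINT x|torus. tr k c x) = (if k = 0 then cos c else 0)"
proof (cases "k = 0")
  case True
  then have "tr k c = (\<lambda>_. cos c)" by (auto simp: tr_def)
  then show ?thesis using True by simp
next
  case False
  then obtain i where i: "k $ i \<noteq> 0" by (auto simp: vec_eq_iff)
  have "partial i (tr k (c - pi / 2)) x = (2 * pi * k $ i) * tr k c x" for x
    using partial_tr[of i 1 k "c - pi / 2"] by simp
  \<comment> \<open>Up to the factor 2 pi k_i the function is a partial derivative; integration by
    parts against the constant mode \<open>tr 0 0\<close> gives 0.\<close>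
  then have "(LINT x|torus. (2 * pi * k $ i) * tr k c x) = (LINT x|torus. partial i (tr k (c - pi / 2)) x * tr 0 0 x)"
    by (simp add: tr_def)
  also have "\<dots> = 0"
    using torus_by_parts[OF tr_test[OF assms], of 0 i "c - pi / 2" 0] by (simp add: Zd_def)
  finally show ?thesis using i False by simp
qed

text \<open>One integration by parts in direction i per derivative. Each shifts the phase by pi/2,
  so the induction runs over all phases and starts each step at c - pi/2.\<close>

lemma fourier_decay:
  fixes \<eta> :: "real^'d \<Rightarrow> real"
  assumes "\<eta> \<in> test_functions" "k \<in> Zd" "\<And>x. \<bar>partials (replicate m i) \<eta> x\<bar> \<le> B"
  shows "\<bar>LINT x|torus. \<eta> x * tr k c x\<bar> * (2 * pi * \<bar>k $ i\<bar>) ^ m \<le> B"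
  using assms
proof (induction m arbitrary: \<eta> c)
  case 0
  then have B: "\<bar>\<eta> x\<bar> \<le> B" for x by (simp add: partials_def)
  have "\<bar>LINT x|torus. \<eta> x * tr k c x\<bar> \<le> (LINT x|torus. \<bar>\<eta> x * tr k c x\<bar>)"
    by (rule integral_abs_bound)
  also have "\<dots> \<le> (LINT x|(torus :: (real^'d) measure). B)"
  proof (rule Bochner_Integration.integral_mono)
    show "integrable torus (\<lambda>x. \<bar>\<eta> x * tr k c x\<bar>)"
      by (intro torus_integrable continuous_intros test_cont0 0)
    fix x :: "real^'d"
    have "\<bar>\<eta> x\<bar> * \<bar>tr k c x\<bar> \<le> B * 1" using B[of x]
      by (intro mult_mono) (auto simp: tr_def)
    then show "\<bar>\<eta> x * tr k c x\<bar> \<le> B" by (simp add: abs_mult)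
  qed (intro torus_integrable continuous_intros)
  finally show ?case by simp
next
  case (Suc m)
  have "replicate (Suc m) i = replicate m i @ [i]" by (simp add: replicate_append_same)
  then have "\<bar>partials (replicate m i) (partial i \<eta>) x\<bar> \<le> B" for x
    using Suc.prems(3)[of x] unfolding partials_partial by metis
  from Suc.IH[OF test_partial[OF Suc.prems(1)] Suc.prems(2) this, of "c - pi / 2"]
  have "\<bar>- (2 * pi * k $ i) * (LINT x|torus. \<eta> x * tr k c x)\<bar> * (2 * pi * \<bar>k $ i\<bar>) ^ m \<le> B"
    unfolding torus_by_parts[OF Suc.prems(1,2)] diff_add_cancel .
  moreover have "\<bar>- (2 * pi * k $ i) * z\<bar> = \<bar>z\<bar> * (2 * pi * \<bar>k $ i\<bar>)" for z
    by (simp add: abs_mult)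
  ultimately show ?case by (simp only: power_Suc mult.assoc)
qed

section \<open>The real Fourier system on the lattice\<close>

definition cosk :: "real^'d \<Rightarrow> real^'d \<Rightarrow> real" where "cosk k x = cos (2 * pi * (k \<bullet> x))"
definition sink :: "real^'d \<Rightarrow> real^'d \<Rightarrow> real" where "sink k x = sin (2 * pi * (k \<bullet> x))"

lemma cosk_tr: "cosk k = tr k 0" by (auto simp: cosk_def tr_def)
lemma sink_tr: "sink k = tr k (- (pi / 2))" by (auto simp: sink_def tr_def cos_diff)

lemma continuous_on_cosk [continuous_intros]: "continuous_on S (cosk k)" "continuous_on S (sink k)"
  by (simp_all add: cosk_tr sink_tr continuous_on_tr)

lemma cosk_uminus [simp]: "cosk (- k) = cosk k" "sink (- k) = (\<lambda>x. - sink k x)"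
  by (auto simp: cosk_def sink_def)

lemma cosk_test: "k \<in> Zd \<Longrightarrow> cosk k \<in> test_functions" "k \<in> Zd \<Longrightarrow> sink k \<in> test_functions"
  by (simp_all add: cosk_tr sink_tr tr_test)

lemma Zd_add: "k \<in> Zd \<Longrightarrow> l \<in> Zd \<Longrightarrow> k + l \<in> Zd" "k \<in> Zd \<Longrightarrow> l \<in> Zd \<Longrightarrow> k - l \<in> Zd" "k \<in> Zd \<Longrightarrow> - k \<in> Zd"
  by (auto simp: Zd_def)

text \<open>Product-to-sum formulas. Both k = l and k = -l count, since k and -k have the same
  cosine and opposite sines.\<close>

lemma torus_orthogonality:
  fixes k l :: "real^'d"
  assumes "k \<in> Zd" "l \<in> Zd"
  shows "(LINT x|torus. cosk k x * cosk l x) = (of_bool (k = l) + of_bool (k = - l)) / 2"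
    and "(LINT x|torus. sink k x * sink l x) = (of_bool (k = l) - of_bool (k = - l)) / 2"
    and "(LINT x|torus. cosk k x * sink l x) = 0"
    and "(LINT x|torus. sink k x * cosk l x) = 0"
proof -
  have eq: "(LINT x|torus. A * tr (k - l) c x + B * tr (k + l) c x) =
      A * (if k = l then cos c else 0) + B * (if k = - l then cos c else 0)" for A B c
    using assms
  proof -
    have "integrable torus (\<lambda>x. A * tr (k - l) c x)" "integrable torus (\<lambda>x. B * tr (k + l) c x)"
      by (intro torus_integrable continuous_intros)+
    then show ?thesis using assms
      by (simp add: Bochner_Integration.integral_add tr_integral Zd_add eq_neg_iff_add_eq_0)
  qed
  have tr_sin: "tr m (- (pi / 2)) x = sin (2 * pi * (m \<bullet> x))" for m x :: "real^'d"
    by (simp add: sink_def flip: sink_tr)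
  have "cosk k x * cosk l x = 1 / 2 * tr (k - l) 0 x + 1 / 2 * tr (k + l) 0 x" for x
    by (simp add: cosk_def tr_def inner_diff_left inner_add_left cos_times_cos field_simps)
  then show "(LINT x|torus. cosk k x * cosk l x) = (of_bool (k = l) + of_bool (k = - l)) / 2"
    by (simp only: eq) simp
  have "sink k x * sink l x = 1 / 2 * tr (k - l) 0 x + (- 1 / 2) * tr (k + l) 0 x" for x
    by (simp add: sink_def tr_def inner_diff_left inner_add_left sin_times_sin field_simps)
  then show "(LINT x|torus. sink k x * sink l x) = (of_bool (k = l) - of_bool (k = - l)) / 2"
    by (simp only: eq) simp
  have "cosk k x * sink l x = (- 1 / 2) * tr (k - l) (- (pi / 2)) x + 1 / 2 * tr (k + l) (- (pi / 2)) x" for x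
    by (simp add: cosk_def sink_def tr_sin inner_diff_left inner_add_left cos_times_sin field_simps)
  then show "(LINT x|torus. cosk k x * sink l x) = 0"
    by (simp only: eq) simp
  have "sink k x * cosk l x = 1 / 2 * tr (k - l) (- (pi / 2)) x + 1 / 2 * tr (k + l) (- (pi / 2)) x" for x
    by (simp only: cosk_def sink_def tr_sin inner_diff_left inner_add_left sin_times_cos
        right_diff_distrib distrib_left) simp
  then show "(LINT x|torus. sink k x * cosk l x) = 0"
    by (simp only: eq) simp
qed

text \<open>Meant for K symmetric, A even and B odd, so that the terms of k and -k coincide.\<close>

definition trig_poly :: "(real^'d) set \<Rightarrow> (real^'d \<Rightarrow> real) \<Rightarrow> (real^'d \<Rightarrow> real) \<Rightarrow> real^'d \<Rightarrow> real" where
  "trig_poly K A B x = (\<Sum>k\<in>K. A k * cosk k x + B k * sink k x)"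

lemma continuous_on_trig_poly [continuous_intros]: "continuous_on S (trig_poly K A B)"
  unfolding trig_poly_def by (intro continuous_intros)

lemma trig_poly_integral:
  fixes g :: "real^'d \<Rightarrow> real"
  assumes "continuous_on UNIV g"
  shows "(LINT x|torus. trig_poly K A B x * g x) =
    (\<Sum>k\<in>K. A k * (LINT x|torus. cosk k x * g x) + B k * (LINT x|torus. sink k x * g x))"
proof -
  have i: "integrable torus (\<lambda>x. cosk k x * g x)" "integrable torus (\<lambda>x. sink k x * g x)" for k
    by (intro torus_integrable continuous_intros assms)+
  have "(LINT x|torus. trig_poly K A B x * g x) =
      (LINT x|torus. (\<Sum>k\<in>K. A k * (cosk k x * g x) + B k * (sink k x * g x)))"
    by (simp add: trig_poly_def sum_distrib_right distrib_right mult.assoc)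
  also have "\<dots> = (\<Sum>k\<in>K. A k * (LINT x|torus. cosk k x * g x) + B k * (LINT x|torus. sink k x * g x))"
    by (subst Bochner_Integration.integral_sum) (auto simp: i Bochner_Integration.integral_add)
  finally show ?thesis .
qed

text \<open>The frequencies l and -l contribute one half each, so the coefficients come back without
  a normalizing factor, also at l = 0.\<close>

lemma trig_poly_coeff:
  fixes K :: "(real^'d) set"
  assumes K: "finite K" "K \<subseteq> Zd" "\<And>k. k \<in> K \<Longrightarrow> - k \<in> K"
    and A: "\<And>k. A (- k) = A k" and B: "\<And>k. B (- k) = - B k" and l: "l \<in> Zd"
  shows "(LINT x|torus. trig_poly K A B x * cosk l x) = (if l \<in> K then A l else 0)"
    and "(LINT x|torus. trig_poly K A B x * sink l x) = (if l \<in> K then B l else 0)"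
proof -
  have of1: "c * ((of_bool P + of_bool Q) / 2) = (if P then c / 2 else 0) + (if Q then c / 2 else 0)"
    and of2: "c * ((of_bool P - of_bool Q) / 2) = (if P then c / 2 else 0) + (if Q then - c / 2 else 0)"
    for c :: real and P Q by auto
  have K': "- l \<in> K \<longleftrightarrow> l \<in> K" using K(3)[of l] K(3)[of "- l"] by auto
  have "(LINT x|torus. trig_poly K A B x * cosk l x) = (\<Sum>k\<in>K. A k * ((of_bool (k = l) + of_bool (k = - l)) / 2))"
    unfolding trig_poly_integral[OF continuous_on_cosk(1)]
    using K l by (intro sum.cong refl) (auto simp: torus_orthogonality subset_iff)
  also have "\<dots> = (\<Sum>k\<in>K. (if k = l then A k / 2 else 0) + (if k = - l then A k / 2 else 0))"
    by (intro sum.cong refl of1)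
  also have "\<dots> = (if l \<in> K then A l else 0)"
    unfolding sum.distrib sum.delta[OF K(1)] K' A by simp
  finally show "(LINT x|torus. trig_poly K A B x * cosk l x) = (if l \<in> K then A l else 0)" .
  have "(LINT x|torus. trig_poly K A B x * sink l x) = (\<Sum>k\<in>K. B k * ((of_bool (k = l) - of_bool (k = - l)) / 2))"
    unfolding trig_poly_integral[OF continuous_on_cosk(2)]
    using K l by (intro sum.cong refl) (auto simp: torus_orthogonality subset_iff)
  also have "\<dots> = (\<Sum>k\<in>K. (if k = l then B k / 2 else 0) + (if k = - l then - B k / 2 else 0))"
    by (intro sum.cong refl of2)
  also have "\<dots> = (if l \<in> K then B l else 0)"
    unfolding sum.distrib sum.delta[OF K(1)] K' B by simp
  finally show "(LINT x|torus. trig_poly K A B x * sink l x) = (if l \<in> K then B l else 0)" .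
qed

lemma trig_poly_square:
  fixes K :: "(real^'d) set"
  assumes K: "finite K" "K \<subseteq> Zd" "\<And>k. k \<in> K \<Longrightarrow> - k \<in> K"
    and A: "\<And>k. A (- k) = A k" and B: "\<And>k. B (- k) = - B k"
  shows "(LINT x|torus. (trig_poly K A B x)\<^sup>2) = (\<Sum>k\<in>K. (A k)\<^sup>2 + (B k)\<^sup>2)"
proof -
  have "(LINT x|torus. (trig_poly K A B x)\<^sup>2) =
    (\<Sum>k\<in>K. A k * (LINT x|torus. cosk k x * trig_poly K A B x) + B k * (LINT x|torus. sink k x * trig_poly K A B x))"
    unfolding power2_eq_square by (rule trig_poly_integral) (intro continuous_intros)
  also have "\<dots> = (\<Sum>k\<in>K. (A k)\<^sup>2 + (B k)\<^sup>2)"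
  proof (intro sum.cong refl)
    fix k assume "k \<in> K"
    then have "(LINT x|torus. cosk k x * trig_poly K A B x) = A k" "(LINT x|torus. sink k x * trig_poly K A B x) = B k"
      using trig_poly_coeff[where A = A and B = B, OF K A B, of k] K(2) by (auto simp: mult.commute)
    then show "A k * (LINT x|torus. cosk k x * trig_poly K A B x) + B k * (LINT x|torus. sink k x * trig_poly K A B x)
      = (A k)\<^sup>2 + (B k)\<^sup>2" by (simp add: power2_eq_square)
  qed
  finally show ?thesis .
qed

text \<open>Nonnegativity of the squared L^2 distance from g to its Fourier projection.\<close>

lemma bessel:
  fixes K :: "(real^'d) set" and g :: "real^'d \<Rightarrow> real"
  assumes K: "finite K" "K \<subseteq> Zd" "\<And>k. k \<in> K \<Longrightarrow> - k \<in> K" and g: "continuous_on UNIV g"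
  shows "(\<Sum>k\<in>K. (LINT x|torus. cosk k x * g x)\<^sup>2 + (LINT x|torus. sink k x * g x)\<^sup>2) \<le> (LINT x|torus. (g x)\<^sup>2)"
proof -
  define A where "A k = (LINT x|torus. cosk k x * g x)" for k :: "real^'d"
  define B where "B k = (LINT x|torus. sink k x * g x)" for k :: "real^'d"
  define S where "S = (\<Sum>k\<in>K. (A k)\<^sup>2 + (B k)\<^sup>2)"
  have 1: "(LINT x|torus. trig_poly K A B x * g x) = S"
    unfolding trig_poly_integral[OF g] by (simp add: S_def A_def B_def power2_eq_square)
  have 2: "(LINT x|torus. (trig_poly K A B x)\<^sup>2) = S"
    unfolding S_def by (rule trig_poly_square[OF K]) (auto simp: A_def B_def)
  have "0 \<le> (LINT x|torus. (g x - trig_poly K A B x)\<^sup>2)" by (intro Bochner_Integration.integral_nonneg) simp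
  also have "\<dots> = (LINT x|torus. ((g x)\<^sup>2 - 2 * (trig_poly K A B x * g x)) + (trig_poly K A B x)\<^sup>2)"
    by (simp add: power2_diff algebra_simps)
  also have "\<dots> = (LINT x|torus. (g x)\<^sup>2) - 2 * S + S"
  proof -
    have i: "integrable torus (\<lambda>x. (g x)\<^sup>2)" "integrable torus (\<lambda>x. 2 * (trig_poly K A B x * g x))"
      "integrable torus (\<lambda>x. (trig_poly K A B x)\<^sup>2)"
      by (intro torus_integrable continuous_intros g)+
    show ?thesis
      unfolding Bochner_Integration.integral_add[OF Bochner_Integration.integrable_diff[OF i(1,2)] i(3)]
        Bochner_Integration.integral_diff[OF i(1,2)] using 1 2 by simp
  qed
  finally show ?thesis by (simp add: S_def A_def B_def)
qed

section \<open>Littlewood--Paley blocks\<close>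

lemma epowr_ennreal [simp]: "0 \<le> x \<Longrightarrow> epowr (ennreal x) t = ennreal (x powr t)"
  by (simp add: epowr_def)

lemma eLp_norm_seq:
  fixes b :: "nat \<Rightarrow> real"
  assumes q: "0 < q" and b: "\<And>j. 0 \<le> b j"
  shows "eLp_norm (count_space UNIV) (ennreal q) (\<lambda>j. ennreal (b j)) =
    (if summable (\<lambda>j. b j powr q) then ennreal ((\<Sum>j. b j powr q) powr (1 / q)) else \<infinity>)"
proof -
  have *: "eLp_norm (count_space UNIV) (ennreal q) (\<lambda>j. ennreal (b j)) = epowr (\<Sum>j. ennreal (b j powr q)) (1 / q)"
    unfolding eLp_norm_def nn_integral_count_space_nat using q by (simp add: b)
  show ?thesis
  proof (cases "summable (\<lambda>j. b j powr q)")
    case True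
    have "(\<Sum>j. ennreal (b j powr q)) = ennreal (\<Sum>j. b j powr q)"
      by (rule suminf_ennreal2[OF _ True]) simp
    moreover have "0 \<le> (\<Sum>j. b j powr q)" by (rule suminf_nonneg[OF True]) simp
    ultimately show ?thesis unfolding * using True by simp
  next
    case False
    have "(\<Sum>j. ennreal (b j powr q)) = top"
    proof (rule ccontr)
      assume "(\<Sum>j. ennreal (b j powr q)) \<noteq> top"
      then have "summable (\<lambda>j. b j powr q)" by (intro summable_suminf_not_top) auto
      with False show False ..
    qed
    then show ?thesis unfolding * using False by (simp add: epowr_def)
  qed
qed

lemma eLp_norm_sup_upper: "f j \<le> eLp_norm (count_space UNIV) \<infinity> f"
  unfolding eLp_norm_def by (auto simp: AE_count_space intro!: Inf_greatest)

lemma eLp_norm_sup_least: "(\<And>j. f j \<le> C) \<Longrightarrow> eLp_norm (count_space UNIV) \<infinity> f \<le> C"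
  unfolding eLp_norm_def by (auto simp: AE_count_space intro!: Inf_lower)

definition Lpt :: "real \<Rightarrow> (real^'d \<Rightarrow> real) \<Rightarrow> real" where
  "Lpt p f = (LINT x|torus. \<bar>f x\<bar> powr p) powr (1 / p)"

lemma Lpt_nonneg: "0 \<le> Lpt p f"
  by (simp add: Lpt_def)

lemma continuous_on_abs_powr:
  fixes f :: "'a::topological_space \<Rightarrow> real"
  shows "continuous_on S f \<Longrightarrow> 0 < p \<Longrightarrow> continuous_on S (\<lambda>x. \<bar>f x\<bar> powr p)"
  by (intro continuous_on_powr' continuous_intros) auto

lemma eLp_norm_torus:
  fixes f :: "real^'d \<Rightarrow> real"
  assumes "continuous_on UNIV f" "0 < p"
  shows "eLp_norm torus (ennreal p) (\<lambda>x. ennreal \<bar>f x\<bar>) = ennreal (Lpt p f)"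
proof -
  have "(\<integral>\<^sup>+x. ennreal (\<bar>f x\<bar> powr p) \<partial>torus) = ennreal (LINT x|torus. \<bar>f x\<bar> powr p)"
    by (intro nn_integral_eq_integral torus_integrable continuous_on_abs_powr assms) auto
  then show ?thesis
    using assms by (simp add: eLp_norm_def Lpt_def)
qed

text \<open>Jensen: the tangent at the mean M is integrated over the torus, which has measure
  1.\<close>

lemma L1_le_Lpt:
  fixes f :: "real^'d \<Rightarrow> real"
  assumes f: "continuous_on UNIV f" and p: "1 \<le> p"
  shows "(LINT x|torus. \<bar>f x\<bar>) \<le> Lpt p f"
proof -
  define M where "M = (LINT x|torus. \<bar>f x\<bar>)"
  have M: "0 \<le> M" by (simp add: M_def)
  have i: "integrable torus (\<lambda>x. \<bar>f x\<bar> powr p)" "integrable torus (\<lambda>x. M powr p + p * M powr (p - 1) * (\<bar>f x\<bar> - M))"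
    "integrable torus (\<lambda>x. \<bar>f x\<bar>)" "integrable (torus :: (real^'d) measure) (\<lambda>x. M)" "integrable (torus :: (real^'d) measure) (\<lambda>x. M powr p)"
    "integrable torus (\<lambda>x. p * M powr (p - 1) * (\<bar>f x\<bar> - M))" "integrable torus (\<lambda>x. \<bar>f x\<bar> - M)"
    using p by (intro torus_integrable continuous_intros continuous_on_abs_powr f; simp)+
  have "(LINT x|torus. M powr p + p * M powr (p - 1) * (\<bar>f x\<bar> - M)) \<le> (LINT x|torus. \<bar>f x\<bar> powr p)"
    using p M by (intro Bochner_Integration.integral_mono i powr_above_tangent) auto
  also have "(LINT x|torus. M powr p + p * M powr (p - 1) * (\<bar>f x\<bar> - M)) = M powr p"
    by (simp add: Bochner_Integration.integral_add[OF i(5,6)] Bochner_Integration.integral_diff[OF i(3,4)] M_def[symmetric])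
  finally have "(M powr p) powr (1 / p) \<le> (LINT x|torus. \<bar>f x\<bar> powr p) powr (1 / p)"
    using p by (intro powr_mono2) auto
  then show ?thesis using p M by (simp add: powr_powr Lpt_def M_def)
qed

text \<open>Dominated convergence; bounded coefficients provide the constant majorant W^p. It
  carries block norms to the limit in \<open>lp_complete\<close>.\<close>

lemma Lpt_trig_poly_tendsto:
  fixes K :: "(real^'d) set"
  assumes K: "finite K" and A: "\<And>k. k \<in> K \<Longrightarrow> (\<lambda>m. A m k) \<longlonglongrightarrow> A' k" and B: "\<And>k. k \<in> K \<Longrightarrow> (\<lambda>m. B m k) \<longlonglongrightarrow> B' k"
    and p: "1 \<le> p"
  shows "(\<lambda>m. Lpt p (trig_poly K (A m) (B m))) \<longlonglongrightarrow> Lpt p (trig_poly K A' B')"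
proof -
  have "(\<lambda>m. \<Sum>k\<in>K. \<bar>A m k\<bar> + \<bar>B m k\<bar>) \<longlonglongrightarrow> (\<Sum>k\<in>K. \<bar>A' k\<bar> + \<bar>B' k\<bar>)"
    by (intro tendsto_sum tendsto_add tendsto_rabs A B)
  then have "Bseq (\<lambda>m. \<Sum>k\<in>K. \<bar>A m k\<bar> + \<bar>B m k\<bar>)"
    by (intro convergent_imp_Bseq convergentI)
  then obtain W where W: "\<And>m. norm (\<Sum>k\<in>K. \<bar>A m k\<bar> + \<bar>B m k\<bar>) \<le> W" by (auto simp: Bseq_def)
  have bd: "\<bar>trig_poly K (A m) (B m) x\<bar> \<le> W" for m x
  proof -
    have "\<bar>trig_poly K (A m) (B m) x\<bar> \<le> (\<Sum>k\<in>K. \<bar>A m k * cosk k x + B m k * sink k x\<bar>)"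
      unfolding trig_poly_def by (rule sum_abs)
    also have "\<dots> \<le> (\<Sum>k\<in>K. \<bar>A m k\<bar> + \<bar>B m k\<bar>)"
    proof (rule sum_mono)
      fix k
      have "\<bar>A m k * cosk k x + B m k * sink k x\<bar> \<le> \<bar>A m k\<bar> * \<bar>cosk k x\<bar> + \<bar>B m k\<bar> * \<bar>sink k x\<bar>"
        using abs_triangle_ineq[of "A m k * cosk k x" "B m k * sink k x"] by (simp add: abs_mult)
      also have "\<dots> \<le> \<bar>A m k\<bar> * 1 + \<bar>B m k\<bar> * 1"
        by (intro add_mono mult_left_mono) (auto simp: cosk_def sink_def)
      finally show "\<bar>A m k * cosk k x + B m k * sink k x\<bar> \<le> \<bar>A m k\<bar> + \<bar>B m k\<bar>" by simp
    qed
    also have "\<dots> \<le> W" using W[of m] by simp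
    finally show ?thesis .
  qed
  have W0: "0 \<le> W" using bd[of 0 0] by simp
  have "(\<lambda>m. LINT x|torus. \<bar>trig_poly K (A m) (B m) x\<bar> powr p) \<longlonglongrightarrow> (LINT x|torus. \<bar>trig_poly K A' B' x\<bar> powr p)"
  proof (rule integral_dominated_convergence[where w = "\<lambda>_. W powr p"])
    show "(\<lambda>x. \<bar>trig_poly K A' B' x\<bar> powr p) \<in> borel_measurable torus"
         "(\<lambda>x. \<bar>trig_poly K (A m) (B m) x\<bar> powr p) \<in> borel_measurable torus" for m
      using p by (intro borel_measurable_integrable torus_integrable continuous_on_abs_powr continuous_on_trig_poly; simp)+
    show "integrable (torus :: (real^'d) measure) (\<lambda>_. W powr p)"
      by (intro torus_integrable continuous_intros)
    show "AE x in torus. (\<lambda>m. \<bar>trig_poly K (A m) (B m) x\<bar> powr p) \<longlonglongrightarrow> \<bar>trig_poly K A' B' x\<bar> powr p"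
      using p unfolding trig_poly_def
      by (intro AE_I2 tendsto_powr' tendsto_rabs tendsto_sum tendsto_add tendsto_mult A B tendsto_const) auto
    show "AE x in torus. norm (\<bar>trig_poly K (A m) (B m) x\<bar> powr p) \<le> W powr p" for m
      using bd p by (intro AE_I2) (auto intro!: powr_mono2)
  qed
  then show ?thesis
    unfolding Lpt_def using p by (intro tendsto_powr' tendsto_const) auto
qed

definition Kset :: "nat \<Rightarrow> (real^'d) set" where
  "Kset j = {k. (\<forall>i. k $ i \<in> \<int>) \<and> norm k \<le> 2 ^ (j + 1)}"

lemma Kset_props: "Kset j \<subseteq> Zd" "k \<in> Kset j \<Longrightarrow> - k \<in> Kset j"
  by (auto simp: Kset_def Zd_def)

text \<open>Every coordinate is an integer in [-2^(j+1), 2^(j+1)], and 2 * 2^(j+1) + 1 \<le>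
  2^(j+3).\<close>

lemma finite_card_Kset:
  shows "finite (Kset j :: (real^'d) set)" and "card (Kset j :: (real^'d) set) \<le> 2 ^ ((j + 3) * CARD('d))"
proof -
  define P where "P = (PiE (UNIV :: 'd set) (\<lambda>_. {- (2 ^ (j + 1)) .. (2 :: int) ^ (j + 1)}))"
  have fin: "finite P" unfolding P_def by (intro finite_PiE) auto
  have sub: "(Kset j :: (real^'d) set) \<subseteq> (\<lambda>f. \<chi> i. of_int (f i)) ` P"
  proof
    fix k :: "real^'d" assume k: "k \<in> Kset j"
    then have "\<forall>i. \<exists>n. k $ i = of_int n" by (auto simp: Kset_def Ints_def)
    then obtain f where f: "\<And>i. k $ i = of_int (f i)" by metis
    have "- (2 ^ (j + 1)) \<le> f i \<and> f i \<le> 2 ^ (j + 1)" for i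
    proof -
      have "\<bar>of_int (f i) :: real\<bar> \<le> 2 ^ (j + 1)"
        using component_le_norm_cart[of k i] k by (auto simp: f Kset_def)
      then have "real_of_int \<bar>f i\<bar> \<le> real_of_int (2 ^ (j + 1))" by simp
      then show ?thesis unfolding of_int_le_iff by linarith
    qed
    then have "f \<in> P" by (auto simp: P_def)
    moreover have "k = (\<chi> i. of_int (f i))" by (simp add: vec_eq_iff f)
    ultimately show "k \<in> (\<lambda>f. \<chi> i. of_int (f i)) ` P" by blast
  qed
  show "finite (Kset j :: (real^'d) set)" by (rule finite_subset[OF sub]) (simp add: fin)
  have "card (Kset j :: (real^'d) set) \<le> card P"
    by (rule order_trans[OF card_mono[OF _ sub] card_image_le]) (auto simp: fin)
  also have "card P = (2 * 2 ^ (j + 1) + 1) ^ CARD('d)"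
    unfolding P_def by (subst card_PiE) (auto simp: nat_add_distrib nat_mult_distrib nat_power_eq)
  also have "\<dots> \<le> (2 ^ (j + 3)) ^ CARD('d)"
  proof (intro power_mono)
    have "1 \<le> (2 :: nat) ^ j" by simp
    then show "2 * 2 ^ (j + 1) + 1 \<le> (2 :: nat) ^ (j + 3)" unfolding power_add by simp
  qed auto
  finally show "card (Kset j :: (real^'d) set) \<le> 2 ^ ((j + 3) * CARD('d))"
    by (simp only: power_mult)
qed

lemma dapply_dist: "is_distribution (dapply f)"
  using dapply[of f] by simp

lemma dapply_lincomb:
  "\<eta> \<in> test_functions \<Longrightarrow> \<zeta> \<in> test_functions \<Longrightarrow> dapply f (\<lambda>x. b * \<eta> x + c * \<zeta> x) = b * dapply f \<eta> + c * dapply f \<zeta>"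
  using dapply_dist[of f] unfolding is_distribution_def by blast

text \<open>Set to 0 off the lattice, so that parity and convergence of coefficients hold for every
  vector k.\<close>

definition fc :: "'d::finite distribution \<Rightarrow> real^'d \<Rightarrow> real" where
  "fc f k = (if k \<in> Zd then dapply f (cosk k) else 0)"
definition fs :: "'d::finite distribution \<Rightarrow> real^'d \<Rightarrow> real" where
  "fs f k = (if k \<in> Zd then dapply f (sink k) else 0)"

lemma Zd_uminus [simp]: "- k \<in> Zd \<longleftrightarrow> k \<in> Zd"
  by (auto simp: Zd_def)

lemma fc_uminus [simp]: "fc f (- k) = fc f k"
  by (simp add: fc_def)

lemma fs_uminus [simp]: "fs f (- k) = - fs f k"
proof (cases "k \<in> Zd")
  case True
  then have "dapply f (\<lambda>x. (- 1) * sink k x + 0 * sink k x) = - dapply f (sink k)"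
    by (subst dapply_lincomb) (auto simp: cosk_test)
  then show ?thesis using True by (simp add: fs_def)
qed (simp add: fs_def)

lemma fc_diff: "fc (f - g) k = fc f k - fc g k" "fs (f - g) k = fs f k - fs g k"
  by (simp_all add: fc_def fs_def dapply_simps)

text \<open>Applied to cosine and sine coefficients alike.\<close>

definition lp_cos :: "(real^'d \<Rightarrow> real) \<Rightarrow> nat \<Rightarrow> (real^'d \<Rightarrow> real) \<Rightarrow> real^'d \<Rightarrow> real" where
  "lp_cos \<theta> j a k = dyadic \<theta> j k * a k"

text \<open>The cosine of the difference separates x from y, so that f is tested only with
  \<open>cosk\<close> and \<open>sink\<close>.\<close>

lemma lp_block_trig:
  fixes \<theta> :: "real^'d::finite \<Rightarrow> real"
  shows "lp_block \<theta> j f = trig_poly (Kset j) (lp_cos \<theta> j (fc f)) (lp_cos \<theta> j (fs f))"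
proof
  fix x
  have *: "dapply f (\<lambda>y. cos (2 * pi * (k \<bullet> (x - y)))) = cosk k x * fc f k + sink k x * fs f k" if "k \<in> Zd" for k
  proof -
    have "(\<lambda>y. cos (2 * pi * (k \<bullet> (x - y)))) = (\<lambda>y. cosk k x * cosk k y + sink k x * sink k y)"
      by (auto simp: cosk_def sink_def inner_diff_right right_diff_distrib cos_diff)
    then show ?thesis using that by (simp add: dapply_lincomb cosk_test fc_def fs_def)
  qed
  show "lp_block \<theta> j f x = trig_poly (Kset j) (lp_cos \<theta> j (fc f)) (lp_cos \<theta> j (fs f)) x"
    unfolding lp_block_def trig_poly_def Kset_def[symmetric] lp_cos_def
  proof (intro sum.cong refl)
    fix k :: "real^'d" assume "k \<in> Kset j"
    then have "k \<in> Zd" using Kset_props(1) by blast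
    then show "dyadic \<theta> j k * dapply f (\<lambda>y. cos (2 * pi * (k \<bullet> (x - y)))) =
        dyadic \<theta> j k * fc f k * cosk k x + dyadic \<theta> j k * fs f k * sink k x"
      unfolding *[OF \<open>k \<in> Zd\<close>] by (simp add: algebra_simps)
  qed
qed

lemma lp_block_cont: "continuous_on S (lp_block \<theta> j f)"
  unfolding lp_block_trig by (intro continuous_intros)

lemma lp_block_add_scale: "lp_block \<theta> j (b *\<^sub>R f + c *\<^sub>R g) x = b * lp_block \<theta> j f x + c * lp_block \<theta> j g x"
  unfolding lp_block_def by (simp add: dapply_simps sum.distrib sum_distrib_left algebra_simps)

lemma lp_block_diff: "lp_block \<theta> j (f - g) x = lp_block \<theta> j f x - lp_block \<theta> j g x"
  using lp_block_add_scale[of \<theta> j 1 f "-1" g x] by simp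

locale lp_setting =
  fixes \<theta> :: "real^'d::finite \<Rightarrow> real"
  assumes cutoff: "lp_cutoff \<theta>"
begin

lemma dyadic_even [simp]: "dyadic \<theta> j (- k) = dyadic \<theta> j k"
proof -
  have "\<theta> (- x) = \<theta> x" for x using cutoff by (simp add: lp_cutoff_def)
  from this[of "inverse (2 ^ j) *\<^sub>R k"] this[of "inverse (2 ^ (j - 1)) *\<^sub>R k"] this[of k]
  show ?thesis by (simp add: dyadic_def)
qed

lemma abs_dyadic_le: "\<bar>dyadic \<theta> j k\<bar> \<le> 1"
proof -
  have "0 \<le> \<theta> x \<and> \<theta> x \<le> 1" for x using cutoff by (simp add: lp_cutoff_def)
  from this[of "inverse (2 ^ j) *\<^sub>R k"] this[of "inverse (2 ^ (j - 1)) *\<^sub>R k"] this[of k]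
  show ?thesis by (auto simp: dyadic_def)
qed

lemma theta_1: "norm x \<le> 1 \<Longrightarrow> \<theta> x = 1" and theta_0: "2 \<le> norm x \<Longrightarrow> \<theta> x = 0"
  using cutoff by (auto simp: lp_cutoff_def)

lemma dyadic_outside: "2 ^ (j + 1) < norm k \<Longrightarrow> dyadic \<theta> j k = 0"
proof -
  assume k: "2 ^ (j + 1) < norm k"
  have "\<theta> (k /\<^sub>R 2 ^ i) = 0" if "i \<le> j" for i
  proof (rule theta_0)
    have "2 * 2 ^ i \<le> (2 ^ (j + 1) :: real)" using that by simp
    then have "2 * 2 ^ i \<le> norm k" using k by linarith
    then show "2 \<le> norm (k /\<^sub>R 2 ^ i)" by (simp add: field_simps)
  qed
  from this[of j] this[of "j - 1"] this[of 0] show ?thesis by (simp add: dyadic_def)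
qed

lemma dyadic_inside: "1 \<le> j \<Longrightarrow> norm k \<le> 2 ^ (j - 1) \<Longrightarrow> dyadic \<theta> j k = 0"
proof -
  assume j: "1 \<le> j" and k: "norm k \<le> 2 ^ (j - 1)"
  have "\<theta> (k /\<^sub>R 2 ^ i) = 1" if "j - 1 \<le> i" for i
  proof (rule theta_1)
    have "(2 ^ (j - 1) :: real) \<le> 2 ^ i" using that by (intro power_increasing) auto
    then have "norm k \<le> 2 ^ i" using k by linarith
    then show "norm (k /\<^sub>R 2 ^ i) \<le> 1" by (simp add: field_simps)
  qed
  from this[of j] this[of "j - 1"] j show ?thesis by (simp add: dyadic_def)
qed

text \<open>The sum telescopes to \<theta>(k / 2^J).\<close>

lemma dyadic_sum: "norm k \<le> 2 ^ J \<Longrightarrow> (\<Sum>j\<le>J. dyadic \<theta> j k) = 1"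
proof -
  assume k: "norm k \<le> 2 ^ J"
  have "(\<Sum>j\<le>J. dyadic \<theta> j k) = \<theta> (k /\<^sub>R 2 ^ J)"
    by (induction J) (simp_all add: dyadic_def)
  also have "\<dots> = 1" using k by (intro theta_1) (simp add: field_simps)
  finally show ?thesis .
qed

lemma lp_cos_coeff:
  assumes a: "\<And>k. a (- k) = a k" and b: "\<And>k. b (- k) = - b k" and l: "l \<in> Zd"
  shows "(LINT x|torus. trig_poly (Kset j) (lp_cos \<theta> j a) (lp_cos \<theta> j b) x * cosk l x) = dyadic \<theta> j l * a l"
    and "(LINT x|torus. trig_poly (Kset j) (lp_cos \<theta> j a) (lp_cos \<theta> j b) x * sink l x) = dyadic \<theta> j l * b l"
proof -
  \<comment> \<open>Restricting the block to \<open>Kset\<close> cuts nothing off: the multiplier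
    vanishes outside the ball of radius 2^(j+1).\<close>
  have *: "dyadic \<theta> j l = 0" if "l \<notin> Kset j"
    using that l dyadic_outside[of j l] by (auto simp: Kset_def Zd_def)
  have AB: "\<And>k. lp_cos \<theta> j a (- k) = lp_cos \<theta> j a k" "\<And>k. lp_cos \<theta> j b (- k) = - lp_cos \<theta> j b k"
    by (simp_all add: lp_cos_def a b)
  show "(LINT x|torus. trig_poly (Kset j) (lp_cos \<theta> j a) (lp_cos \<theta> j b) x * cosk l x) = dyadic \<theta> j l * a l"
    by (subst trig_poly_coeff(1)[where A = "lp_cos \<theta> j a" and B = "lp_cos \<theta> j b", OF finite_card_Kset(1) Kset_props AB l])
      (auto simp: * lp_cos_def)
  show "(LINT x|torus. trig_poly (Kset j) (lp_cos \<theta> j a) (lp_cos \<theta> j b) x * sink l x) = dyadic \<theta> j l * b l"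
    by (subst trig_poly_coeff(2)[where A = "lp_cos \<theta> j a" and B = "lp_cos \<theta> j b", OF finite_card_Kset(1) Kset_props AB l])
      (auto simp: * lp_cos_def)
qed

lemma abs_integral_mult_le:
  fixes u v :: "real^'e \<Rightarrow> real"
  assumes "continuous_on UNIV u" "continuous_on UNIV v" "\<And>x. \<bar>v x\<bar> \<le> 1"
  shows "\<bar>LINT x|torus. u x * v x\<bar> \<le> (LINT x|torus. \<bar>u x\<bar>)"
proof -
  have "\<bar>LINT x|torus. u x * v x\<bar> \<le> (LINT x|torus. \<bar>u x * v x\<bar>)" by (rule integral_abs_bound)
  also have "\<dots> \<le> (LINT x|torus. \<bar>u x\<bar>)"
    using assms
    by (intro Bochner_Integration.integral_mono torus_integrable continuous_intros)
       (simp_all add: abs_mult mult_right_le_one_le)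
  finally show ?thesis .
qed

text \<open>The blocks 0 to J already recover the coefficient at l, and each contributes at most its
  L^1 norm. With J near log2 |l| this is logarithmic growth.\<close>

lemma fourier_coeff_bound:
  assumes l: "norm l \<le> 2 ^ J"
    and C: "\<And>j. (LINT x|torus. \<bar>lp_block \<theta> j f x\<bar>) \<le> C"
  shows "\<bar>fc f l\<bar> \<le> (real J + 1) * C" "\<bar>fs f l\<bar> \<le> (real J + 1) * C"
proof -
  have "0 \<le> (LINT x|torus. \<bar>lp_block \<theta> 0 f x\<bar>)" by simp
  then have C0: "0 \<le> C" using C[of 0] by linarith
  have "\<bar>fc f l\<bar> \<le> (real J + 1) * C \<and> \<bar>fs f l\<bar> \<le> (real J + 1) * C"
  proof (cases "l \<in> Zd")
    case True
    have sums: "fc f l = (\<Sum>j\<le>J. dyadic \<theta> j l * fc f l)" "fs f l = (\<Sum>j\<le>J. dyadic \<theta> j l * fs f l)"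
      using dyadic_sum[OF l] by (simp_all flip: sum_distrib_right)
    have terms: "\<bar>dyadic \<theta> j l * fc f l\<bar> \<le> C" "\<bar>dyadic \<theta> j l * fs f l\<bar> \<le> C" for j
    proof -
      have "\<bar>LINT x|torus. lp_block \<theta> j f x * cosk l x\<bar> \<le> C" "\<bar>LINT x|torus. lp_block \<theta> j f x * sink l x\<bar> \<le> C"
        by (rule order_trans[OF abs_integral_mult_le[OF lp_block_cont continuous_on_cosk(1)] C], simp add: cosk_def)
           (rule order_trans[OF abs_integral_mult_le[OF lp_block_cont continuous_on_cosk(2)] C], simp add: sink_def)
      then show "\<bar>dyadic \<theta> j l * fc f l\<bar> \<le> C" "\<bar>dyadic \<theta> j l * fs f l\<bar> \<le> C"
        unfolding lp_block_trig by (simp_all add: lp_cos_coeff True)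
    qed
    have bound: "\<bar>\<Sum>j\<le>J. z j\<bar> \<le> (real J + 1) * C" if "\<And>j. \<bar>z j\<bar> \<le> C" for z :: "nat \<Rightarrow> real"
      using order_trans[OF sum_abs sum_mono[of "{..J}" "\<lambda>j. \<bar>z j\<bar>" "\<lambda>_. C"]] that
      by (simp add: algebra_simps)
    show ?thesis
      using bound[of "\<lambda>j. dyadic \<theta> j l * fc f l"] bound[of "\<lambda>j. dyadic \<theta> j l * fs f l"] terms
      unfolding sums[symmetric] by simp
  next
    case False
    then show ?thesis using C0 by (simp add: fc_def fs_def)
  qed
  then show "\<bar>fc f l\<bar> \<le> (real J + 1) * C" "\<bar>fs f l\<bar> \<le> (real J + 1) * C" by auto
qed

text \<open>Parseval for the block, multipliers of modulus at most 1 and Bessel for g bound the L^2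
  norm, which dominates the L^1 norm on the torus.\<close>

lemma lp_block_distr_of_L1:
  assumes g: "continuous_on UNIV g"
  shows "(LINT x|torus. \<bar>lp_block \<theta> j (distr_of g) x\<bar>) \<le> sqrt (LINT x|torus. (g x)\<^sup>2)"
proof -
  have fg: "fc (distr_of g) k = (LINT x|torus. cosk k x * g x)" "fs (distr_of g) k = (LINT x|torus. sink k x * g x)"
    if "k \<in> Zd" for k
    using that by (simp_all add: fc_def fs_def dapply_distr_of torus_integrable g cosk_test mult.commute)
  have "(LINT x|torus. (lp_block \<theta> j (distr_of g) x)\<^sup>2)
      = (\<Sum>k\<in>Kset j. (lp_cos \<theta> j (fc (distr_of g)) k)\<^sup>2 + (lp_cos \<theta> j (fs (distr_of g)) k)\<^sup>2)"
    unfolding lp_block_trig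
    by (rule trig_poly_square[OF finite_card_Kset(1) Kset_props]) (simp_all add: lp_cos_def)
  also have "\<dots> \<le> (\<Sum>k\<in>Kset j. (LINT x|torus. cosk k x * g x)\<^sup>2 + (LINT x|torus. sink k x * g x)\<^sup>2)"
  proof (rule sum_mono)
    fix k :: "real^'d" assume "k \<in> Kset j"
    then have "k \<in> Zd" using Kset_props(1) by blast
    have "(dyadic \<theta> j k)\<^sup>2 \<le> 1" using abs_dyadic_le[of j k] by (simp add: abs_square_le_1)
    then have "(dyadic \<theta> j k)\<^sup>2 * z\<^sup>2 \<le> z\<^sup>2" for z by (intro mult_left_le_one_le) auto
    then show "(lp_cos \<theta> j (fc (distr_of g)) k)\<^sup>2 + (lp_cos \<theta> j (fs (distr_of g)) k)\<^sup>2
       \<le> (LINT x|torus. cosk k x * g x)\<^sup>2 + (LINT x|torus. sink k x * g x)\<^sup>2"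
      unfolding lp_cos_def power_mult_distrib fg[OF \<open>k \<in> Zd\<close>] by (intro add_mono)
  qed
  also have "\<dots> \<le> (LINT x|torus. (g x)\<^sup>2)"
    by (rule bessel[OF finite_card_Kset(1) Kset_props g])
  finally have 1: "(LINT x|torus. (lp_block \<theta> j (distr_of g) x)\<^sup>2) \<le> (LINT x|torus. (g x)\<^sup>2)" .
  have 2: "(LINT x|torus. \<bar>lp_block \<theta> j (distr_of g) x\<bar>) \<le> sqrt (LINT x|torus. (lp_block \<theta> j (distr_of g) x)\<^sup>2)"
    using L1_le_Lpt[OF lp_block_cont, of 2 \<theta> j "distr_of g"] by (simp add: Lpt_def powr_half_sqrt)
  show ?thesis by (rule order_trans[OF 2 real_sqrt_le_mono[OF 1]])
qed

text \<open>Serves for finite sums of wavelets, which need not be test functions: it puts them in a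
  space where \<open>wavelet_system\<close> controls coefficients.\<close>

lemma distr_of_besov:
  assumes g: "continuous_on UNIV g"
  shows "distr_of g \<in> besov \<theta> 0 1 \<infinity>"
proof -
  have "eLp_norm torus 1 (\<lambda>x. ennreal \<bar>lp_block \<theta> j (distr_of g) x\<bar>) \<le> ennreal (sqrt (LINT x|torus. (g x)\<^sup>2))" for j
    using eLp_norm_torus[OF lp_block_cont, of 1 \<theta> j "distr_of g"] lp_block_distr_of_L1[OF g, of j]
    by (simp add: Lpt_def ennreal_leI)
  then have "besov_enorm \<theta> 0 1 \<infinity> (distr_of g) \<le> ennreal (sqrt (LINT x|torus. (g x)\<^sup>2))"
    unfolding besov_enorm_def by (intro eLp_norm_sup_least) simp
  then show ?thesis unfolding besov_def by (auto intro: le_less_trans)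
qed

end

section \<open>Distributions with prescribed Fourier coefficients\<close>

lemma partials_lincomb:
  assumes "\<eta> \<in> test_functions" "\<zeta> \<in> test_functions"
  shows "partials is (\<lambda>x. b * \<eta> x + c * \<zeta> x) = (\<lambda>x. b * partials is \<eta> x + c * partials is \<zeta> x)"
proof (induction "is")
  case (Cons i "is")
  have *: "partials is' \<xi> \<in> test_functions" if "\<xi> \<in> test_functions" for \<xi> is'
    using that by (induction is') (auto simp: partials_def test_partial)
  have "((\<lambda>t. b * partials is \<eta> (x + t *\<^sub>R axis i 1) + c * partials is \<zeta> (x + t *\<^sub>R axis i 1))
      has_field_derivative b * partial i (partials is \<eta>) x + c * partial i (partials is \<zeta>) x) (at 0)" for x
    by (intro DERIV_add DERIV_cmult test_deriv * assms)
  then have "partial i (\<lambda>x. b * partials is \<eta> x + c * partials is \<zeta> x) = (\<lambda>x. b * partial i (partials is \<eta>) x + c * partial i (partials is \<zeta>) x)"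
    by (intro ext) (simp add: partial_def[of i "\<lambda>x. b * partials is \<eta> x + c * partials is \<zeta> x"] DERIV_imp_deriv)
  with Cons show ?case by (simp add: partials_def)
qed (simp add: partials_def)

lemma test_lincomb:
  assumes "\<eta> \<in> test_functions" "\<zeta> \<in> test_functions"
  shows "(\<lambda>x. b * \<eta> x + c * \<zeta> x) \<in> test_functions"
proof -
  have d: "(\<lambda>t. partials is \<xi> (x + t *\<^sub>R axis i 1)) differentiable at (0::real)"
    if "\<xi> \<in> test_functions" for \<xi> :: "real^'a \<Rightarrow> real" and "is" i x
    using that unfolding test_functions_def C_k_def by blast
  have "C_k m (\<lambda>x. b * \<eta> x + c * \<zeta> x)" for m
    unfolding C_k_def partials_lincomb[OF assms]
    by (intro conjI allI impI derivative_intros continuous_intros test_cont d assms)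
  moreover have "periodic (\<lambda>x. b * \<eta> x + c * \<zeta> x)"
    using assms by (simp add: test_functions_def periodic_def)
  ultimately show ?thesis by (simp add: test_functions_def)
qed


text \<open>Subtracting the integer parts of all coordinates moves any point into the unit cube,
  where compactness applies.\<close>

lemma test_bounded:
  fixes \<zeta> :: "real^'d \<Rightarrow> real"
  assumes "\<zeta> \<in> test_functions"
  shows "\<exists>B. \<forall>x. \<bar>\<zeta> x\<bar> \<le> B"
proof -
  have "compact (\<zeta> ` cbox 0 1)"
    using test_cont0[OF assms] by (intro compact_continuous_image) (auto intro: continuous_on_subset)
  then obtain B where B: "\<And>x. x \<in> cbox 0 1 \<Longrightarrow> norm (\<zeta> x) \<le> B"
    using compact_imp_bounded[of "\<zeta> ` cbox 0 1"] unfolding bounded_iff by blast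
  have per: "\<zeta> (x + axis i 1) = \<zeta> x" for x i using assms by (simp add: test_functions_def periodic_def)
  have per_n: "\<zeta> (x + real n *\<^sub>R axis i 1) = \<zeta> x" for x i n
  proof (induction n)
    case (Suc n)
    have "\<zeta> (x + real (Suc n) *\<^sub>R axis i 1) = \<zeta> ((x + real n *\<^sub>R axis i 1) + axis i 1)"
      by (simp add: scaleR_add_left algebra_simps)
    then show ?case using per Suc by simp
  qed simp
  have per_z: "\<zeta> (x + of_int z *\<^sub>R axis i 1) = \<zeta> x" for x i z
  proof (cases "0 \<le> z")
    case True
    then show ?thesis using per_n[of x "nat z" i] by simp
  next
    case False
    then show ?thesis using per_n[of "x + of_int z *\<^sub>R axis i 1" "nat (- z)" i] by simp
  qed
  have per_sum: "\<zeta> (x + (\<Sum>i\<in>S. of_int (z i) *\<^sub>R axis i 1)) = \<zeta> x" if "finite S" for S x z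
    using that
  proof (induction S arbitrary: x)
    case (insert i S)
    have "\<zeta> (x + (\<Sum>i\<in>insert i S. of_int (z i) *\<^sub>R axis i 1)) = \<zeta> ((x + (\<Sum>i\<in>S. of_int (z i) *\<^sub>R axis i 1)) + of_int (z i) *\<^sub>R axis i 1)"
      using insert(1,2) by (simp add: add_ac)
    then show ?case using per_z insert.IH by simp
  qed simp
  have "\<bar>\<zeta> x\<bar> \<le> B" for x
  proof -
    define y where "y = x + (\<Sum>i\<in>UNIV. of_int (- \<lfloor>x $ i\<rfloor>) *\<^sub>R axis i 1)"
    have "y $ i = frac (x $ i)" for i
    proof -
      have "(\<Sum>j\<in>UNIV. of_int (- \<lfloor>x $ j\<rfloor>) *\<^sub>R axis j (1::real)) $ i = (\<Sum>j\<in>UNIV. if j = i then - of_int \<lfloor>x $ i\<rfloor> else 0)"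
        unfolding sum_component by (intro sum.cong) (auto simp: axis_def)
      then show ?thesis by (simp add: y_def frac_def)
    qed
    then have "y \<in> cbox 0 1" by (simp add: mem_box_cart less_imp_le[OF frac_lt_1])
    then show ?thesis using B[of y] per_sum[of UNIV x "\<lambda>i. - \<lfloor>x $ i\<rfloor>"] by (simp add: y_def)
  qed
  then show ?thesis by blast
qed

context lp_setting
begin

text \<open>There are at most 2^((j+3)d) frequencies, with coefficients at most (j+2)C \<le> 2 * 2^j
  * C, and d + 2 integrations by parts give 2^(-j(d+2)) up to constants. The order d + 2 is what
  leaves a factor 2^(-j).\<close>

lemma lp_cos_pairing_bound:
  fixes a b :: "real^'d \<Rightarrow> real"
  assumes C: "\<And>l J. norm l \<le> 2 ^ J \<Longrightarrow> \<bar>a l\<bar> \<le> (real J + 1) * C" "\<And>l J. norm l \<le> 2 ^ J \<Longrightarrow> \<bar>b l\<bar> \<le> (real J + 1) * C"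
    and \<eta>: "\<eta> \<in> test_functions"
    and B: "\<And>is x. length is \<le> CARD('d) + 2 \<Longrightarrow> \<bar>partials is \<eta> x\<bar> \<le> B"
  shows "\<bar>LINT x|torus. trig_poly (Kset j) (lp_cos \<theta> j a) (lp_cos \<theta> j b) x * \<eta> x\<bar>
    \<le> 2 ^ (3 * CARD('d)) * 4 * C * (2 * CARD('d)) ^ (CARD('d) + 2) * B * (1 / 2) ^ j"
proof -
  define d where "d = CARD('d)"
  define E where "E = (2 * d / 2 ^ j) ^ (d + 2) * B"
  have d: "1 \<le> d" by (simp add: d_def Suc_leI)
  have B0: "0 \<le> B" using B[of "[]" 0] by (simp add: partials_def)
  have C0: "0 \<le> C" using C(1)[of 0 0] by simp
  have E0: "0 \<le> E" using B0 by (simp add: E_def)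
  have decay: "\<bar>LINT x|torus. \<eta> x * tr k c x\<bar> \<le> E" if k: "k \<in> Kset j" and dy: "dyadic \<theta> j k \<noteq> 0" for k c
  proof -
    have kZ: "k \<in> Zd" using k Kset_props(1) by blast
    show ?thesis
    proof (cases "j = 0")
      \<comment> \<open>Block 0 contains k = 0, where nothing decays; the supremum bound
        suffices.\<close>
      case True
      have "\<bar>LINT x|torus. \<eta> x * tr k c x\<bar> \<le> 1 * B"
        using fourier_decay[OF \<eta> kZ, of 0 undefined B c] B[of "[]"] by simp
      also have "\<dots> \<le> (2 * real d) ^ (d + 2) * B"
      proof (intro mult_right_mono one_le_power B0)
        show "1 \<le> 2 * real d" using d by simp
      qed
      finally show ?thesis by (simp add: E_def True)
    next
      case False
      then have j: "1 \<le> j" by simp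
      have nk: "2 ^ (j - 1) \<le> norm k" using dyadic_inside[OF j, of k] dy by linarith
      \<comment> \<open>The largest coordinate is at least |k|/d, hence at least 2^j/(2d) on this
        annulus; integration by parts is done in its direction.\<close>
      have "norm k \<le> (\<Sum>i\<in>UNIV. \<bar>k $ i\<bar>)" by (rule norm_le_l1_cart)
      also have "\<dots> \<le> d * Max (range (\<lambda>i. \<bar>k $ i\<bar>))"
        using sum_bounded_above[of UNIV "\<lambda>i. \<bar>k $ i\<bar>" "Max (range (\<lambda>i. \<bar>k $ i\<bar>))"] by (simp add: d_def)
      finally have nM: "norm k \<le> d * Max (range (\<lambda>i. \<bar>k $ i\<bar>))" .
      have "Max (range (\<lambda>i. \<bar>k $ i\<bar>)) \<in> range (\<lambda>i. \<bar>k $ i\<bar>)" by (intro Max_in) auto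
      then obtain i where "Max (range (\<lambda>i. \<bar>k $ i\<bar>)) = \<bar>k $ i\<bar>" by (rule rangeE)
      then have "norm k \<le> d * \<bar>k $ i\<bar>" using nM by simp
      then have "2 ^ (j - 1) \<le> d * \<bar>k $ i\<bar>" using nk by linarith
      moreover have "(2::real) ^ j = 2 * 2 ^ (j - 1)" using j by (cases j) auto
      ultimately have ki: "1 \<le> (2 * d / 2 ^ j) * \<bar>k $ i\<bar>" by (simp add: field_simps)
      define z where "z = \<bar>LINT x|torus. \<eta> x * tr k c x\<bar>"
      have z0: "0 \<le> z" by (simp add: z_def)
      have zB: "z * (2 * pi * \<bar>k $ i\<bar>) ^ (d + 2) \<le> B"
        unfolding z_def using fourier_decay[OF \<eta> kZ, of "d + 2" i B c] B by (simp add: d_def)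
      have "z * 1 \<le> z * ((2 * d / 2 ^ j) * \<bar>k $ i\<bar>) ^ (d + 2)"
        using ki z0 by (intro mult_left_mono one_le_power) auto
      also have "\<dots> = (2 * d / 2 ^ j) ^ (d + 2) * (z * \<bar>k $ i\<bar> ^ (d + 2))"
        by (simp only: power_mult_distrib mult_ac)
      also have "\<dots> \<le> (2 * d / 2 ^ j) ^ (d + 2) * (z * (2 * pi * \<bar>k $ i\<bar>) ^ (d + 2))"
      proof (intro mult_left_mono power_mono)
        have "1 * \<bar>k $ i\<bar> \<le> (2 * pi) * \<bar>k $ i\<bar>" using pi_gt3 by (intro mult_right_mono) auto
        then show "\<bar>k $ i\<bar> \<le> 2 * pi * \<bar>k $ i\<bar>" by simp
      qed (use z0 in auto)
      also have "\<dots> \<le> E" unfolding E_def by (intro mult_left_mono zB) auto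
      finally show ?thesis by (simp add: z_def)
    qed
  qed
  have term_le: "\<bar>lp_cos \<theta> j a k * (LINT x|torus. cosk k x * \<eta> x) + lp_cos \<theta> j b k * (LINT x|torus. sink k x * \<eta> x)\<bar>
      \<le> 2 * ((real j + 2) * C * E)" if k: "k \<in> Kset j" for k
  proof (cases "dyadic \<theta> j k = 0")
    case True
    then show ?thesis using C0 E0 by (simp add: lp_cos_def)
  next
    case False
    have nk: "norm k \<le> 2 ^ (j + 1)" using k by (simp add: Kset_def)
    have "\<bar>dyadic \<theta> j k\<bar> * \<bar>a k\<bar> \<le> 1 * ((real j + 2) * C)" "\<bar>dyadic \<theta> j k\<bar> * \<bar>b k\<bar> \<le> 1 * ((real j + 2) * C)"
      using C(1)[OF nk] C(2)[OF nk] by (intro mult_mono abs_dyadic_le; simp add: add.commute)+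
    then have ab: "\<bar>lp_cos \<theta> j a k\<bar> \<le> (real j + 2) * C" "\<bar>lp_cos \<theta> j b k\<bar> \<le> (real j + 2) * C"
      by (simp_all add: lp_cos_def abs_mult)
    have "\<bar>lp_cos \<theta> j a k * (LINT x|torus. cosk k x * \<eta> x)\<bar> \<le> (real j + 2) * C * E"
      "\<bar>lp_cos \<theta> j b k * (LINT x|torus. sink k x * \<eta> x)\<bar> \<le> (real j + 2) * C * E"
      unfolding abs_mult using ab C0 decay[OF k False]
      by (intro mult_mono; simp add: cosk_tr sink_tr mult.commute[of "tr _ _ _"])+
    then show ?thesis by linarith
  qed
  have "\<bar>LINT x|torus. trig_poly (Kset j) (lp_cos \<theta> j a) (lp_cos \<theta> j b) x * \<eta> x\<bar>
     \<le> (\<Sum>k\<in>(Kset j :: (real^'d) set). 2 * ((real j + 2) * C * E))"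
    unfolding trig_poly_integral[OF test_cont0[OF \<eta>]]
    by (rule order_trans[OF sum_abs sum_mono]) (rule term_le)
  also have "\<dots> = card (Kset j :: (real^'d) set) * (2 * ((real j + 2) * C * E))" by simp
  also have "\<dots> \<le> 2 ^ ((j + 3) * d) * (2 * ((2 * 2 ^ j) * C * E))"
  proof (intro mult_mono mult_left_mono mult_right_mono)
    show "real (card (Kset j :: (real^'d) set)) \<le> 2 ^ ((j + 3) * d)"
      using finite_card_Kset(2)[where 'd = 'd, of j] unfolding d_def of_nat_le_iff[where 'a = real, symmetric] by simp
    have "Suc j + 1 \<le> 2 ^ Suc j" by (induction j) auto
    then have "real (Suc j + 1) \<le> real (2 ^ Suc j)" by (simp only: of_nat_le_iff)
    then show "real j + 2 \<le> 2 * 2 ^ j" by simp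
  qed (use C0 E0 in auto)
  also have "\<dots> = 2 ^ (3 * d) * 4 * C * (2 * d) ^ (d + 2) * B * (1 / 2) ^ j"
  proof -
    have "(2::real) ^ ((j + 3) * d) = 2 ^ (j * d) * 2 ^ (3 * d)" by (simp add: add_mult_distrib power_add)
    moreover have "((2::real) ^ j) ^ (d + 2) = 2 ^ (j * d) * 2 ^ j * 2 ^ j"
      by (simp add: power_add power_mult power2_eq_square)
    ultimately show ?thesis
      unfolding E_def by (simp add: power_divide field_simps)
  qed
  finally show ?thesis by (simp add: d_def)
qed

text \<open>The distribution is the sum of the tested blocks. By \<open>lp_cos_pairing_bound\<close>
  the series converges geometrically and is bounded by derivatives up to order d + 2.\<close>

lemma distribution_from_coeffs:
  fixes a b :: "real^'d \<Rightarrow> real"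
  assumes C: "\<And>l J. norm l \<le> 2 ^ J \<Longrightarrow> \<bar>a l\<bar> \<le> (real J + 1) * C" "\<And>l J. norm l \<le> 2 ^ J \<Longrightarrow> \<bar>b l\<bar> \<le> (real J + 1) * C"
    and even: "\<And>l. a (- l) = a l" and odd: "\<And>l. b (- l) = - b l"
  obtains G where "\<And>l. l \<in> Zd \<Longrightarrow> fc G l = a l" "\<And>l. l \<in> Zd \<Longrightarrow> fs G l = b l"
proof -
  define U where "U j \<eta> = (LINT x|torus. trig_poly (Kset j) (lp_cos \<theta> j a) (lp_cos \<theta> j b) x * \<eta> x)" for j and \<eta> :: "real^'d \<Rightarrow> real"
  define u where "u \<eta> = (if \<eta> \<in> test_functions then \<Sum>j. U j \<eta> else 0)" for \<eta>
  define M where "M = 2 ^ (3 * CARD('d)) * 4 * C * (2 * CARD('d)) ^ (CARD('d) + 2)"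
  have Ule: "\<bar>U j \<eta>\<bar> \<le> M * B * (1 / 2) ^ j"
    if "\<eta> \<in> test_functions" "\<And>is x. length is \<le> CARD('d) + 2 \<Longrightarrow> \<bar>partials is \<eta> x\<bar> \<le> B" for \<eta> B j
    unfolding U_def M_def using lp_cos_pairing_bound[OF C that(1)] that(2) by simp
  have bdd: "\<exists>B. \<forall>is x. length is \<le> n \<longrightarrow> \<bar>partials is \<eta> x\<bar> \<le> B" if \<eta>: "\<eta> \<in> test_functions" for \<eta> :: "real^'d \<Rightarrow> real" and n
  proof -
    have "partials is \<eta> \<in> test_functions" for "is"
      using \<eta> by (induction "is") (auto simp: partials_def test_partial)
    then have "\<forall>is. \<exists>B. \<forall>x. \<bar>partials is \<eta> x\<bar> \<le> B" using test_bounded by blast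
    then obtain b where b: "\<And>is x. \<bar>partials is \<eta> x\<bar> \<le> b is" by metis
    have fin: "finite {is :: 'd list. length is \<le> n}"
      using finite_lists_length_le[of "UNIV :: 'd set" n] by simp
    have "\<bar>partials is \<eta> x\<bar> \<le> Max (b ` {is. length is \<le> n})" if "length is \<le> n" for "is" x
      by (rule order_trans[OF b Max_ge]) (use fin that in auto)
    then show ?thesis by blast
  qed
  have sumU: "summable (\<lambda>j. U j \<eta>)" if tf: "\<eta> \<in> test_functions" for \<eta>
  proof -
    obtain B where B: "\<And>is x. length is \<le> CARD('d) + 2 \<Longrightarrow> \<bar>partials is \<eta> x\<bar> \<le> B" using bdd[OF tf, of "CARD('d) + 2"] by blast
    show ?thesis
      by (rule summable_comparison_test'[of "\<lambda>j. M * B * (1 / 2) ^ j"])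
         (auto intro!: summable_mult summable_geometric simp: Ule[OF tf B])
  qed
  have "is_distribution u"
    unfolding is_distribution_def
  proof (intro conjI ballI allI impI exI)
    show "u \<eta> = 0" if "\<eta> \<notin> test_functions" for \<eta> using that by (simp add: u_def)
    fix \<eta> \<zeta> :: "real^'d \<Rightarrow> real" and b' c'
    assume tf: "\<eta> \<in> test_functions" "\<zeta> \<in> test_functions"
    have "U j (\<lambda>x. b' * \<eta> x + c' * \<zeta> x) = b' * U j \<eta> + c' * U j \<zeta>" for j
    proof -
      let ?T = "trig_poly (Kset j) (lp_cos \<theta> j a) (lp_cos \<theta> j b)"
      have i: "integrable torus (\<lambda>x. ?T x * \<eta> x)" "integrable torus (\<lambda>x. ?T x * \<zeta> x)"
        by (intro torus_integrable continuous_intros test_cont0 tf)+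
      have "U j (\<lambda>x. b' * \<eta> x + c' * \<zeta> x) = (LINT x|torus. b' * (?T x * \<eta> x) + c' * (?T x * \<zeta> x))"
        unfolding U_def by (simp only: distrib_left mult.left_commute)
      also have "\<dots> = b' * U j \<eta> + c' * U j \<zeta>"
        unfolding U_def using i by simp
      finally show ?thesis .
    qed
    then show "u (\<lambda>x. b' * \<eta> x + c' * \<zeta> x) = b' * u \<eta> + c' * u \<zeta>"
      using tf by (simp add: u_def test_lincomb suminf_add[symmetric] suminf_mult summable_mult sumU)
  next
    fix \<eta> :: "real^'d \<Rightarrow> real" and B
    assume tf: "\<eta> \<in> test_functions" and "\<forall>is x. length is \<le> CARD('d) + 2 \<longrightarrow> \<bar>partials is \<eta> x\<bar> \<le> B"
    then have le: "\<bar>U j \<eta>\<bar> \<le> M * B * (1 / 2) ^ j" for j by (intro Ule) auto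
    have sg: "summable (\<lambda>j. M * B * (1 / 2) ^ j)" by (auto intro!: summable_mult summable_geometric)
    have sa: "summable (\<lambda>j. \<bar>U j \<eta>\<bar>)"
      by (rule summable_comparison_test'[OF sg]) (use le in auto)
    have "\<bar>u \<eta>\<bar> \<le> (\<Sum>j. \<bar>U j \<eta>\<bar>)" using tf summable_rabs[OF sa] by (simp add: u_def)
    also have "\<dots> \<le> (\<Sum>j. M * B * (1 / 2) ^ j)" by (intro suminf_le le sa sg)
    also have "\<dots> = 2 * M * B" by (subst suminf_mult) (auto simp: suminf_geometric)
    finally show "\<bar>u \<eta>\<bar> \<le> 2 * M * B" .
  qed
  then have G: "dapply (Abs_distribution u) = u" by (simp add: Abs_distribution_inverse)
  \<comment> \<open>Only the blocks j \<le> J see the frequency l, so the series is a finite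
    telescoping sum.\<close>
  have "(\<Sum>j. dyadic \<theta> j l * z) = z" for l :: "real^'d" and z
  proof -
    have "\<exists>J. norm l \<le> 2 ^ J"
      using real_arch_pow[of 2 "norm l"] by (auto intro: less_imp_le)
    then obtain J where J: "norm l \<le> 2 ^ J" by blast
    have "dyadic \<theta> j l * z = 0" if "j \<notin> {..J}" for j
    proof -
      have "(2::real) ^ J \<le> 2 ^ (j - 1)" using that by (intro power_increasing) auto
      then have "norm l \<le> 2 ^ (j - 1)" using J by linarith
      then have "dyadic \<theta> j l = 0" using that by (intro dyadic_inside) auto
      then show ?thesis by simp
    qed
    then have "(\<Sum>j. dyadic \<theta> j l * z) = (\<Sum>j\<le>J. dyadic \<theta> j l * z)" by (intro suminf_finite) auto
    also have "\<dots> = z" using dyadic_sum[OF J] by (simp flip: sum_distrib_right)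
    finally show ?thesis .
  qed
  then have "fc (Abs_distribution u) l = a l" "fs (Abs_distribution u) l = b l" if "l \<in> Zd" for l
    using that by (simp_all add: fc_def fs_def G u_def cosk_test U_def lp_cos_coeff even odd)
  then show ?thesis using that by blast
qed

definition bl :: "real \<Rightarrow> nat \<Rightarrow> 'd distribution \<Rightarrow> real" where
  "bl p j f = Lpt p (lp_block \<theta> j f)"

lemma bl_nonneg: "0 \<le> bl p j f"
  by (simp add: bl_def Lpt_nonneg)

text \<open>A block depends on finitely many Fourier coefficients, so their convergence gives
  convergence of block norms, and the Cauchy bound passes to the limit on every partial sum. Stating
  bounds on partial sums avoids presupposing that the series for the limit converges.\<close>

theorem lp_complete:
  fixes g :: "nat \<Rightarrow> 'd distribution"
  assumes p: "1 \<le> p" and q: "0 < q"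
    and C: "\<And>n j. bl p j (g n) \<le> C n"
    and cauchy: "\<And>\<epsilon>. 0 < \<epsilon> \<Longrightarrow> \<exists>M. \<forall>m\<ge>M. \<forall>n\<ge>M. \<forall>J. (\<Sum>j<J. bl p j (g m - g n) powr q) \<le> \<epsilon> powr q"
  obtains G where "\<And>\<epsilon>. 0 < \<epsilon> \<Longrightarrow> \<exists>M. \<forall>n\<ge>M. \<forall>J. (\<Sum>j<J. bl p j (g n - G) powr q) \<le> \<epsilon> powr q"
proof -
  have L1: "(LINT x|torus. \<bar>lp_block \<theta> j f x\<bar>) \<le> bl p j f" for j f
    unfolding bl_def by (intro L1_le_Lpt lp_block_cont p)
  have L1_cauchy: "\<exists>M. \<forall>m\<ge>M. \<forall>n\<ge>M. \<forall>j. (LINT x|torus. \<bar>lp_block \<theta> j (g m - g n) x\<bar>) \<le> \<epsilon>" if \<epsilon>: "0 < \<epsilon>" for \<epsilon>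
  proof -
    obtain M where M: "\<And>m n J. m \<ge> M \<Longrightarrow> n \<ge> M \<Longrightarrow> (\<Sum>j<J. bl p j (g m - g n) powr q) \<le> \<epsilon> powr q"
      using cauchy[OF \<epsilon>] by blast
    have "(LINT x|torus. \<bar>lp_block \<theta> j (g m - g n) x\<bar>) \<le> \<epsilon>" if "m \<ge> M" "n \<ge> M" for m n j
    proof -
      have "bl p j (g m - g n) powr q \<le> (\<Sum>j<Suc j. bl p j (g m - g n) powr q)"
        by (intro member_le_sum) auto
      also have "\<dots> \<le> \<epsilon> powr q" by (rule M[OF that])
      finally have "bl p j (g m - g n) \<le> \<epsilon>"
        using q bl_nonneg \<epsilon> powr_less_mono2[of q \<epsilon> "bl p j (g m - g n)"] by linarith
      then show ?thesis using L1 order_trans by blast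
    qed
    then show ?thesis by blast
  qed
  have conv: "convergent (\<lambda>n. fc (g n) l) \<and> convergent (\<lambda>n. fs (g n) l)" for l
  proof -
    have "\<exists>J. norm l \<le> 2 ^ J"
      using real_arch_pow[of 2 "norm l"] by (auto intro: less_imp_le)
    then obtain J where J: "norm l \<le> 2 ^ J" by blast
    have *: "\<exists>M. \<forall>m\<ge>M. \<forall>n\<ge>M. \<bar>fc (g m) l - fc (g n) l\<bar> < \<epsilon> \<and> \<bar>fs (g m) l - fs (g n) l\<bar> < \<epsilon>" if \<epsilon>: "0 < \<epsilon>" for \<epsilon>
    proof -
      define \<epsilon>' where "\<epsilon>' = \<epsilon> / (2 * (real J + 1))"
      have \<epsilon>': "0 < \<epsilon>'" "(real J + 1) * \<epsilon>' < \<epsilon>"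
        using \<epsilon> by (auto simp: \<epsilon>'_def field_simps intro: add_pos_nonneg)
      obtain M where M: "\<And>m n j. m \<ge> M \<Longrightarrow> n \<ge> M \<Longrightarrow> (LINT x|torus. \<bar>lp_block \<theta> j (g m - g n) x\<bar>) \<le> \<epsilon>'"
        using L1_cauchy[OF \<epsilon>'(1)] by blast
      show ?thesis
        using fourier_coeff_bound[OF J M] \<epsilon>'(2) unfolding fc_diff by (meson le_less_trans)
    qed
    have "Cauchy (\<lambda>n. fc (g n) l)" "Cauchy (\<lambda>n. fs (g n) l)"
      unfolding Cauchy_def dist_real_def using * by blast+
    then show ?thesis by (simp add: Cauchy_convergent_iff)
  qed
  define a where "a l = lim (\<lambda>n. fc (g n) l)" for l
  define b where "b l = lim (\<lambda>n. fs (g n) l)" for l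
  have lim_a: "(\<lambda>n. fc (g n) l) \<longlonglongrightarrow> a l" and lim_b: "(\<lambda>n. fs (g n) l) \<longlonglongrightarrow> b l" for l
    unfolding a_def b_def using conv by (auto simp: convergent_LIMSEQ_iff)
  obtain M0 where M0: "\<And>m n j. m \<ge> M0 \<Longrightarrow> n \<ge> M0 \<Longrightarrow> (LINT x|torus. \<bar>lp_block \<theta> j (g m - g n) x\<bar>) \<le> 1"
    using L1_cauchy[of 1] by auto
  \<comment> \<open>The block bound of the single element \<open>g M0\<close>, plus 1, bounds the
    L^1 norms of all later blocks uniformly in j.\<close>
  define C' where "C' = 1 + C M0"
  have C': "(LINT x|torus. \<bar>lp_block \<theta> j (g m) x\<bar>) \<le> C'" if m: "m \<ge> M0" for m j
  proof -
    have i: "integrable torus (\<lambda>x. \<bar>lp_block \<theta> j f x\<bar>)" for f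
      by (intro torus_integrable continuous_intros lp_block_cont)
    have "(LINT x|torus. \<bar>lp_block \<theta> j (g m) x\<bar>) \<le> (LINT x|torus. \<bar>lp_block \<theta> j (g m - g M0) x\<bar> + \<bar>lp_block \<theta> j (g M0) x\<bar>)"
      by (intro Bochner_Integration.integral_mono Bochner_Integration.integrable_add i) (simp add: lp_block_diff)
    also have "\<dots> = (LINT x|torus. \<bar>lp_block \<theta> j (g m - g M0) x\<bar>) + (LINT x|torus. \<bar>lp_block \<theta> j (g M0) x\<bar>)"
      by (intro Bochner_Integration.integral_add i)
    also have "\<dots> \<le> 1 + C M0"
      by (intro add_mono M0 m order_trans[OF L1 C]) auto
    finally show ?thesis by (simp add: C'_def)
  qed
  obtain G where G: "\<And>l. l \<in> Zd \<Longrightarrow> fc G l = a l" "\<And>l. l \<in> Zd \<Longrightarrow> fs G l = b l"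
  proof (rule distribution_from_coeffs)
    fix l :: "real^'d" and J assume l: "norm l \<le> 2 ^ J"
    have "\<bar>fc (g m) l\<bar> \<le> (real J + 1) * C'" "\<bar>fs (g m) l\<bar> \<le> (real J + 1) * C'" if "m \<ge> M0" for m
      using fourier_coeff_bound[OF l C'] that by auto
    then show "\<bar>a l\<bar> \<le> (real J + 1) * C'" "\<bar>b l\<bar> \<le> (real J + 1) * C'"
      using tendsto_rabs[OF lim_a] tendsto_rabs[OF lim_b] by (blast intro: LIMSEQ_le_const2)+
  next
    show "a (- l) = a l" for l by (simp add: a_def)
    show "b (- l) = - b l" for l
      using LIMSEQ_unique[OF lim_b[of "- l"], of "- b l"] tendsto_minus[OF lim_b[of l]] by simp
  qed blast
  have lim_c: "(\<lambda>m. fc (g m) k) \<longlonglongrightarrow> fc G k" and lim_s: "(\<lambda>m. fs (g m) k) \<longlonglongrightarrow> fs G k" for k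
  proof -
    have "(\<lambda>m. fc (g m) k) \<longlonglongrightarrow> fc G k \<and> (\<lambda>m. fs (g m) k) \<longlonglongrightarrow> fs G k"
    proof (cases "k \<in> Zd")
      case True
      then show ?thesis by (simp add: G lim_a lim_b)
    qed (simp add: fc_def fs_def)
    then show "(\<lambda>m. fc (g m) k) \<longlonglongrightarrow> fc G k" "(\<lambda>m. fs (g m) k) \<longlonglongrightarrow> fs G k" by auto
  qed
  have lim_bl: "(\<lambda>m. bl p j (g n - g m)) \<longlonglongrightarrow> bl p j (g n - G)" for n j
    unfolding bl_def lp_block_trig
    by (intro Lpt_trig_poly_tendsto finite_card_Kset p;
        unfold lp_cos_def fc_diff; intro tendsto_mult tendsto_diff tendsto_const lim_c lim_s)
  have "\<exists>M. \<forall>n\<ge>M. \<forall>J. (\<Sum>j<J. bl p j (g n - G) powr q) \<le> \<epsilon> powr q" if \<epsilon>: "0 < \<epsilon>" for \<epsilon>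
  proof -
    obtain M where M: "\<And>m n J. m \<ge> M \<Longrightarrow> n \<ge> M \<Longrightarrow> (\<Sum>j<J. bl p j (g m - g n) powr q) \<le> \<epsilon> powr q"
      using cauchy[OF \<epsilon>] by blast
    have "(\<Sum>j<J. bl p j (g n - G) powr q) \<le> \<epsilon> powr q" if n: "n \<ge> M" for n J
    proof (rule LIMSEQ_le_const2)
      show "(\<lambda>m. \<Sum>j<J. bl p j (g n - g m) powr q) \<longlonglongrightarrow> (\<Sum>j<J. bl p j (g n - G) powr q)"
        using q bl_nonneg by (intro tendsto_sum tendsto_powr' lim_bl tendsto_const) auto
      show "\<exists>N. \<forall>m\<ge>N. (\<Sum>j<J. bl p j (g n - g m) powr q) \<le> \<epsilon> powr q"
        using M n by blast
    qed
    then show ?thesis by blast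
  qed
  then show ?thesis using that by blast
qed

end

section \<open>Besov spaces and wavelet coefficients\<close>

lemma one_le_ennreal: "1 \<le> x \<Longrightarrow> 1 \<le> ennreal x"
  using ennreal_leI[of 1 x] by simp

text \<open>Superadditivity of the power 2/p, one coordinate at a time.\<close>

lemma lpn_2_le:
  assumes p: "1 \<le> p" "p \<le> 2" and A: "finite A"
  shows "lpn 2 A x \<le> lpn p A x"
proof -
  have "(\<Sum>l\<in>A. \<bar>x l\<bar> powr 2) \<le> (\<Sum>l\<in>A. \<bar>x l\<bar> powr p) powr (2 / p)"
    using A
  proof (induction A rule: finite_induct)
    case (insert i A)
    have "\<bar>x i\<bar> powr 2 = (\<bar>x i\<bar> powr p) powr (2 / p)" using p by (simp only: powr_powr) simp
    then have "(\<Sum>l\<in>insert i A. \<bar>x l\<bar> powr 2) \<le> (\<bar>x i\<bar> powr p) powr (2 / p) + (\<Sum>l\<in>A. \<bar>x l\<bar> powr p) powr (2 / p)"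
      using insert by simp
    also have "\<dots> \<le> (\<bar>x i\<bar> powr p + (\<Sum>l\<in>A. \<bar>x l\<bar> powr p)) powr (2 / p)"
      using p by (intro powr_superadd sum_nonneg) auto
    finally show ?case using insert by simp
  qed simp
  then have "lpn 2 A x \<le> ((\<Sum>l\<in>A. \<bar>x l\<bar> powr p) powr (2 / p)) powr (1 / 2)"
    unfolding lpn_def by (intro powr_mono2 sum_nonneg) auto
  then show ?thesis using p by (simp add: lpn_def powr_powr)
qed

text \<open>Jensen: tangent of the concave power p/2 at the mean Y of the squares; the linear terms
  sum to 0.\<close>

lemma lpn_le_2:
  assumes p: "1 \<le> p" "p \<le> 2" and A: "finite A"
  shows "lpn p A x \<le> real (card A) powr (1 / p - 1 / 2) * lpn 2 A x"
proof (cases "(\<Sum>l\<in>A. \<bar>x l\<bar> powr 2) = 0")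
  case True
  then have "\<forall>l\<in>A. x l = 0" using A by (simp add: sum_nonneg_eq_0_iff)
  then show ?thesis by (simp add: lpn_def)
next
  case False
  define S where "S = (\<Sum>l\<in>A. \<bar>x l\<bar> powr 2)"
  define n where "n = real (card A)"
  have S: "0 < S" using False sum_nonneg[of A "\<lambda>l. \<bar>x l\<bar> powr 2"] by (simp add: S_def)
  have n: "0 < n" using False A by (auto simp: n_def card_gt_0_iff)
  define Y where "Y = S / n"
  have Y: "0 < Y" using S n by (simp add: Y_def)
  have "(\<Sum>l\<in>A. \<bar>x l\<bar> powr p) = (\<Sum>l\<in>A. (\<bar>x l\<bar> powr 2) powr (p / 2))"
    by (simp only: powr_powr) simp
  also have "\<dots> \<le> (\<Sum>l\<in>A. Y powr (p / 2) + p / 2 * Y powr (p / 2 - 1) * (\<bar>x l\<bar> powr 2 - Y))"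
    using p Y by (intro sum_mono powr_below_tangent) auto
  also have "\<dots> = n * Y powr (p / 2) + p / 2 * Y powr (p / 2 - 1) * (S - n * Y)"
  proof -
    have "(\<Sum>l\<in>A. c1 + c2 * (z l - Y)) = n * c1 + c2 * (sum z A - n * Y)" for c1 c2 :: real and z
      by (simp add: sum.distrib sum_subtractf n_def flip: sum_distrib_left)
    then show ?thesis unfolding S_def .
  qed
  also have "\<dots> = n * (S / n) powr (p / 2)" using n by (simp add: Y_def)
  finally have "lpn p A x \<le> (n * (S / n) powr (p / 2)) powr (1 / p)"
    unfolding lpn_def using p by (intro powr_mono2 sum_nonneg) auto
  also have "\<dots> = n powr (1 / p) * (S powr (1 / 2) / n powr (1 / 2))"
    using p by (simp add: powr_mult powr_powr powr_divide)
  also have "\<dots> = n powr (1 / p - 1 / 2) * lpn 2 A x"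
    by (simp add: powr_diff lpn_def S_def)
  finally show ?thesis by (simp add: n_def)
qed

lemma epowr_1: "epowr x 1 = x"
  by (cases x) (simp_all add: epowr_def)

lemma powr_le_suminf:
  fixes b :: "nat \<Rightarrow> real"
  assumes "summable (\<lambda>j. b j powr q)" "0 < q" "\<And>j. 0 \<le> b j"
  shows "b j \<le> (\<Sum>j. b j powr q) powr (1 / q)"
proof -
  have "b j powr q \<le> (\<Sum>j. b j powr q)" using sum_le_suminf[OF assms(1), of "{j}"] by simp
  then have "(b j powr q) powr (1 / q) \<le> (\<Sum>j. b j powr q) powr (1 / q)"
    using assms(2) by (intro powr_mono2) auto
  then show ?thesis using assms by (simp add: powr_powr)
qed

context lp_setting
begin

lemma besov_enorm_0:
  assumes "0 < p" "0 < q"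
  shows "besov_enorm \<theta> 0 (ennreal p) (ennreal q) f =
    (if summable (\<lambda>j. bl p j f powr q) then ennreal ((\<Sum>j. bl p j f powr q) powr (1 / q)) else \<infinity>)"
  using eLp_norm_seq[of q "\<lambda>j. bl p j f", OF assms(2) bl_nonneg] assms
  by (simp add: besov_enorm_def eLp_norm_torus lp_block_cont bl_def)

lemma besov_0_iff:
  assumes "0 < p" "0 < q"
  shows "f \<in> besov \<theta> 0 (ennreal p) (ennreal q) \<longleftrightarrow> summable (\<lambda>j. bl p j f powr q)"
  by (simp add: besov_def besov_enorm_0[OF assms])

lemma bl_le:
  assumes "0 < p" "0 < q" "f \<in> besov \<theta> 0 (ennreal p) (ennreal q)"
  shows "bl p j f \<le> (\<Sum>j. bl p j f powr q) powr (1 / q)"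
  using assms by (intro powr_le_suminf bl_nonneg) (simp_all add: besov_0_iff)

text \<open>Puts X inside B^0_{1,inf}, on which \<open>wav_iff\<close> identifies Besov spaces by
  their wavelet norms.\<close>

lemma besov_sub_B1:
  assumes p: "1 \<le> p" and q: "0 < q" and f: "f \<in> besov \<theta> 0 (ennreal p) (ennreal q)"
  shows "f \<in> besov \<theta> 0 1 \<infinity>"
proof -
  define C where "C = (\<Sum>j. bl p j f powr q) powr (1 / q)"
  have "eLp_norm torus 1 (\<lambda>x. ennreal \<bar>lp_block \<theta> j f x\<bar>) \<le> ennreal C" for j
  proof -
    have "Lpt 1 (lp_block \<theta> j f) \<le> C"
      using L1_le_Lpt[OF lp_block_cont, of p \<theta> j f] bl_le[of p q f j] p q f
      by (simp add: Lpt_def bl_def C_def)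
    then show ?thesis using eLp_norm_torus[OF lp_block_cont, of 1 \<theta> j f] by (simp add: ennreal_leI)
  qed
  then have "besov_enorm \<theta> 0 1 \<infinity> f \<le> ennreal C"
    unfolding besov_enorm_def by (intro eLp_norm_sup_least) simp
  then show ?thesis unfolding besov_def by (auto intro: le_less_trans)
qed

text \<open>Set against the corresponding wavelet norms in \<open>card_level_bound\<close>, this
  inclusion limits the number of wavelets.\<close>

lemma besov_B1_le_B2: "besov_enorm \<theta> 0 1 \<infinity> f \<le> besov_enorm \<theta> 0 2 \<infinity> f"
proof -
  have le: "eLp_norm torus 1 (\<lambda>x. ennreal \<bar>lp_block \<theta> j f x\<bar>) \<le> eLp_norm torus 2 (\<lambda>x. ennreal \<bar>lp_block \<theta> j f x\<bar>)" for j
    using L1_le_Lpt[OF lp_block_cont, of 2 \<theta> j f] eLp_norm_torus[OF lp_block_cont, of 1 \<theta> j f]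
      eLp_norm_torus[OF lp_block_cont, of 2 \<theta> j f] by (simp add: ennreal_leI Lpt_def)
  then show ?thesis
    unfolding besov_enorm_def
  proof (intro eLp_norm_sup_least)
    fix j
    have "ennreal (2 powr (real j * 0)) * eLp_norm torus 1 (\<lambda>x. ennreal \<bar>lp_block \<theta> j f x\<bar>)
        \<le> ennreal (2 powr (real j * 0)) * eLp_norm torus 2 (\<lambda>x. ennreal \<bar>lp_block \<theta> j f x\<bar>)"
      by (intro mult_left_mono le) auto
    also have "\<dots> \<le> eLp_norm (count_space UNIV) \<infinity> (\<lambda>j. ennreal (2 powr (real j * 0)) * eLp_norm torus 2 (\<lambda>x. ennreal \<bar>lp_block \<theta> j f x\<bar>))"
      by (rule eLp_norm_sup_upper)
    finally show "ennreal (2 powr (real j * 0)) * eLp_norm torus 1 (\<lambda>x. ennreal \<bar>lp_block \<theta> j f x\<bar>)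
        \<le> eLp_norm (count_space UNIV) \<infinity> (\<lambda>j. ennreal (2 powr (real j * 0)) * eLp_norm torus 2 (\<lambda>x. ennreal \<bar>lp_block \<theta> j f x\<bar>))" .
  qed
qed

text \<open>Only membership is at stake, so the crude \<open>powr_add_le\<close> replaces
  Minkowski's inequality, with exponent p inside a block and q/p across blocks.\<close>

lemma besov_lincomb:
  assumes p: "1 \<le> p" and q: "0 < q"
    and f: "f \<in> besov \<theta> 0 (ennreal p) (ennreal q)" and g: "g \<in> besov \<theta> 0 (ennreal p) (ennreal q)"
  shows "b *\<^sub>R f + c *\<^sub>R g \<in> besov \<theta> 0 (ennreal p) (ennreal q)"
proof -
  define S where "S f j = (LINT x|torus. \<bar>lp_block \<theta> j f x\<bar> powr p)" for f j
  have blS: "bl p j f powr q = S f j powr (q / p)" for f j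
    using p by (simp add: bl_def Lpt_def S_def powr_powr)
  have S0: "0 \<le> S f j" for f j by (simp add: S_def)
  define B where "B = 2 powr p * \<bar>b\<bar> powr p" define D where "D = 2 powr p * \<bar>c\<bar> powr p"
  have S_le: "S (b *\<^sub>R f + c *\<^sub>R g) j \<le> B * S f j + D * S g j" for j
  proof -
    have i: "integrable torus (\<lambda>x. \<bar>lp_block \<theta> j f x\<bar> powr p)" for f
      using p by (intro torus_integrable continuous_on_abs_powr lp_block_cont) simp
    have "S (b *\<^sub>R f + c *\<^sub>R g) j \<le> (LINT x|torus. B * \<bar>lp_block \<theta> j f x\<bar> powr p + D * \<bar>lp_block \<theta> j g x\<bar> powr p)"
      unfolding S_def
    proof (intro Bochner_Integration.integral_mono Bochner_Integration.integrable_add integrable_mult_right i)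
      fix x
      have "\<bar>lp_block \<theta> j (b *\<^sub>R f + c *\<^sub>R g) x\<bar> powr p \<le> (\<bar>b * lp_block \<theta> j f x\<bar> + \<bar>c * lp_block \<theta> j g x\<bar>) powr p"
        unfolding lp_block_add_scale using p by (intro powr_mono2) auto
      also have "\<dots> \<le> 2 powr p * (\<bar>b * lp_block \<theta> j f x\<bar> powr p + \<bar>c * lp_block \<theta> j g x\<bar> powr p)"
        using p by (intro powr_add_le) auto
      also have "\<dots> = B * \<bar>lp_block \<theta> j f x\<bar> powr p + D * \<bar>lp_block \<theta> j g x\<bar> powr p"
        by (simp add: B_def D_def abs_mult powr_mult algebra_simps)
      finally show "\<bar>lp_block \<theta> j (b *\<^sub>R f + c *\<^sub>R g) x\<bar> powr p \<le> B * \<bar>lp_block \<theta> j f x\<bar> powr p + D * \<bar>lp_block \<theta> j g x\<bar> powr p" .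
    qed
    also have "\<dots> = B * S f j + D * S g j"
      unfolding S_def using i by simp
    finally show ?thesis .
  qed
  have "summable (\<lambda>j. S (b *\<^sub>R f + c *\<^sub>R g) j powr (q / p))"
  proof (rule summable_comparison_test')
    show "summable (\<lambda>j. 2 powr (q / p) * (B powr (q / p) * S f j powr (q / p) + D powr (q / p) * S g j powr (q / p)))"
      using f g p q by (intro summable_mult summable_add) (simp_all add: besov_0_iff blS)
    fix j
    have "S (b *\<^sub>R f + c *\<^sub>R g) j powr (q / p) \<le> (B * S f j + D * S g j) powr (q / p)"
      using p q S0 S_le by (intro powr_mono2) auto
    also have "\<dots> \<le> 2 powr (q / p) * ((B * S f j) powr (q / p) + (D * S g j) powr (q / p))"
      using p q S0 by (intro powr_add_le) (auto simp: B_def D_def)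
    finally show "norm (S (b *\<^sub>R f + c *\<^sub>R g) j powr (q / p))
       \<le> 2 powr (q / p) * (B powr (q / p) * S f j powr (q / p) + D powr (q / p) * S g j powr (q / p))"
      by (simp add: powr_mult)
  qed
  then show ?thesis using p q by (simp add: besov_0_iff blS)
qed

end

section \<open>Wavelet coefficients and finite wavelet sums\<close>

locale besov_setting = lp_setting \<theta> for \<theta> :: "real^'d::finite \<Rightarrow> real" +
  fixes N :: "real \<Rightarrow> ennreal \<Rightarrow> ennreal \<Rightarrow> 'd distribution \<Rightarrow> real"
    and \<sigma> :: real and I :: "nat \<Rightarrow> 'i set" and \<phi> :: "nat \<Rightarrow> 'i \<Rightarrow> real^'d \<Rightarrow> real" and p q :: real
  assumes norms: "besov_norms \<theta> N" and wav: "wavelet_system \<theta> \<sigma> I \<phi>"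
    and \<sigma>: "0 < \<sigma>" and p: "1 < p" "p \<le> 2" and q: "1 < q"
begin

abbreviation X :: "'d distribution set" where
  "X \<equiv> besov \<theta> 0 (ennreal p) (ennreal q)"

abbreviation cf :: "'d distribution \<Rightarrow> nat \<Rightarrow> 'i \<Rightarrow> real" where
  "cf f j l \<equiv> pairing \<theta> f (\<phi> j l)"

text \<open>The clause of \<open>wavelet_system\<close> for fixed s, p, q, awaiting its three range
  conditions.\<close>

lemmas wav_at = wav[unfolded wavelet_system_def, THEN conjunct2, THEN conjunct2, THEN spec, THEN spec, THEN spec,
    THEN mp, OF conjI[OF _ conjI]]

lemma wav_iff:
  "\<bar>s\<bar> < \<sigma> \<Longrightarrow> 1 \<le> p' \<Longrightarrow> 1 \<le> q' \<Longrightarrow> f \<in> besov \<theta> 0 1 \<infinity> \<Longrightarrow>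
    f \<in> besov \<theta> s p' q' \<longleftrightarrow> wavelet_enorm \<theta> I \<phi> s p' q' f < \<infinity>"
proof -
  assume *: "\<bar>s\<bar> < \<sigma>" "1 \<le> p'" "1 \<le> q'" "f \<in> besov \<theta> 0 1 \<infinity>"
  show ?thesis
    using wav_at[OF *(1-3), THEN conjunct1, rule_format, of 0 f] * \<sigma> by simp
qed

lemma wav_expands:
  assumes "\<bar>s\<bar> < \<sigma>" "1 \<le> p'" "1 \<le> q'" "f \<in> besov \<theta> s p' q'"
  shows "expands I \<phi> f (cf f)"
  using wav_at[OF assms(1-3), THEN conjunct2, THEN conjunct2] assms(4) by blast

lemma wav_unique:
  assumes "\<bar>s\<bar> < \<sigma>" "1 \<le> p'" "1 \<le> q'" "f \<in> besov \<theta> s p' q'"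
    and "seq_enorm TYPE('d) I s p' q' c < \<infinity>" "expands I \<phi> f c" "l \<in> I j"
  shows "cf f j l = c j l"
proof -
  have "\<forall>j. \<forall>l\<in>I j. c j l = cf f j l"
    using wav_at[OF assms(1-3), THEN conjunct2, THEN conjunct2, THEN bspec, OF assms(4), THEN conjunct2, THEN spec, THEN mp]
      assms(5,6) by blast
  then show ?thesis using assms(7) by simp
qed

lemma phi_cont: "l \<in> I j \<Longrightarrow> continuous_on S (\<phi> j l)"
proof -
  assume "l \<in> I j"
  then have "\<phi> j l \<in> C_sigma \<sigma>" using wav unfolding wavelet_system_def by blast
  then have "continuous_on UNIV (partials [] (\<phi> j l))"
    unfolding C_sigma_def C_k_def by auto
  then show ?thesis by (auto simp: partials_def intro: continuous_on_subset)
qed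

definition synth :: "(nat \<times> 'i) set \<Rightarrow> (nat \<Rightarrow> 'i \<Rightarrow> real) \<Rightarrow> 'd distribution" where
  "synth T c = distr_of (\<lambda>x. \<Sum>(j, l)\<in>T. c j l * \<phi> j l x)"

text \<open>The pairing is not computed from its series. The truncated array c' expands the sum and
  has finite B^0_{1,inf} sequence norm, so uniqueness of expansions identifies it with the
  coefficients.\<close>

lemma synth:
  assumes T: "finite T" "T \<subseteq> Sigma UNIV I"
  shows "synth T c \<in> besov \<theta> 0 1 \<infinity>"
    and "\<And>j l. l \<in> I j \<Longrightarrow> cf (synth T c) j l = (if (j, l) \<in> T then c j l else 0)"
proof -
  have cont: "continuous_on UNIV (\<lambda>x. \<Sum>(j, l)\<in>T. c j l * \<phi> j l x)"
    using T by (intro continuous_on_sum) (auto intro!: continuous_intros phi_cont)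
  show B1: "synth T c \<in> besov \<theta> 0 1 \<infinity>"
    unfolding synth_def by (rule distr_of_besov[OF cont])
  fix j l assume l: "l \<in> I j"
  define c' where "c' j l = (if (j, l) \<in> T then c j l else 0)" for j l
  have "expands I \<phi> (synth T c) c'"
    unfolding expands_def
  proof
    fix \<eta> :: "real^'d \<Rightarrow> real" assume \<eta>: "\<eta> \<in> test_functions"
    have i: "integrable torus (\<lambda>x. c (fst z) (snd z) * \<phi> (fst z) (snd z) x * \<eta> x)" if "z \<in> T" for z
      using T that by (intro torus_integrable continuous_intros phi_cont test_cont0 \<eta>) auto
    have "dapply (synth T c) \<eta> = (LINT x|torus. (\<Sum>(j, l)\<in>T. c j l * \<phi> j l x) * \<eta> x)"
      unfolding synth_def by (intro dapply_distr_of torus_integrable cont \<eta>)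
    also have "\<dots> = (LINT x|torus. (\<Sum>z\<in>T. c (fst z) (snd z) * \<phi> (fst z) (snd z) x * \<eta> x))"
      by (simp add: sum_distrib_right case_prod_beta)
    also have "\<dots> = (\<Sum>z\<in>T. c (fst z) (snd z) * L2_inner (\<phi> (fst z) (snd z)) \<eta>)"
      by (subst Bochner_Integration.integral_sum[OF i]) (simp_all add: L2_inner_def mult.assoc)
    finally have eq: "dapply (synth T c) \<eta> = (\<Sum>z\<in>T. case z of (j, l) \<Rightarrow> c' j l * L2_inner (\<phi> j l) \<eta>)"
      by (simp add: c'_def case_prod_beta)
    have "((\<lambda>(j, l). c' j l * L2_inner (\<phi> j l) \<eta>) has_sum dapply (synth T c) \<eta>) T"
      unfolding eq by (rule has_sum_finite[OF T(1)])
    then show "((\<lambda>(j, l). c' j l * L2_inner (\<phi> j l) \<eta>) has_sum dapply (synth T c) \<eta>) (Sigma UNIV I)"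
      by (rule has_sum_cong_neutral[THEN iffD1, rotated -1]) (use T in \<open>auto simp: c'_def\<close>)
  qed
  moreover have "seq_enorm TYPE('d) I 0 1 \<infinity> c' < \<infinity>"
  proof -
    define V where "V = (\<Sum>z\<in>T. \<bar>c (fst z) (snd z)\<bar>)"
    have "eLp_norm (count_space (I j)) 1 (\<lambda>l. ennreal \<bar>c' j l\<bar>) \<le> ennreal V" for j
    proof -
      define Tj where "Tj = snd ` {z \<in> T. fst z = j}"
      have Tj: "finite Tj" "Tj \<subseteq> I j" using T by (auto simp: Tj_def)
      have "(\<integral>\<^sup>+l. ennreal \<bar>c' j l\<bar> \<partial>count_space (I j)) = (\<Sum>l\<in>Tj. ennreal \<bar>c' j l\<bar>)"
        by (rule nn_integral_count_space'[OF Tj(1) _ Tj(2)]) (force simp: Tj_def c'_def)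
      also have "\<dots> = ennreal (\<Sum>l\<in>Tj. \<bar>c' j l\<bar>)" by simp
      also have "(\<Sum>l\<in>Tj. \<bar>c' j l\<bar>) = (\<Sum>z\<in>{z \<in> T. fst z = j}. \<bar>c' j (snd z)\<bar>)"
        unfolding Tj_def by (subst sum.reindex) (auto simp: inj_on_def prod_eq_iff)
      also have "\<dots> = (\<Sum>z\<in>{z \<in> T. fst z = j}. \<bar>c (fst z) (snd z)\<bar>)"
        by (intro sum.cong) (auto simp: c'_def)
      also have "\<dots> \<le> V" unfolding V_def using T by (intro sum_mono2) auto
      finally have *: "(\<integral>\<^sup>+l. ennreal \<bar>c' j l\<bar> \<partial>count_space (I j)) \<le> ennreal V"
        by (simp add: ennreal_leI)
      have "eLp_norm (count_space (I j)) 1 (\<lambda>l. ennreal \<bar>c' j l\<bar>) = (\<integral>\<^sup>+l. ennreal \<bar>c' j l\<bar> \<partial>count_space (I j))"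
        by (simp add: eLp_norm_def epowr_1)
      then show ?thesis using * by simp
    qed
    then have "ennreal (2 powr (real j * 0) * 2 powr (real j * CARD('d) * (1 / 2 - 1 / enn2real 1))) *
            eLp_norm (count_space (I j)) 1 (\<lambda>l. ennreal \<bar>c' j l\<bar>) \<le> ennreal 1 * ennreal V" for j
    proof (intro mult_mono ennreal_leI)
      have "(2::real) powr (real j * CARD('d) * (1 / 2 - 1)) \<le> 2 powr 0"
        by (intro powr_mono mult_nonneg_nonpos) auto
      then show "2 powr (real j * 0) * 2 powr (real j * CARD('d) * (1 / 2 - 1 / enn2real 1)) \<le> (1::real)" by simp
    qed auto
    then have "seq_enorm TYPE('d) I 0 1 \<infinity> c' \<le> ennreal 1 * ennreal V"
      unfolding seq_enorm_def by (intro eLp_norm_sup_least) simp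
    then show ?thesis by (auto intro: le_less_trans)
  qed
  ultimately show "cf (synth T c) j l = (if (j, l) \<in> T then c j l else 0)"
    using wav_unique[of 0 1 \<infinity> "synth T c" c' l j] B1 l \<sigma> by (simp add: c'_def)
qed

end

lemma eLp_norm_finite_set:
  assumes "finite A" "0 < p"
  shows "eLp_norm (count_space A) (ennreal p) (\<lambda>l. ennreal \<bar>x l\<bar>) = ennreal (lpn p A x)"
  using assms by (simp add: eLp_norm_def nn_integral_count_space_finite lpn_def sum_nonneg)

text \<open>In its partial-sum form a norm bound survives limits taken term by term, and it includes
  summability.\<close>

lemma suminf_powr_le_iff:
  fixes b :: "nat \<Rightarrow> real"
  assumes "0 < q" "0 \<le> C"
  shows "summable (\<lambda>j. b j powr q) \<and> (\<Sum>j. b j powr q) powr (1 / q) \<le> C \<longleftrightarrow> (\<forall>J. (\<Sum>j<J. b j powr q) \<le> C powr q)"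
proof
  assume *: "summable (\<lambda>j. b j powr q) \<and> (\<Sum>j. b j powr q) powr (1 / q) \<le> C"
  then have "((\<Sum>j. b j powr q) powr (1 / q)) powr q \<le> C powr q"
    using assms by (intro powr_mono2) auto
  then have "(\<Sum>j. b j powr q) \<le> C powr q"
    using assms * by (simp add: powr_powr suminf_nonneg)
  then show "\<forall>J. (\<Sum>j<J. b j powr q) \<le> C powr q"
    using order_trans[OF sum_le_suminf[of "\<lambda>j. b j powr q" "{..<_}"]] * by simp
next
  assume *: "\<forall>J. (\<Sum>j<J. b j powr q) \<le> C powr q"
  then have s: "summable (\<lambda>j. b j powr q)" by (intro summableI_nonneg_bounded) auto
  have "(\<Sum>j. b j powr q) \<le> C powr q" using * by (intro suminf_le_const s) auto
  then have "(\<Sum>j. b j powr q) powr (1 / q) \<le> (C powr q) powr (1 / q)"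
    using assms by (intro powr_mono2 suminf_nonneg s) auto
  then show "summable (\<lambda>j. b j powr q) \<and> (\<Sum>j. b j powr q) powr (1 / q) \<le> C"
    using s assms by (simp add: powr_powr)
qed

context besov_setting
begin

lemmas norms_at = norms[unfolded besov_norms_def, THEN spec, THEN spec, THEN spec, THEN mp, OF conjI]

text \<open>Test the norm equivalences on the sum of n wavelets of level j. Its wavelet norms are
  2^(-jd/2) n in B^0_{1,inf} and sqrt n in B^0_{2,inf}; as the first Besov norm is at most the
  second, n 2^(-jd/2) \<le> C1 C2 sqrt n. Finite subsets S are counted because finiteness of
  \<open>I j\<close> is only deduced from this bound.\<close>

lemma card_level_bound:
  obtains K where "0 < K" "\<And>j S. finite S \<Longrightarrow> S \<subseteq> I j \<Longrightarrow> real (card S) \<le> K * 2 powr (j * CARD('d))"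
proof -
  obtain C1 where C1: "0 < C1" "\<And>f. f \<in> besov \<theta> 0 1 \<infinity> \<Longrightarrow> wavelet_enorm \<theta> I \<phi> 0 1 \<infinity> f \<le> ennreal C1 * besov_enorm \<theta> 0 1 \<infinity> f"
    using wav_at[of 0 1 \<infinity>, THEN conjunct2, THEN conjunct1] \<sigma> by auto
  have two: "(1 :: ennreal) \<le> 2" using one_le_ennreal[of 2] by simp
  obtain C2 where C2: "0 < C2" "\<And>f. f \<in> besov \<theta> 0 2 \<infinity> \<Longrightarrow> besov_enorm \<theta> 0 2 \<infinity> f \<le> ennreal C2 * wavelet_enorm \<theta> I \<phi> 0 2 \<infinity> f"
    using wav_at[of 0 2 \<infinity>, THEN conjunct2, THEN conjunct1] \<sigma> two by auto
  have "real (card S) \<le> (C1 * C2)\<^sup>2 * 2 powr (j * CARD('d))" if S: "finite S" "S \<subseteq> I j" for S j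
  proof -
    define T where "T = {j} \<times> S"
    define f where "f = synth T (\<lambda>_ _. 1)"
    have T: "finite T" "T \<subseteq> Sigma UNIV I" using S by (auto simp: T_def)
    have fB: "f \<in> besov \<theta> 0 1 \<infinity>" unfolding f_def by (rule synth(1)[OF T])
    have cf: "cf f j' l = (if j' = j \<and> l \<in> S then 1 else 0)" if "l \<in> I j'" for j' l
      using synth(2)[OF T that] by (auto simp: f_def T_def)
    have en: "eLp_norm (count_space (I j')) (ennreal p') (\<lambda>l. ennreal \<bar>cf f j' l\<bar>) =
        (if j' = j then ennreal (real (card S) powr (1 / p')) else 0)" if p': "1 \<le> p'" for j' p'
    proof -
      have "(\<integral>\<^sup>+l. epowr (ennreal \<bar>cf f j' l\<bar>) p' \<partial>count_space (I j')) =
          (\<integral>\<^sup>+l. ennreal (if j' = j \<and> l \<in> S then 1 else 0) \<partial>count_space (I j'))"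
        by (intro nn_integral_cong) (auto simp: cf)
      also have "\<dots> = (\<Sum>l\<in>(if j' = j then S else {}). ennreal (if j' = j \<and> l \<in> S then 1 else 0))"
        by (rule nn_integral_count_space') (use S in auto)
      also have "\<dots> = ennreal (if j' = j then real (card S) else 0)" by (simp add: ennreal_of_nat_eq_real_of_nat)
      finally show ?thesis using p' by (simp add: eLp_norm_def)
    qed
    have w2: "wavelet_enorm \<theta> I \<phi> 0 2 \<infinity> f \<le> ennreal (sqrt (card S))"
      unfolding wavelet_enorm_def seq_enorm_def
      by (intro eLp_norm_sup_least) (use en[of 2] in \<open>auto simp: powr_half_sqrt\<close>)
    then have fB2: "f \<in> besov \<theta> 0 2 \<infinity>"
      using wav_iff[of 0 2 \<infinity> f] fB \<sigma> two by (auto intro: le_less_trans)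
    have "ennreal (2 powr (- (j * CARD('d) / 2)) * card S) = ennreal (2 powr (real j * 0) * 2 powr (j * CARD('d) * (1 / 2 - 1 / enn2real 1))) *
       eLp_norm (count_space (I j)) 1 (\<lambda>l. ennreal \<bar>cf f j l\<bar>)"
      using en[of 1 j] by (simp add: ennreal_mult)
    also have "\<dots> \<le> wavelet_enorm \<theta> I \<phi> 0 1 \<infinity> f"
      unfolding wavelet_enorm_def seq_enorm_def by (rule eLp_norm_sup_upper)
    also have "\<dots> \<le> ennreal C1 * besov_enorm \<theta> 0 1 \<infinity> f" by (rule C1(2)[OF fB])
    also have "\<dots> \<le> ennreal C1 * (ennreal C2 * wavelet_enorm \<theta> I \<phi> 0 2 \<infinity> f)"
      by (intro mult_left_mono order_trans[OF besov_B1_le_B2 C2(2)[OF fB2]]) auto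
    also have "\<dots> \<le> ennreal C1 * (ennreal C2 * ennreal (sqrt (card S)))"
      by (intro mult_left_mono w2) auto
    also have "\<dots> = ennreal (C1 * (C2 * sqrt (card S)))"
      using C1(1) C2(1) by (simp add: ennreal_mult)
    finally have *: "2 powr (- (j * CARD('d) / 2)) * card S \<le> C1 * (C2 * sqrt (card S))"
      using C1(1) C2(1) by (subst (asm) ennreal_le_iff) auto
    define x where "x = sqrt (card S)"
    define y where "y = (2::real) powr (j * CARD('d) / 2)"
    have x: "0 \<le> x" "x * x = card S" by (simp_all add: x_def)
    have y: "0 < y" "y * y = 2 powr (j * CARD('d))" by (simp_all add: y_def flip: powr_add)
    have "x * x \<le> C1 * C2 * y * x"
      using * y(1) unfolding x(2) x_def[symmetric] by (simp add: y_def powr_minus field_simps)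
    then have "x \<le> C1 * C2 * y"
      using x(1) y(1) C1(1) C2(1) by (cases "x = 0") auto
    then have "x * x \<le> (C1 * C2 * y) * (C1 * C2 * y)"
      using x(1) by (intro mult_mono) auto
    also have "\<dots> = (C1 * C2)\<^sup>2 * (y * y)" by (simp add: power2_eq_square)
    finally show ?thesis by (simp only: x y)
  qed
  moreover have "0 < (C1 * C2)\<^sup>2" using C1(1) C2(1) by simp
  ultimately show ?thesis using that by blast
qed

lemma finite_I [simp]: "finite (I j)"
proof -
  obtain K where K: "\<And>j S. finite S \<Longrightarrow> S \<subseteq> I j \<Longrightarrow> real (card S) \<le> K * 2 powr (j * CARD('d))"
    using card_level_bound by blast
  have "card S \<le> nat \<lceil>K * 2 powr (j * CARD('d))\<rceil>" if "S \<subseteq> I j" "finite S" for S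
    using K[OF that(2,1)] by linarith
  then show ?thesis by (intro conjunct1[OF finite_if_finite_subsets_card_bdd]) auto
qed

text \<open>The level-j term of \<open>seq_enorm\<close>, real-valued since the levels are
  finite.\<close>

definition slev :: "real \<Rightarrow> real \<Rightarrow> nat \<Rightarrow> (nat \<Rightarrow> 'i \<Rightarrow> real) \<Rightarrow> real" where
  "slev s p' j c = 2 powr (j * s) * 2 powr (j * CARD('d) * (1 / 2 - 1 / p')) * lpn p' (I j) (c j)"

lemma slev_nonneg [simp]: "0 \<le> slev s p' j c"
  by (simp add: slev_def lpn_nonneg)

lemma seq_enorm_eq:
  assumes "0 < p'" "0 < q'"
  shows "seq_enorm TYPE('d) I s (ennreal p') (ennreal q') c =
    (if summable (\<lambda>j. slev s p' j c powr q') then ennreal ((\<Sum>j. slev s p' j c powr q') powr (1 / q')) else \<infinity>)"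
proof -
  have "seq_enorm TYPE('d) I s (ennreal p') (ennreal q') c = eLp_norm (count_space UNIV) (ennreal q') (\<lambda>j. ennreal (slev s p' j c))"
    using assms by (simp add: seq_enorm_def eLp_norm_finite_set slev_def ennreal_mult lpn_nonneg)
  then show ?thesis using eLp_norm_seq[of q' "\<lambda>j. slev s p' j c"] assms by simp
qed

lemma slev_le_enorm:
  assumes "0 < p'"
  shows "ennreal (slev s p' j c) \<le> seq_enorm TYPE('d) I s (ennreal p') \<infinity> c"
  using eLp_norm_sup_upper[of "\<lambda>j. ennreal (slev s p' j c)" j] assms
  by (simp add: seq_enorm_def eLp_norm_finite_set slev_def ennreal_mult lpn_nonneg)

lemma N_wavelet_equiv:
  assumes s: "\<bar>s\<bar> < \<sigma>" and p': "1 \<le> p'" and q': "1 \<le> q'"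
  obtains C where "0 < C" "\<And>f. f \<in> besov \<theta> s p' q' \<Longrightarrow> N s p' q' f \<le> C * enn2real (wavelet_enorm \<theta> I \<phi> s p' q' f)"
    "\<And>f. f \<in> besov \<theta> s p' q' \<Longrightarrow> enn2real (wavelet_enorm \<theta> I \<phi> s p' q' f) \<le> C * N s p' q' f"
    "\<And>f. f \<in> besov \<theta> s p' q' \<Longrightarrow> wavelet_enorm \<theta> I \<phi> s p' q' f < \<infinity>"
proof -
  obtain C1 where C1: "0 < C1" "\<And>f. f \<in> besov \<theta> s p' q' \<Longrightarrow> N s p' q' f \<le> C1 * enn2real (besov_enorm \<theta> s p' q' f)"
    "\<And>f. f \<in> besov \<theta> s p' q' \<Longrightarrow> enn2real (besov_enorm \<theta> s p' q' f) \<le> C1 * N s p' q' f"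
    using norms_at[OF p' q', THEN conjunct2] by blast
  obtain C2 where C2: "0 < C2" "\<And>f. f \<in> besov \<theta> s p' q' \<Longrightarrow> wavelet_enorm \<theta> I \<phi> s p' q' f \<le> ennreal C2 * besov_enorm \<theta> s p' q' f"
    "\<And>f. f \<in> besov \<theta> s p' q' \<Longrightarrow> besov_enorm \<theta> s p' q' f \<le> ennreal C2 * wavelet_enorm \<theta> I \<phi> s p' q' f"
    using wav_at[OF s p' q', THEN conjunct2, THEN conjunct1] by blast
  have fin: "besov_enorm \<theta> s p' q' f < \<infinity>" "wavelet_enorm \<theta> I \<phi> s p' q' f < \<infinity>" if "f \<in> besov \<theta> s p' q'" for f
  proof -
    show b: "besov_enorm \<theta> s p' q' f < \<infinity>" using that by (simp add: besov_def)
    then have "ennreal C2 * besov_enorm \<theta> s p' q' f < \<infinity>" by (simp add: ennreal_mult_less_top)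
    then show "wavelet_enorm \<theta> I \<phi> s p' q' f < \<infinity>" using C2(2)[OF that] by (rule le_less_trans[rotated])
  qed
  have r: "enn2real (wavelet_enorm \<theta> I \<phi> s p' q' f) \<le> C2 * enn2real (besov_enorm \<theta> s p' q' f)"
    "enn2real (besov_enorm \<theta> s p' q' f) \<le> C2 * enn2real (wavelet_enorm \<theta> I \<phi> s p' q' f)" if f: "f \<in> besov \<theta> s p' q'" for f
    using enn2real_mono[OF C2(2)[OF f]] enn2real_mono[OF C2(3)[OF f]] fin[OF f] C2(1)
    by (simp_all add: enn2real_mult ennreal_mult_less_top)
  show ?thesis
  proof (rule that[of "C1 * C2"])
    fix f assume f: "f \<in> besov \<theta> s p' q'"
    show "N s p' q' f \<le> C1 * C2 * enn2real (wavelet_enorm \<theta> I \<phi> s p' q' f)"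
      using order_trans[OF C1(2)[OF f] mult_left_mono[OF r(2)[OF f], of C1]] C1(1) by (simp add: mult.assoc)
    show "enn2real (wavelet_enorm \<theta> I \<phi> s p' q' f) \<le> C1 * C2 * N s p' q' f"
      using order_trans[OF r(1)[OF f] mult_left_mono[OF C1(3)[OF f], of C2]] C2(1) by (simp add: mult_ac)
    show "wavelet_enorm \<theta> I \<phi> s p' q' f < \<infinity>" by (rule fin(2)[OF f])
  qed (use C1(1) C2(1) in simp)
qed

abbreviation lv :: "nat \<Rightarrow> 'd distribution \<Rightarrow> real" where
  "lv j f \<equiv> slev 0 p j (cf f)"

definition Wn :: "'d distribution \<Rightarrow> real" where
  "Wn f = (\<Sum>j. lv j f powr q) powr (1 / q)"

lemma Wn_nonneg: "0 \<le> Wn f"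
  by (simp add: Wn_def)

lemma p_q_le: "1 \<le> ennreal p" "1 \<le> ennreal q"
  using p q by (auto intro!: one_le_ennreal)

lemma X_B1: "f \<in> X \<Longrightarrow> f \<in> besov \<theta> 0 1 \<infinity>"
  using p q by (intro besov_sub_B1[of p q f]) auto

lemma wavelet_enorm_0:
  "wavelet_enorm \<theta> I \<phi> 0 (ennreal p) (ennreal q) f = (if summable (\<lambda>j. lv j f powr q) then ennreal (Wn f) else \<infinity>)"
  using p q by (simp add: wavelet_enorm_def seq_enorm_eq Wn_def)

lemma X_summable: "f \<in> X \<Longrightarrow> summable (\<lambda>j. lv j f powr q)"
  using wav_iff[of 0 "ennreal p" "ennreal q" f] p_q_le \<sigma> X_B1[of f] by (auto simp: wavelet_enorm_0 split: if_splits)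

lemma X_intro: "f \<in> besov \<theta> 0 1 \<infinity> \<Longrightarrow> summable (\<lambda>j. lv j f powr q) \<Longrightarrow> f \<in> X"
  using wav_iff[of 0 "ennreal p" "ennreal q" f] p_q_le \<sigma> by (auto simp: wavelet_enorm_0 split: if_splits)

lemma lv_le_Wn: "f \<in> X \<Longrightarrow> lv j f \<le> Wn f"
  unfolding Wn_def using q by (intro powr_le_suminf X_summable) auto

lemma X_lincomb: "f \<in> X \<Longrightarrow> g \<in> X \<Longrightarrow> b *\<^sub>R f + c *\<^sub>R g \<in> X"
  using p q by (intro besov_lincomb) auto

lemma X_ops:
  assumes "f \<in> X" "g \<in> X"
  shows "f + g \<in> X" "f - g \<in> X" "b *\<^sub>R f \<in> X" "0 \<in> X"
  using X_lincomb[OF assms, of 1 1] X_lincomb[OF assms, of 1 "-1"] X_lincomb[OF assms, of b 0]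
    X_lincomb[OF assms, of 0 0] by simp_all

lemma slev_lincomb:
  "slev 0 p j (\<lambda>j l. b * c j l + b' * c' j l) \<le> \<bar>b\<bar> * slev 0 p j c + \<bar>b'\<bar> * slev 0 p j c'"
proof -
  define w :: real where "w = 2 powr (j * 0) * 2 powr (j * CARD('d) * (1 / 2 - 1 / p))"
  have w: "0 \<le> w" by (simp add: w_def)
  have "lpn p (I j) (\<lambda>l. b * c j l + b' * c' j l) \<le> \<bar>b\<bar> * lpn p (I j) (c j) + \<bar>b'\<bar> * lpn p (I j) (c' j)"
    using lpn_minkowski[of p "I j" "\<lambda>l. b * c j l" "\<lambda>l. b' * c' j l"] p by (simp add: lpn_scale)
  from mult_left_mono[OF this w] show ?thesis by (simp add: slev_def w_def algebra_simps)
qed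

text \<open>\<open>pairing\<close> is a series whose convergence is not built into it, so linearity
  is not formal. The combined array has finite sequence norm and expands the combination; uniqueness
  gives the claim.\<close>

lemma cf_lincomb:
  assumes f: "f \<in> X" and g: "g \<in> X" and l: "l \<in> I j"
  shows "cf (b *\<^sub>R f + c *\<^sub>R g) j l = b * cf f j l + c * cf g j l"
proof -
  define e where "e j l = b * cf f j l + c * cf g j l" for j l
  have sm: "summable (\<lambda>j. slev 0 p j e powr q)"
  proof (rule summable_comparison_test')
    show "summable (\<lambda>j. 2 powr q * (\<bar>b\<bar> powr q * lv j f powr q + \<bar>c\<bar> powr q * lv j g powr q))"
      by (intro summable_mult summable_add X_summable f g)
    fix j
    have "slev 0 p j e powr q \<le> (\<bar>b\<bar> * lv j f + \<bar>c\<bar> * lv j g) powr q"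
      unfolding e_def using q by (intro powr_mono2 slev_lincomb) auto
    also have "\<dots> \<le> 2 powr q * ((\<bar>b\<bar> * lv j f) powr q + (\<bar>c\<bar> * lv j g) powr q)"
      using q by (intro powr_add_le) auto
    finally show "norm (slev 0 p j e powr q) \<le> 2 powr q * (\<bar>b\<bar> powr q * lv j f powr q + \<bar>c\<bar> powr q * lv j g powr q)"
      by (simp add: powr_mult)
  qed
  have ex: "expands I \<phi> (b *\<^sub>R f + c *\<^sub>R g) e"
    unfolding expands_def
  proof
    fix \<eta> :: "real^'d \<Rightarrow> real" assume \<eta>: "\<eta> \<in> test_functions"
    have h: "((\<lambda>(j, l). cf h j l * L2_inner (\<phi> j l) \<eta>) has_sum dapply h \<eta>) (Sigma UNIV I)" if "h \<in> X" for h
      using wav_expands[of 0 "ennreal p" "ennreal q" h] p_q_le \<sigma> that \<eta> by (simp add: expands_def)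
    have "((\<lambda>z. b * (case z of (j, l) \<Rightarrow> cf f j l * L2_inner (\<phi> j l) \<eta>) + c * (case z of (j, l) \<Rightarrow> cf g j l * L2_inner (\<phi> j l) \<eta>))
        has_sum b * dapply f \<eta> + c * dapply g \<eta>) (Sigma UNIV I)"
      by (intro has_sum_add has_sum_cmult_right h f g)
    moreover have "(\<lambda>z. b * (case z of (j, l) \<Rightarrow> cf f j l * L2_inner (\<phi> j l) \<eta>) + c * (case z of (j, l) \<Rightarrow> cf g j l * L2_inner (\<phi> j l) \<eta>))
       = (\<lambda>(j, l). e j l * L2_inner (\<phi> j l) \<eta>)"
      by (auto simp: e_def algebra_simps)
    ultimately show "((\<lambda>(j, l). e j l * L2_inner (\<phi> j l) \<eta>) has_sum dapply (b *\<^sub>R f + c *\<^sub>R g) \<eta>) (Sigma UNIV I)"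
      by (simp add: dapply_simps)
  qed
  show ?thesis
    using wav_unique[of 0 "ennreal p" "ennreal q" "b *\<^sub>R f + c *\<^sub>R g" e l j] p_q_le \<sigma> X_lincomb[OF f g] sm ex l p q
    by (simp add: seq_enorm_eq e_def)
qed

lemma lpn_cong: "(\<And>l. l \<in> A \<Longrightarrow> x l = y l) \<Longrightarrow> lpn p' A x = lpn p' A y"
  unfolding lpn_def by (intro arg_cong2[of _ _ _ _ "(powr)"] sum.cong) auto

lemma slev_cong: "(\<And>l. l \<in> I j \<Longrightarrow> c j l = c' j l) \<Longrightarrow> slev s p' j c = slev s p' j c'"
  unfolding slev_def using lpn_cong[of "I j" "c j" "c' j"] by simp

lemma slev_cf_lincomb:
  assumes "f \<in> X" "g \<in> X"
  shows "slev s p' j (cf (b *\<^sub>R f + c *\<^sub>R g)) = slev s p' j (\<lambda>j l. b * cf f j l + c * cf g j l)"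
  by (intro slev_cong cf_lincomb assms)

lemma slev_cf_diff:
  assumes "f \<in> X" "g \<in> X"
  shows "slev s p' j (cf (f - g)) = slev s p' j (\<lambda>j l. cf f j l - cf g j l)"
  using slev_cf_lincomb[OF assms, of s p' j 1 "-1"] by simp

lemma lv_lincomb:
  "f \<in> X \<Longrightarrow> g \<in> X \<Longrightarrow> lv j (b *\<^sub>R f + c *\<^sub>R g) \<le> \<bar>b\<bar> * lv j f + \<bar>c\<bar> * lv j g"
  by (simp add: slev_cf_lincomb slev_lincomb)

lemma N_Wn_equiv:
  obtains C where "0 < C" "\<And>f. f \<in> X \<Longrightarrow> N 0 (ennreal p) (ennreal q) f \<le> C * Wn f" "\<And>f. f \<in> X \<Longrightarrow> Wn f \<le> C * N 0 (ennreal p) (ennreal q) f"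
proof -
  have "\<bar>0\<bar> < \<sigma>" using \<sigma> by simp
  from N_wavelet_equiv[OF this p_q_le] obtain C where C: "0 < C"
    "\<And>f. f \<in> X \<Longrightarrow> N 0 (ennreal p) (ennreal q) f \<le> C * enn2real (wavelet_enorm \<theta> I \<phi> 0 (ennreal p) (ennreal q) f)"
    "\<And>f. f \<in> X \<Longrightarrow> enn2real (wavelet_enorm \<theta> I \<phi> 0 (ennreal p) (ennreal q) f) \<le> C * N 0 (ennreal p) (ennreal q) f" by metis
  then show ?thesis
    by (intro that[of C]) (auto simp: wavelet_enorm_0 X_summable Wn_nonneg)
qed

text \<open>Being a finite wavelet sum, the truncation lies in X for every f.\<close>

definition proj :: "nat \<Rightarrow> 'd distribution \<Rightarrow> 'd distribution" where
  "proj J f = synth (Sigma {..<J} I) (cf f)"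

lemma cf_proj: "l \<in> I j \<Longrightarrow> cf (proj J f) j l = (if j < J then cf f j l else 0)"
  unfolding proj_def by (subst synth(2)) auto

lemma slev_0 [simp]: "slev s p' j (\<lambda>j l. 0) = 0"
  by (simp add: slev_def lpn_def)

lemma lv_proj: "lv j (proj J f) = (if j < J then lv j f else 0)"
proof -
  have "lv j (proj J f) = slev 0 p j (if j < J then cf f else (\<lambda>j l. 0))"
    by (intro slev_cong) (simp add: cf_proj)
  then show ?thesis by simp
qed

lemma proj_X: "proj J f \<in> X"
proof (rule X_intro)
  show "proj J f \<in> besov \<theta> 0 1 \<infinity>" unfolding proj_def by (intro synth(1)) auto
  show "summable (\<lambda>j. lv j (proj J f) powr q)"
    using q by (intro summable_finite[of "{..<J}"]) (auto simp: lv_proj)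
qed

lemma lv_proj_compl: "f \<in> X \<Longrightarrow> lv j (f - proj J f) = (if j < J then 0 else lv j f)"
proof -
  assume f: "f \<in> X"
  have "lv j (f - proj J f) = slev 0 p j (if j < J then (\<lambda>j l. 0) else cf f)"
    unfolding slev_cf_diff[OF f proj_X] by (intro slev_cong) (simp add: cf_proj)
  then show ?thesis by simp
qed

text \<open>\<open>lp_complete\<close> provides the limit in the Littlewood--Paley norm, to which N
  is equivalent.\<close>

lemma X_complete:
  fixes g :: "nat \<Rightarrow> 'd distribution"
  assumes g: "\<And>n. g n \<in> X"
    and cauchy: "\<And>\<epsilon>. 0 < \<epsilon> \<Longrightarrow> \<exists>M. \<forall>m\<ge>M. \<forall>n\<ge>M. N 0 (ennreal p) (ennreal q) (g m - g n) \<le> \<epsilon>"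
  obtains G where "G \<in> X" "(\<lambda>n. N 0 (ennreal p) (ennreal q) (g n - G)) \<longlonglongrightarrow> 0"
proof -
  let ?N = "N 0 (ennreal p) (ennreal q)"
  have p0: "0 < p" "1 \<le> p" and q0: "0 < q" using p q by auto
  define Bn where "Bn f = (\<Sum>j. bl p j f powr q) powr (1 / q)" for f
  have B: "enn2real (besov_enorm \<theta> 0 (ennreal p) (ennreal q) f) = Bn f" if "f \<in> X" for f
    using that by (simp add: besov_enorm_0[OF p0(1) q0] besov_0_iff[OF p0(1) q0] Bn_def)
  obtain C where C0: "0 < C" "\<And>f. f \<in> X \<Longrightarrow> ?N f \<le> C * enn2real (besov_enorm \<theta> 0 (ennreal p) (ennreal q) f)"
    "\<And>f. f \<in> X \<Longrightarrow> enn2real (besov_enorm \<theta> 0 (ennreal p) (ennreal q) f) \<le> C * ?N f"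
    using norms_at[OF p_q_le, THEN conjunct2] by blast
  have C: "0 < C" "f \<in> X \<Longrightarrow> ?N f \<le> C * Bn f" "f \<in> X \<Longrightarrow> Bn f \<le> C * ?N f" for f
    using C0(1) C0(2,3)[of f] B[of f] by auto
  have N0: "0 \<le> ?N f" if "f \<in> X" for f
    using norms_at[OF p_q_le, THEN conjunct1] that unfolding norm_on_def by blast
  obtain G where G: "\<And>\<epsilon>. 0 < \<epsilon> \<Longrightarrow> \<exists>M. \<forall>n\<ge>M. \<forall>J. (\<Sum>j<J. bl p j (g n - G) powr q) \<le> \<epsilon> powr q"
  proof (rule lp_complete[OF p0(2) q0])
    show "bl p j (g n) \<le> Bn (g n)" for n j unfolding Bn_def by (rule bl_le[OF p0(1) q0 g])
    fix \<epsilon> :: real assume \<epsilon>: "0 < \<epsilon>"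
    then obtain M where M: "\<And>m n. m \<ge> M \<Longrightarrow> n \<ge> M \<Longrightarrow> ?N (g m - g n) \<le> \<epsilon> / C"
      using cauchy[of "\<epsilon> / C"] C(1) by auto
    have "(\<Sum>j<J. bl p j (g m - g n) powr q) \<le> \<epsilon> powr q" if "m \<ge> M" "n \<ge> M" for m n J
    proof -
      have X: "g m - g n \<in> X" by (intro X_ops g)
      have "Bn (g m - g n) \<le> C * (\<epsilon> / C)"
        using C(1) by (intro order_trans[OF C(3)[OF X] mult_left_mono[OF M[OF that]]]) auto
      then have "Bn (g m - g n) \<le> \<epsilon>" using C(1) by simp
      then show ?thesis
        using suminf_powr_le_iff[OF q0, of \<epsilon> "\<lambda>j. bl p j (g m - g n)"] X \<epsilon>
        by (auto simp: Bn_def besov_0_iff[OF p0(1) q0])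
    qed
    then show "\<exists>M. \<forall>m\<ge>M. \<forall>n\<ge>M. \<forall>J. (\<Sum>j<J. bl p j (g m - g n) powr q) \<le> \<epsilon> powr q" by blast
  qed blast
  have ev: "\<exists>M. \<forall>n\<ge>M. g n - G \<in> X \<and> ?N (g n - G) \<le> C * \<epsilon>" if \<epsilon>: "0 < \<epsilon>" for \<epsilon>
  proof -
    obtain M where M: "\<And>n J. n \<ge> M \<Longrightarrow> (\<Sum>j<J. bl p j (g n - G) powr q) \<le> \<epsilon> powr q" using G[OF \<epsilon>] by blast
    have "g n - G \<in> X \<and> ?N (g n - G) \<le> C * \<epsilon>" if "n \<ge> M" for n
    proof -
      have *: "summable (\<lambda>j. bl p j (g n - G) powr q) \<and> Bn (g n - G) \<le> \<epsilon>"
        using suminf_powr_le_iff[OF q0, of \<epsilon> "\<lambda>j. bl p j (g n - G)"] M[OF that] \<epsilon> by (simp add: Bn_def)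
      then have X: "g n - G \<in> X" by (simp add: besov_0_iff[OF p0(1) q0])
      moreover have "C * Bn (g n - G) \<le> C * \<epsilon>" using * C(1) by (intro mult_left_mono) auto
      ultimately show ?thesis using C(2)[OF X] by linarith
    qed
    then show ?thesis by blast
  qed
  obtain M1 where "g M1 - G \<in> X" using ev[of 1] by auto
  from X_ops(2)[OF g[of M1] this] have GX: "G \<in> X" by simp
  have "(\<lambda>n. ?N (g n - G)) \<longlonglongrightarrow> 0"
  proof (rule LIMSEQ_I)
    fix e :: real assume e: "0 < e"
    then obtain M where M: "\<And>n. n \<ge> M \<Longrightarrow> ?N (g n - G) \<le> C * (e / (2 * C))"
      using ev[of "e / (2 * C)"] C(1) by auto
    have "norm (?N (g n - G) - 0) < e" if "n \<ge> M" for n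
      using M[OF that] N0[OF X_ops(2)[OF g GX], of n] C(1) e by simp
    then show "\<exists>no. \<forall>n\<ge>no. norm (?N (g n - G) - 0) < e" by blast
  qed
  with GX show ?thesis using that by blast
qed

end

section \<open>The penalty and the source condition\<close>

lemma norm_onD:
  assumes "norm_on V n" "f \<in> V"
  shows "0 \<le> n f" and "n f = 0 \<Longrightarrow> f = 0" and "n (b *\<^sub>R f) = \<bar>b\<bar> * n f" and "g \<in> V \<Longrightarrow> n (f + g) \<le> n f + n g"
  using assms by (auto simp: norm_on_def)

locale tik_setting = besov_setting \<theta> N \<sigma> I \<phi> p q
  for \<theta> :: "real^'d::finite \<Rightarrow> real" and N \<sigma> and I :: "nat \<Rightarrow> 'i set" and \<phi> p q +
  fixes a s r :: real
  assumes a: "0 < a" "a < \<sigma>" "real CARD('d) / p - real CARD('d) / 2 < a"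
    and s: "0 < s" "s < \<sigma>" "s < a / (q - 1)" and r: "r = max 2 q"
begin

lemma r_ge: "2 \<le> r" "q \<le> r" "0 < r" "1 < r"
  using r by auto

abbreviation R :: "'d distribution \<Rightarrow> real" where
  "R \<equiv> penalty \<theta> I \<phi> p q r"

abbreviation Nx :: "'d distribution \<Rightarrow> real" where
  "Nx \<equiv> N 0 (ennreal p) (ennreal q)"

abbreviation Nm :: "'d distribution \<Rightarrow> real" where
  "Nm \<equiv> N (- a) 2 2"

lemma R_eq: "f \<in> X \<Longrightarrow> R f = 1 / r * Wn f powr r"
  by (simp add: penalty_def wavelet_enorm_0 X_summable Wn_nonneg)

lemma Wn_powr_r: "Wn f powr r = (\<Sum>j. lv j f powr q) powr (r / q)"
  by (simp add: Wn_def powr_powr)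

text \<open>The constant of \<open>lpn_two_convex\<close> carried through
  \<open>uniformly_convex_series\<close>, divided by r because of the factor 1/r in the
  penalty.\<close>

definition \<kappa> :: real where
  "\<kappa> = conv_const q (p * (p - 1) / 16) / r"

lemma \<kappa>_pos: "0 < \<kappa>"
  using conv_const_pos[of q "p * (p - 1) / 16"] p q r_ge by (simp add: \<kappa>_def)

text \<open>The weight w of a level factors out of all four norms, so \<open>lpn_two_convex\<close>
  supplies the quadratic hypothesis of \<open>uniformly_convex_series\<close>.\<close>

lemma R_uniformly_convex:
  assumes f: "f \<in> X" and g: "g \<in> X"
  shows "R ((1 / 2) *\<^sub>R f + (1 / 2) *\<^sub>R g) + \<kappa> * Wn (f - g) powr r \<le> (R f + R g) / 2"
proof -
  let ?h = "(1 / 2) *\<^sub>R f + (1 / 2) *\<^sub>R g"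
  have h: "?h \<in> X" by (intro X_lincomb f g)
  have d: "f - g \<in> X" by (intro X_ops f g)
  have "(\<Sum>j. lv j ?h powr q) powr (r / q) + conv_const q (p * (p - 1) / 16) * (\<Sum>j. lv j (f - g) powr q) powr (r / q)
    \<le> ((\<Sum>j. lv j f powr q) powr (r / q) + (\<Sum>j. lv j g powr q) powr (r / q)) / 2"
  proof (rule uniformly_convex_series[OF q r])
    show "0 < p * (p - 1) / 16" using p by simp
    fix j
    show "lv j ?h \<le> (lv j f + lv j g) / 2"
      using lv_lincomb[OF f g, of j "1/2" "1/2"] by simp
    show "lv j (f - g) \<le> lv j f + lv j g"
      using lv_lincomb[OF f g, of j 1 "-1"] by simp
    define w :: real where "w = 2 powr (j * 0) * 2 powr (j * CARD('d) * (1 / 2 - 1 / p))"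
    have lw: "slev 0 p j c = w * lpn p (I j) (c j)" for c by (simp add: slev_def w_def)
    have "w\<^sup>2 * ((lpn p (I j) (\<lambda>l. (cf f j l + cf g j l) / 2))\<^sup>2 + p * (p - 1) / 16 * (lpn p (I j) (\<lambda>l. cf f j l - cf g j l))\<^sup>2)
        \<le> w\<^sup>2 * (((lpn p (I j) (cf f j))\<^sup>2 + (lpn p (I j) (cf g j))\<^sup>2) / 2)"
      by (intro mult_left_mono lpn_two_convex p) auto
    then show "(lv j ?h)\<^sup>2 + p * (p - 1) / 16 * (lv j (f - g))\<^sup>2 \<le> ((lv j f)\<^sup>2 + (lv j g)\<^sup>2) / 2"
      unfolding slev_cf_lincomb[OF f g] slev_cf_diff[OF f g] lw
      by (simp add: power_mult_distrib algebra_simps add_divide_distrib)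
  qed (auto simp: X_summable f g)
  then have "1 / r * (Wn ?h powr r + conv_const q (p * (p - 1) / 16) * Wn (f - g) powr r)
      \<le> 1 / r * ((Wn f powr r + Wn g powr r) / 2)"
    unfolding Wn_powr_r using r_ge by (intro mult_left_mono) auto
  also have "\<dots> = (R f + R g) / 2" by (simp add: R_eq f g add_divide_distrib)
  finally show ?thesis by (simp add: R_eq h \<kappa>_def add_divide_distrib)
qed

section \<open>Subgradients and the Bregman distance\<close>

lemma subgradD:
  assumes "u \<in> subdifferential X Nx R f"
  shows "g \<in> X \<Longrightarrow> h \<in> X \<Longrightarrow> u (b *\<^sub>R g + c *\<^sub>R h) = b * u g + c * u h"
    and "g \<in> X \<Longrightarrow> R f + u (g - f) \<le> R g"
  using assms unfolding subdifferential_def by auto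

lemma subgrad_ops:
  assumes u: "u \<in> subdifferential X Nx R f" and g: "g \<in> X" and h: "h \<in> X"
  shows "u (g + h) = u g + u h" "u (- g) = - u g" "u (b *\<^sub>R g) = b * u g"
  using subgradD(1)[OF u g h, of 1 1] subgradD(1)[OF u g h, of "-1" 0] subgradD(1)[OF u g h, of b 0] by simp_all

text \<open>By the subgradient inequality R at the midpoint is at least R g + u(f - g)/2; inserting
  this in \<open>R_uniformly_convex\<close> and doubling yields the factor 2.\<close>

lemma bregman_lower:
  assumes u: "u \<in> subdifferential X Nx R g" and f: "f \<in> X" and g: "g \<in> X"
  shows "2 * \<kappa> * Wn (f - g) powr r \<le> bregman R u f g"
proof -
  let ?h = "(1 / 2) *\<^sub>R f + (1 / 2) *\<^sub>R g"
  have "?h - g = (1 / 2) *\<^sub>R (f - g)" by (simp add: algebra_simps flip: scaleR_add_left)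
  then have "u (?h - g) = 1 / 2 * u (f - g)"
    using subgrad_ops(3)[OF u X_ops(2)[OF f g] g] by simp
  moreover have "R g + u (?h - g) \<le> R ?h" by (intro subgradD(2)[OF u] X_lincomb f g)
  ultimately show ?thesis
    using R_uniformly_convex[OF f g] by (simp add: bregman_def)
qed

text \<open>A subgradient lies below the difference quotients for t > 0, and subadditivity of the
  level norms puts these below the quotients of \<open>directional_derivative_bound\<close>.\<close>

lemma subgradient_bound:
  assumes u: "u \<in> subdifferential X Nx R f" and f: "f \<in> X" and g: "g \<in> X"
  shows "u g \<le> 2 powr (q - 1) * ((\<Sum>j. lv j f powr q) powr ((r - q) / q) * (\<Sum>j. lv j f powr (q - 1) * lv j g))"
proof (rule directional_derivative_bound[where u = "\<lambda>j. lv j f" and v = "\<lambda>j. lv j g", OF q r_ge(2)])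
  fix t :: real assume t: "0 < t" "t \<le> 1"
  have X: "f + t *\<^sub>R g \<in> X" using X_lincomb[OF f g, of 1 t] by simp
  have "R f + t * u g \<le> R (f + t *\<^sub>R g)"
    using subgradD(2)[OF u X] subgrad_ops(3)[OF u g g] by simp
  also have "\<dots> = 1 / r * (\<Sum>j. lv j (f + t *\<^sub>R g) powr q) powr (r / q)"
    by (simp add: R_eq[OF X] Wn_powr_r)
  also have "\<dots> \<le> 1 / r * (\<Sum>j. (lv j f + t * lv j g) powr q) powr (r / q)"
  proof -
    have sm: "summable (\<lambda>j. (lv j f + t * lv j g) powr q)"
      by (rule suminf_powr_shift_le(2)[OF q]) (use t in \<open>auto simp: X_summable f g\<close>)
    have "lv j (f + t *\<^sub>R g) powr q \<le> (lv j f + t * lv j g) powr q" for j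
      using lv_lincomb[OF f g, of j 1 t] t q by (intro powr_mono2) auto
    then have "(\<Sum>j. lv j (f + t *\<^sub>R g) powr q) \<le> (\<Sum>j. (lv j f + t * lv j g) powr q)"
      by (intro suminf_le X_summable X sm)
    then show ?thesis
      using r_ge q by (intro mult_left_mono powr_mono2 suminf_nonneg X_summable X) auto
  qed
  finally show "1 / r * (\<Sum>j. lv j f powr q) powr (r / q) + t * u g \<le> 1 / r * (\<Sum>j. (lv j f + t * lv j g) powr q) powr (r / q)"
    by (simp add: R_eq[OF f] Wn_powr_r)
qed (auto simp: X_summable f g)

text \<open>Decay per level of the embedding of B^0_{p,q} into B^{-a}_{2,2}.\<close>

definition \<epsilon>0 :: real where "\<epsilon>0 = a - CARD('d) * (1 / p - 1 / 2)"

lemma \<epsilon>0_pos: "0 < \<epsilon>0"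
  using a(3) by (simp add: \<epsilon>0_def algebra_simps)

lemma slev_neg_le: "slev (- a) 2 j c \<le> 2 powr (- (j * \<epsilon>0)) * slev 0 p j c"
proof -
  have "slev (- a) 2 j c = 2 powr (- (j * a)) * lpn 2 (I j) (c j)" by (simp add: slev_def)
  also have "\<dots> \<le> 2 powr (- (j * a)) * lpn p (I j) (c j)"
    using p by (intro mult_left_mono lpn_2_le) auto
  also have "- (j * a) = - (j * \<epsilon>0) + j * CARD('d) * (1 / 2 - 1 / p)"
    by (simp add: \<epsilon>0_def algebra_simps)
  also have "2 powr \<dots> * lpn p (I j) (c j) = 2 powr (- (j * \<epsilon>0)) * slev 0 p j c"
    unfolding powr_add by (simp add: slev_def)
  finally show ?thesis .
qed

text \<open>Hoelder on a level costs the cardinality to the power 1/p - 1/2, which the level weight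
  compensates up to a constant by \<open>card_level_bound\<close>; only 2^(ja) remains.\<close>

lemma slev_le_neg:
  obtains K where "0 < K" "\<And>j c. slev 0 p j c \<le> K * 2 powr (j * a) * slev (- a) 2 j c"
proof -
  obtain K where K: "0 < K" "\<And>j S. finite S \<Longrightarrow> S \<subseteq> I j \<Longrightarrow> real (card S) \<le> K * 2 powr (j * CARD('d))"
    using card_level_bound by blast
  have "slev 0 p j c \<le> K powr (1 / p - 1 / 2) * 2 powr (j * a) * slev (- a) 2 j c" for j c
  proof -
    define e where "e = 1 / p - 1 / 2"
    have e: "0 \<le> e" using p by (simp add: e_def field_simps)
    have "lpn p (I j) (c j) \<le> real (card (I j)) powr e * lpn 2 (I j) (c j)"
      unfolding e_def using p by (intro lpn_le_2) auto
    also have "\<dots> \<le> (K * 2 powr (j * CARD('d))) powr e * lpn 2 (I j) (c j)"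
      using e K(2)[of "I j" j] by (intro mult_right_mono powr_mono2 lpn_nonneg) auto
    also have "\<dots> = K powr e * 2 powr (j * CARD('d) * e) * lpn 2 (I j) (c j)"
      by (simp add: powr_mult powr_powr)
    finally have "2 powr (j * CARD('d) * (- e)) * lpn p (I j) (c j)
        \<le> 2 powr (j * CARD('d) * (- e)) * (K powr e * 2 powr (j * CARD('d) * e) * lpn 2 (I j) (c j))"
      by (rule mult_left_mono) simp
    also have "\<dots> = K powr e * (2 powr (j * CARD('d) * (- e)) * 2 powr (j * CARD('d) * e)) * lpn 2 (I j) (c j)"
      by (simp only: mult_ac)
    also have "2 powr (j * CARD('d) * (- e)) * 2 powr (j * CARD('d) * e) = (1 :: real)"
      unfolding powr_add[symmetric] by simp
    also have "K powr e * 1 * lpn 2 (I j) (c j) = K powr e * 2 powr (j * a) * slev (- a) 2 j c"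
      by (simp add: slev_def powr_minus)
    finally show ?thesis by (simp add: slev_def e_def)
  qed
  then show ?thesis using that[of "K powr (1 / p - 1 / 2)"] K(1) by simp
qed

text \<open>Squared weak norm, taken of coefficient arrays: \<open>Nm_compact\<close> applies it to
  differences with a limit array that is not known to come from a distribution.\<close>

definition Wm2 :: "(nat \<Rightarrow> 'i \<Rightarrow> real) \<Rightarrow> real" where
  "Wm2 c = (\<Sum>j. slev (- a) 2 j c powr 2)"

lemma neg_powr_summable: "0 < b \<Longrightarrow> summable (\<lambda>j. (2::real) powr (- (real j * b)))"
proof -
  assume b: "0 < b"
  have "(2::real) powr (- (real j * b)) = (2 powr (- b)) ^ j" for j
    by (simp add: powr_powr mult.commute flip: powr_realpow)
  moreover have "(2::real) powr (- b) < 2 powr 0" using b by (intro powr_less_mono) auto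
  ultimately show ?thesis by (simp add: summable_geometric)
qed

lemma slev_neg_square_le:
  assumes "slev 0 p j c \<le> B"
  shows "slev (- a) 2 j c powr 2 \<le> B powr 2 * 2 powr (- (j * (2 * \<epsilon>0)))"
proof -
  have "slev (- a) 2 j c \<le> 2 powr (- (j * \<epsilon>0)) * B"
    by (rule order_trans[OF slev_neg_le]) (use assms in simp)
  then have "slev (- a) 2 j c powr 2 \<le> (2 powr (- (j * \<epsilon>0)) * B) powr 2"
    by (intro powr_mono2) auto
  also have "\<dots> = (2 powr (- (j * \<epsilon>0))) powr 2 * B powr 2" by (rule powr_mult)
  also have "(2 powr (- (j * \<epsilon>0))) powr 2 = (2::real) powr (- (j * (2 * \<epsilon>0)))"
    by (simp only: powr_powr) (simp add: mult_ac)
  finally show ?thesis by (simp only: mult.commute)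
qed

lemma slev_neg_summable:
  assumes "\<And>j. slev 0 p j c \<le> B"
  shows "summable (\<lambda>j. slev (- a) 2 j c powr 2)"
proof (rule summable_comparison_test')
  show "summable (\<lambda>j. B powr 2 * 2 powr (- (real j * (2 * \<epsilon>0))))"
    using \<epsilon>0_pos by (intro summable_mult neg_powr_summable) simp
  show "norm (slev (- a) 2 j c powr 2) \<le> B powr 2 * 2 powr (- (real j * (2 * \<epsilon>0)))" for j
    using slev_neg_square_le[OF assms] by simp
qed

lemma wavelet_enorm_neg:
  assumes "f \<in> X"
  shows "wavelet_enorm \<theta> I \<phi> (- a) 2 2 f = ennreal (Wm2 (cf f) powr (1 / 2))"
  using seq_enorm_eq[of 2 2 "- a" "cf f"] slev_neg_summable[OF lv_le_Wn[OF assms]]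
  by (simp add: wavelet_enorm_def Wm2_def)

lemma one_le_2: "(1 :: ennreal) \<le> 2"
  using one_le_ennreal[of 2] by simp

lemma X_neg: "f \<in> X \<Longrightarrow> f \<in> besov \<theta> (- a) 2 2"
  using wav_iff[of "- a" 2 2 f] a X_B1[of f] one_le_2 by (simp add: wavelet_enorm_neg)

lemma Nm_equiv:
  obtains C where "0 < C" "\<And>f. f \<in> X \<Longrightarrow> Nm f \<le> C * Wm2 (cf f) powr (1 / 2)" "\<And>f. f \<in> X \<Longrightarrow> Wm2 (cf f) powr (1 / 2) \<le> C * Nm f"
proof -
  have "\<bar>- a\<bar> < \<sigma>" using a by simp
  from N_wavelet_equiv[OF this one_le_2 one_le_2] obtain C where C: "0 < C"
    "\<And>f. f \<in> besov \<theta> (- a) 2 2 \<Longrightarrow> Nm f \<le> C * enn2real (wavelet_enorm \<theta> I \<phi> (- a) 2 2 f)"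
    "\<And>f. f \<in> besov \<theta> (- a) 2 2 \<Longrightarrow> enn2real (wavelet_enorm \<theta> I \<phi> (- a) 2 2 f) \<le> C * Nm f" by metis
  show ?thesis
    using C(1) C(2)[OF X_neg] C(3)[OF X_neg] by (intro that[of C]) (simp_all add: wavelet_enorm_neg)
qed

lemmas norm_on_Nx = norms_at[OF p_q_le, THEN conjunct1]
lemmas norm_on_Nm = norms_at[OF one_le_2 one_le_2, THEN conjunct1]

lemma Nx_ge_0: "f \<in> X \<Longrightarrow> 0 \<le> Nx f" and Nx_eq_0: "f \<in> X \<Longrightarrow> Nx f = 0 \<Longrightarrow> f = 0"
  by (rule norm_onD(1)[OF norm_on_Nx], assumption) (rule norm_onD(2)[OF norm_on_Nx])

lemma Nm_ge_0: "f \<in> X \<Longrightarrow> 0 \<le> Nm f"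
  by (rule norm_onD(1)[OF norm_on_Nm X_neg])

lemma Nm_eq_0: "f \<in> X \<Longrightarrow> Nm f = 0 \<Longrightarrow> f = 0"
  by (rule norm_onD(2)[OF norm_on_Nm X_neg])

lemma Nm_scale: "f \<in> X \<Longrightarrow> Nm (b *\<^sub>R f) = \<bar>b\<bar> * Nm f"
  by (rule norm_onD(3)[OF norm_on_Nm X_neg])

lemma Nm_add: "f \<in> X \<Longrightarrow> g \<in> X \<Longrightarrow> Nm (f + g) \<le> Nm f + Nm g"
  by (rule norm_onD(4)[OF norm_on_Nm X_neg X_neg])

lemma Nm_uminus: "f \<in> X \<Longrightarrow> Nm (- f) = Nm f"
  using Nm_scale[of f "-1"] by simp

text \<open>All levels are bounded by the norm, and the gap \<open>\<epsilon>0\<close> makes the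
  squares of the weak levels summable whatever q is.\<close>

lemma Nm_le_Nx:
  obtains C where "0 < C" "\<And>f. f \<in> X \<Longrightarrow> Nm f \<le> C * Nx f"
proof -
  obtain C1 where C1: "0 < C1" "\<And>f. f \<in> X \<Longrightarrow> Nm f \<le> C1 * Wm2 (cf f) powr (1 / 2)" using Nm_equiv by metis
  obtain C2 where C2: "0 < C2" "\<And>f. f \<in> X \<Longrightarrow> Wn f \<le> C2 * Nx f" using N_Wn_equiv by metis
  define G where "G = (\<Sum>j. (2::real) powr (- (real j * (2 * \<epsilon>0))))"
  have sG: "summable (\<lambda>j. (2::real) powr (- (real j * (2 * \<epsilon>0))))"
    using \<epsilon>0_pos by (intro neg_powr_summable) simp
  have G: "0 < G" unfolding G_def by (intro suminf_pos sG) simp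
  have "Nm f \<le> C1 * G powr (1 / 2) * C2 * Nx f" if f: "f \<in> X" for f
  proof -
    have "Wm2 (cf f) \<le> (\<Sum>j. Wn f powr 2 * 2 powr (- (real j * (2 * \<epsilon>0))))"
      unfolding Wm2_def
      by (intro suminf_le slev_neg_square_le lv_le_Wn f slev_neg_summable[OF lv_le_Wn] summable_mult sG)
    also have "\<dots> = Wn f powr 2 * G" unfolding G_def by (intro suminf_mult sG)
    finally have le: "Wm2 (cf f) \<le> Wn f powr 2 * G" .
    have "0 \<le> Wm2 (cf f)"
      unfolding Wm2_def by (intro suminf_nonneg slev_neg_summable[OF lv_le_Wn[OF f]] powr_ge_zero)
    then have "Wm2 (cf f) powr (1 / 2) \<le> (Wn f powr 2 * G) powr (1 / 2)"
      by (intro powr_mono2 le) auto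
    also have "\<dots> = (Wn f powr 2) powr (1 / 2) * G powr (1 / 2)" by (rule powr_mult)
    also have "(Wn f powr 2) powr (1 / 2) = Wn f" by (simp only: powr_powr) (simp add: Wn_nonneg)
    also have "Wn f * G powr (1 / 2) \<le> C2 * Nx f * G powr (1 / 2)"
      using C2(2)[OF f] by (intro mult_right_mono) auto
    finally have "C1 * Wm2 (cf f) powr (1 / 2) \<le> C1 * (C2 * Nx f * G powr (1 / 2))"
      using C1(1) by (intro mult_left_mono) auto
    then show ?thesis using C1(2)[OF f] by (simp add: mult_ac)
  qed
  moreover have "0 < C1 * G powr (1 / 2) * C2" using C1(1) C2(1) G by simp
  ultimately show ?thesis using that by blast
qed

end

section \<open>Smoothness of the solution and the variational source condition\<close>

context tik_setting
begin

text \<open>Chosen so that \<gamma>(r-1) = s(q-1) in both cases. All exponents then read r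
  a/(a+\<gamma>) and r\<gamma>/(a+\<gamma>), see \<open>psi_fun_eq\<close>.\<close>

definition \<gamma> :: real where "\<gamma> = (if 2 \<le> q then s else s * (q - 1))"

lemma \<gamma>: "0 < \<gamma>" "\<gamma> * (r - 1) = s * (q - 1)" "s * (q - 1) < a"
proof -
  show "0 < \<gamma>" using s q by (simp add: \<gamma>_def)
  show "\<gamma> * (r - 1) = s * (q - 1)" using r by (auto simp: \<gamma>_def)
  show "s * (q - 1) < a" using s(3) q by (simp add: pos_less_divide_eq)
qed

lemma lv_smooth_bound:
  obtains C where "0 < C" "\<And>f j. f \<in> besov \<theta> s (ennreal p) \<infinity> \<Longrightarrow> lv j f \<le> C * N s (ennreal p) \<infinity> f * 2 powr (- (j * s))"
proof -
  have s': "\<bar>s\<bar> < \<sigma>" "(1 :: ennreal) \<le> \<infinity>" using s by auto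
  obtain C where C: "0 < C"
    "\<And>f. f \<in> besov \<theta> s (ennreal p) \<infinity> \<Longrightarrow> enn2real (wavelet_enorm \<theta> I \<phi> s (ennreal p) \<infinity> f) \<le> C * N s (ennreal p) \<infinity> f"
    "\<And>f. f \<in> besov \<theta> s (ennreal p) \<infinity> \<Longrightarrow> wavelet_enorm \<theta> I \<phi> s (ennreal p) \<infinity> f < \<infinity>"
    using N_wavelet_equiv[OF s'(1) p_q_le(1) s'(2)] by metis
  have "lv j f \<le> C * N s (ennreal p) \<infinity> f * 2 powr (- (j * s))" if f: "f \<in> besov \<theta> s (ennreal p) \<infinity>" for f j
  proof -
    have "ennreal (slev s p j (cf f)) \<le> wavelet_enorm \<theta> I \<phi> s (ennreal p) \<infinity> f"
      unfolding wavelet_enorm_def using p by (intro slev_le_enorm) simp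
    then have "slev s p j (cf f) \<le> enn2real (wavelet_enorm \<theta> I \<phi> s (ennreal p) \<infinity> f)"
      using enn2real_mono[of "ennreal (slev s p j (cf f))"] C(3)[OF f] by simp
    then have "slev s p j (cf f) \<le> C * N s (ennreal p) \<infinity> f" using C(2)[OF f] by linarith
    moreover have "lv j f = slev s p j (cf f) * 2 powr (- (j * s))"
      by (simp add: slev_def powr_minus)
    ultimately show ?thesis by (simp add: mult_right_mono)
  qed
  then show ?thesis using that C(1) by blast
qed

lemma weighted_summable:
  assumes "g \<in> X"
  shows "summable (\<lambda>j. 2 powr (- (j * (s * (q - 1)))) * lv j g)"
proof (rule summable_comparison_test')
  show "summable (\<lambda>j. 2 powr (- (real j * (s * (q - 1)))) * Wn g)"
    using s q by (intro summable_mult2 neg_powr_summable) simp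
  show "norm (2 powr (- (j * (s * (q - 1)))) * lv j g) \<le> 2 powr (- (real j * (s * (q - 1)))) * Wn g" for j
    using lv_le_Wn[OF assms, of j] by (simp add: mult_left_mono)
qed

text \<open>The levels of f are at most M 2^(-js) with M = C\<rho>. In
  \<open>subgradient_bound\<close> the power of the sum contributes M^(r-q) and the weights M^(q-1)
  2^(-js(q-1)), together degree r - 1 in \<rho>.\<close>

lemma subgradient_bound_smooth:
  obtains K where "0 < K" "\<And>f u \<rho> g. f \<in> X \<Longrightarrow> f \<in> besov \<theta> s (ennreal p) \<infinity> \<Longrightarrow> N s (ennreal p) \<infinity> f \<le> \<rho> \<Longrightarrow> 0 < \<rho> \<Longrightarrow>
    u \<in> subdifferential X Nx R f \<Longrightarrow> g \<in> X \<Longrightarrow>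
    u g \<le> K * (\<rho> powr (r - 1) * (\<Sum>j. 2 powr (- (j * (s * (q - 1)))) * lv j g))"
proof -
  obtain C where C: "0 < C" "\<And>f j. f \<in> besov \<theta> s (ennreal p) \<infinity> \<Longrightarrow> lv j f \<le> C * N s (ennreal p) \<infinity> f * 2 powr (- (j * s))"
    using lv_smooth_bound by metis
  define G where "G = (\<Sum>j. (2::real) powr (- (real j * (s * q))))"
  have sG: "summable (\<lambda>j. (2::real) powr (- (real j * (s * q))))"
    using s q by (intro neg_powr_summable) simp
  have G: "0 < G" unfolding G_def by (intro suminf_pos sG) simp
  define e where "e = (r - q) / q"
  have e: "0 \<le> e" using r_ge q by (simp add: e_def)
  define K where "K = 2 powr (q - 1) * G powr e * C powr (r - 1)"
  have K: "0 < K" using G C(1) by (simp add: K_def)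
  have "u g \<le> K * (\<rho> powr (r - 1) * (\<Sum>j. 2 powr (- (j * (s * (q - 1)))) * lv j g))"
    if f: "f \<in> X" "f \<in> besov \<theta> s (ennreal p) \<infinity>" and \<rho>: "N s (ennreal p) \<infinity> f \<le> \<rho>" "0 < \<rho>"
      and u: "u \<in> subdifferential X Nx R f" and g: "g \<in> X" for f u \<rho> g
  proof -
    define M where "M = C * \<rho>"
    have M: "0 < M" using C(1) \<rho> by (simp add: M_def)
    have lvM: "lv j f \<le> M * 2 powr (- (j * s))" for j
    proof -
      have "C * N s (ennreal p) \<infinity> f * 2 powr (- (j * s)) \<le> C * \<rho> * 2 powr (- (j * s))"
        using C(1) \<rho> by (intro mult_right_mono mult_left_mono) auto
      then show ?thesis using C(2)[OF f(2), of j] by (simp add: M_def)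
    qed
    have lvMp: "lv j f powr b \<le> M powr b * 2 powr (- (j * (s * b)))" if "0 \<le> b" for j b
    proof -
      have "lv j f powr b \<le> (M * 2 powr (- (j * s))) powr b"
        using that by (intro powr_mono2 lvM) auto
      also have "\<dots> = M powr b * 2 powr (- (j * (s * b)))"
        unfolding powr_mult powr_powr by (simp add: mult.assoc)
      finally show ?thesis .
    qed
    have "(\<Sum>j. lv j f powr q) \<le> (\<Sum>j. M powr q * 2 powr (- (real j * (s * q))))"
      using q by (intro suminf_le lvMp X_summable f summable_mult sG) auto
    also have "\<dots> = M powr q * G" unfolding G_def by (intro suminf_mult sG)
    finally have "(\<Sum>j. lv j f powr q) powr e \<le> (M powr q * G) powr e"
      using e by (intro powr_mono2 suminf_nonneg X_summable f) auto
    also have "\<dots> = M powr (r - q) * G powr e"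
      unfolding powr_mult powr_powr using q by (simp add: e_def)
    finally have 1: "(\<Sum>j. lv j f powr q) powr e \<le> M powr (r - q) * G powr e" .
    have "(\<Sum>j. lv j f powr (q - 1) * lv j g) \<le> (\<Sum>j. M powr (q - 1) * (2 powr (- (j * (s * (q - 1)))) * lv j g))"
    proof (intro suminf_le summable_mult weighted_summable g)
      show "summable (\<lambda>j. lv j f powr (q - 1) * lv j g)"
        by (rule suminf_powr_shift_le(1)[OF q, of _ _ 0]) (auto simp: X_summable f g)
      show "lv j f powr (q - 1) * lv j g \<le> M powr (q - 1) * (2 powr (- (j * (s * (q - 1)))) * lv j g)" for j
        using mult_right_mono[OF lvMp[of "q - 1" j] slev_nonneg[of 0 p j "cf g"]] q by (simp add: mult.assoc)
    qed
    also have "\<dots> = M powr (q - 1) * (\<Sum>j. 2 powr (- (j * (s * (q - 1)))) * lv j g)"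
      by (intro suminf_mult weighted_summable g)
    finally have 2: "(\<Sum>j. lv j f powr (q - 1) * lv j g) \<le> M powr (q - 1) * (\<Sum>j. 2 powr (- (j * (s * (q - 1)))) * lv j g)" .
    have S0: "0 \<le> (\<Sum>j. 2 powr (- (j * (s * (q - 1)))) * lv j g)"
      by (intro suminf_nonneg weighted_summable g) simp
    have "u g \<le> 2 powr (q - 1) * ((\<Sum>j. lv j f powr q) powr e * (\<Sum>j. lv j f powr (q - 1) * lv j g))"
      unfolding e_def by (rule subgradient_bound[OF u f(1) g])
    also have "\<dots> \<le> 2 powr (q - 1) * ((M powr (r - q) * G powr e) * (M powr (q - 1) * (\<Sum>j. 2 powr (- (j * (s * (q - 1)))) * lv j g)))"
    proof (intro mult_left_mono mult_mono 1 2)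
      show "0 \<le> (\<Sum>j. lv j f powr (q - 1) * lv j g)"
        by (intro suminf_nonneg suminf_powr_shift_le(1)[OF q, of _ _ 0]) (auto simp: X_summable f g)
    qed auto
    also have "\<dots> = 2 powr (q - 1) * G powr e * (M powr (r - q) * M powr (q - 1)) * (\<Sum>j. 2 powr (- (j * (s * (q - 1)))) * lv j g)"
      by (simp only: mult_ac)
    also have "M powr (r - q) * M powr (q - 1) = C powr (r - 1) * \<rho> powr (r - 1)"
      unfolding powr_add[symmetric] powr_mult[symmetric] by (simp add: M_def)
    finally show ?thesis by (simp only: K_def mult_ac)
  qed
  with K show ?thesis using that by blast
qed

text \<open>The part of \<open>h\<close> on the levels below \<open>J\<close> is controlled by the weak norm, the rest by the decay
  of the levels of \<open>f\<close>.\<close>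

lemma subgradient_split:
  obtains K where "0 < K" "\<And>f u \<rho> h E. f \<in> X \<Longrightarrow> f \<in> besov \<theta> s (ennreal p) \<infinity> \<Longrightarrow> N s (ennreal p) \<infinity> f \<le> \<rho> \<Longrightarrow> 0 < \<rho> \<Longrightarrow>
    u \<in> subdifferential X Nx R f \<Longrightarrow> h \<in> X \<Longrightarrow> Nm h \<le> E \<Longrightarrow>
    u h \<le> K * (\<rho> powr (r - 1) * Wn h) \<and>
    (\<forall>J::nat. u h \<le> K * (\<rho> powr (r - 1) * (2 powr (J * (a - s * (q - 1))) * E + 2 powr (- real J * (s * (q - 1))) * Wn h)))"
proof -
  define \<beta> where "\<beta> = s * (q - 1)"
  have \<beta>: "0 < \<beta>" "\<beta> < a" using s q \<gamma>(3) by (auto simp: \<beta>_def)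
  obtain K1 where K1: "0 < K1" "\<And>f u \<rho> g. f \<in> X \<Longrightarrow> f \<in> besov \<theta> s (ennreal p) \<infinity> \<Longrightarrow> N s (ennreal p) \<infinity> f \<le> \<rho> \<Longrightarrow> 0 < \<rho> \<Longrightarrow>
    u \<in> subdifferential X Nx R f \<Longrightarrow> g \<in> X \<Longrightarrow>
    u g \<le> K1 * (\<rho> powr (r - 1) * (\<Sum>j. 2 powr (- (j * \<beta>)) * lv j g))"
    using subgradient_bound_smooth unfolding \<beta>_def by blast
  obtain K2 where K2: "0 < K2" "\<And>j c. slev 0 p j c \<le> K2 * 2 powr (j * a) * slev (- a) 2 j c"
    using slev_le_neg by blast
  obtain K3 where K3: "0 < K3" "\<And>f. f \<in> X \<Longrightarrow> Wm2 (cf f) powr (1 / 2) \<le> K3 * Nm f"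
    using Nm_equiv by metis
  define G where "G = (\<Sum>j. (2::real) powr (- (real j * \<beta>)))"
  have sG: "summable (\<lambda>j. (2::real) powr (- (real j * \<beta>)))"
    using \<beta> by (intro neg_powr_summable)
  have G: "0 < G" unfolding G_def by (intro suminf_pos sG) simp
  \<comment> \<open>Constant of the geometric sum over the low levels; its ratio 2^(a-\<beta>)
    exceeds 1 because s < a/(q-1).\<close>
  define H where "H = 1 / (2 powr (a - \<beta>) - 1)"
  have b1: "1 < (2::real) powr (a - \<beta>)" using \<beta> by simp
  have H: "0 < H" using b1 by (simp add: H_def)
  define K where "K = K1 * G + K1 * (K2 * K3 * H)"
  have K: "0 < K" "K1 * G \<le> K" "K1 * (K2 * K3 * H) \<le> K"
    using K1(1) K2(1) K3(1) G H by (auto simp: K_def intro!: add_pos_pos)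
  have "u h \<le> K * (\<rho> powr (r - 1) * Wn h) \<and>
      (\<forall>J::nat. u h \<le> K * (\<rho> powr (r - 1) * (2 powr (J * (a - \<beta>)) * E + 2 powr (- real J * \<beta>) * Wn h)))"
    if f: "f \<in> X" "f \<in> besov \<theta> s (ennreal p) \<infinity>" and \<rho>: "N s (ennreal p) \<infinity> f \<le> \<rho>" "0 < \<rho>"
      and u: "u \<in> subdifferential X Nx R f" and h: "h \<in> X" and E: "Nm h \<le> E" for f u \<rho> h E
  proof
    have E0: "0 \<le> E" using Nm_ge_0[OF h] E by linarith
    have ug: "u g \<le> K1 * (\<rho> powr (r - 1) * B)" if "g \<in> X" "(\<Sum>j. 2 powr (- (j * \<beta>)) * lv j g) \<le> B" for g B
      by (rule order_trans[OF K1(2)[OF f \<rho> u that(1)]]) (use K1(1) that(2) in \<open>intro mult_left_mono; simp\<close>)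
    have sm: "summable (\<lambda>j. 2 powr (- (j * \<beta>)) * lv j g)" if "g \<in> X" for g
      using weighted_summable[OF that] by (simp add: \<beta>_def)
    have "(\<Sum>j. 2 powr (- (j * \<beta>)) * lv j h) \<le> (\<Sum>j. 2 powr (- (real j * \<beta>)) * Wn h)"
      by (intro suminf_le sm h summable_mult2 sG mult_left_mono lv_le_Wn) auto
    also have "\<dots> = G * Wn h" unfolding G_def using suminf_mult2[OF sG, of "Wn h"] by simp
    finally have "u h \<le> K1 * (\<rho> powr (r - 1) * (G * Wn h))" by (rule ug[OF h])
    also have "\<dots> = (K1 * G) * (\<rho> powr (r - 1) * Wn h)" by (simp only: mult_ac)
    also have "\<dots> \<le> K * (\<rho> powr (r - 1) * Wn h)" using K Wn_nonneg by (intro mult_right_mono) auto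
    finally show "u h \<le> K * (\<rho> powr (r - 1) * Wn h)" .
    show "\<forall>J::nat. u h \<le> K * (\<rho> powr (r - 1) * (2 powr (J * (a - \<beta>)) * E + 2 powr (- real J * \<beta>) * Wn h))"
    proof
      fix J :: nat
      have hP: "h - proj J h \<in> X" by (intro X_ops h proj_X)
      have "(\<Sum>j. 2 powr (- (j * \<beta>)) * lv j (proj J h)) = (\<Sum>j<J. 2 powr (- (j * \<beta>)) * lv j h)"
        by (subst suminf_finite[of "{..<J}"]) (auto simp: lv_proj)
      also have "\<dots> \<le> (\<Sum>j<J. (2 powr (a - \<beta>)) ^ j * (K2 * K3 * E))"
      proof (rule sum_mono)
        fix j
        \<comment> \<open>One level of the weak norm is bounded by the whole;
          \<open>slev_le_neg\<close> converts it back at the price 2^(ja).\<close>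
        have "slev (- a) 2 j (cf h) \<le> Wm2 (cf h) powr (1 / 2)"
          unfolding Wm2_def by (intro powr_le_suminf slev_neg_summable[OF lv_le_Wn[OF h]]) auto
        also have "\<dots> \<le> K3 * E" using K3 E by (intro order_trans[OF K3(2)[OF h]] mult_left_mono) auto
        finally have "K2 * 2 powr (j * a) * slev (- a) 2 j (cf h) \<le> K2 * 2 powr (j * a) * (K3 * E)"
          using K2(1) by (intro mult_left_mono) auto
        then have "2 powr (- (j * \<beta>)) * lv j h \<le> 2 powr (- (j * \<beta>)) * (K2 * 2 powr (j * a) * (K3 * E))"
          using K2(2)[of j "cf h"] by (intro mult_left_mono) auto
        also have "\<dots> = (2 powr (- (j * \<beta>)) * 2 powr (j * a)) * (K2 * K3 * E)" by (simp only: mult_ac)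
        also have "2 powr (- (j * \<beta>)) * 2 powr (j * a) = (2 powr (a - \<beta>)) powr real j"
          unfolding powr_add[symmetric] powr_powr by (simp add: algebra_simps)
        also have "\<dots> = (2 powr (a - \<beta>)) ^ j" by (simp add: powr_realpow)
        finally show "2 powr (- (j * \<beta>)) * lv j h \<le> (2 powr (a - \<beta>)) ^ j * (K2 * K3 * E)" .
      qed
      also have "\<dots> = ((2 powr (a - \<beta>)) ^ J - 1) * H * (K2 * K3 * E)"
      proof -
        have "(\<Sum>j<J. (2 powr (a - \<beta>)) ^ j) = ((2 powr (a - \<beta>)) ^ J - 1) * H"
          unfolding geometric_sum[OF less_imp_neq[OF b1, symmetric]] by (simp add: H_def)
        then show ?thesis by (simp only: sum_distrib_right[symmetric])
      qed
      also have "\<dots> \<le> (2 powr (a - \<beta>)) ^ J * H * (K2 * K3 * E)"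
        using H K2(1) K3(1) E0 by (intro mult_right_mono) auto
      also have "(2 powr (a - \<beta>)) ^ J = (2::real) powr (J * (a - \<beta>))"
        by (simp add: powr_powr mult.commute flip: powr_realpow)
      finally have 1: "u (proj J h) \<le> K1 * (\<rho> powr (r - 1) * (2 powr (J * (a - \<beta>)) * H * (K2 * K3 * E)))"
        by (rule ug[OF proj_X])
      \<comment> \<open>The levels below J vanish, so the sum starts at J and the factor
        2^(-J\<beta>) splits off.\<close>
      have "(\<Sum>j. 2 powr (- (j * \<beta>)) * lv j (h - proj J h)) = (\<Sum>j. 2 powr (- ((j + J) * \<beta>)) * lv (j + J) (h - proj J h))"
        by (subst suminf_split_initial_segment[OF sm[OF hP], of J]) (simp add: lv_proj_compl[OF h])
      also have "\<dots> \<le> (\<Sum>j. 2 powr (- (real j * \<beta>)) * (2 powr (- real J * \<beta>) * Wn h))"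
      proof (intro suminf_le summable_mult2 sG)
        show "summable (\<lambda>j. 2 powr (- ((j + J) * \<beta>)) * lv (j + J) (h - proj J h))"
          using summable_ignore_initial_segment[OF sm[OF hP], of J] by simp
        fix j
        have "2 powr (- ((j + J) * \<beta>)) = (2::real) powr (- (real j * \<beta>)) * 2 powr (- real J * \<beta>)"
          unfolding powr_add[symmetric] by (simp add: algebra_simps)
        then show "2 powr (- ((j + J) * \<beta>)) * lv (j + J) (h - proj J h) \<le> 2 powr (- (real j * \<beta>)) * (2 powr (- real J * \<beta>) * Wn h)"
          using lv_le_Wn[OF h, of "j + J"] by (simp add: lv_proj_compl[OF h] mult_left_mono)
      qed
      also have "\<dots> = G * (2 powr (- real J * \<beta>) * Wn h)"
        unfolding G_def using suminf_mult2[OF sG] by simp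
      finally have 2: "u (h - proj J h) \<le> K1 * (\<rho> powr (r - 1) * (G * (2 powr (- real J * \<beta>) * Wn h)))"
        by (rule ug[OF hP])
      have "u h = u (proj J h) + u (h - proj J h)"
        using subgrad_ops(1)[OF u proj_X hP, of J h] by simp
      also have "\<dots> \<le> K1 * (\<rho> powr (r - 1) * (2 powr (J * (a - \<beta>)) * H * (K2 * K3 * E))) + K1 * (\<rho> powr (r - 1) * (G * (2 powr (- real J * \<beta>) * Wn h)))"
        by (intro add_mono 1 2)
      also have "\<dots> = (K1 * (K2 * K3 * H)) * (\<rho> powr (r - 1) * (2 powr (J * (a - \<beta>)) * E)) + (K1 * G) * (\<rho> powr (r - 1) * (2 powr (- real J * \<beta>) * Wn h))"
        by (simp only: mult_ac)
      also have "\<dots> \<le> K * (\<rho> powr (r - 1) * (2 powr (J * (a - \<beta>)) * E)) + K * (\<rho> powr (r - 1) * (2 powr (- real J * \<beta>) * Wn h))"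
        using K E0 Wn_nonneg by (intro add_mono mult_right_mono) auto
      finally show "u h \<le> K * (\<rho> powr (r - 1) * (2 powr (J * (a - \<beta>)) * E + 2 powr (- real J * \<beta>) * Wn h))"
        by (simp add: distrib_left)
    qed
  qed
  then show ?thesis using that[OF K(1)] unfolding \<beta>_def by blast
qed

text \<open>The Young parameter in \<open>balance_cutoff\<close> is \<kappa>, so that its term
  \<kappa> Wn^r is at most half the Bregman distance by \<open>bregman_lower\<close>. E stands for
  the L^2 distance of the images, and L enters the constant through the weak bound L E.\<close>

lemma variational_source_condition:
  assumes L: "0 < L"
  obtains c where "0 < c" "\<And>f_dag u \<rho> f E. f_dag \<in> X \<Longrightarrow> f_dag \<in> besov \<theta> s (ennreal p) \<infinity> \<Longrightarrow> N s (ennreal p) \<infinity> f_dag \<le> \<rho> \<Longrightarrow>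
    u \<in> subdifferential X Nx R f_dag \<Longrightarrow> f \<in> X \<Longrightarrow> 0 \<le> E \<Longrightarrow> Nm (f_dag - f) \<le> L * E \<Longrightarrow>
    u (f_dag - f) \<le> 1 / 2 * bregman R u f f_dag + c * \<rho> powr (r * a / (a + \<gamma>)) * E powr (r * \<gamma> / (a + \<gamma>))"
proof -
  obtain K where K: "0 < K" "\<And>f u \<rho> h E. f \<in> X \<Longrightarrow> f \<in> besov \<theta> s (ennreal p) \<infinity> \<Longrightarrow> N s (ennreal p) \<infinity> f \<le> \<rho> \<Longrightarrow> 0 < \<rho> \<Longrightarrow>
    u \<in> subdifferential X Nx R f \<Longrightarrow> h \<in> X \<Longrightarrow> Nm h \<le> E \<Longrightarrow>
    u h \<le> K * (\<rho> powr (r - 1) * Wn h) \<and>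
    (\<forall>J::nat. u h \<le> K * (\<rho> powr (r - 1) * (2 powr (J * (a - s * (q - 1))) * E + 2 powr (- real J * (s * (q - 1))) * Wn h)))"
    using subgradient_split by blast
  obtain C where C: "0 < C" "\<And>f j. f \<in> besov \<theta> s (ennreal p) \<infinity> \<Longrightarrow> lv j f \<le> C * N s (ennreal p) \<infinity> f * 2 powr (- (j * s))"
    using lv_smooth_bound by metis
  have \<gamma>': "\<gamma> * (r - 1) < a" using \<gamma> by simp
  obtain c where c: "0 < c" "\<And>\<rho> e n x. 0 < \<rho> \<Longrightarrow> 0 < e \<Longrightarrow> 0 \<le> n \<Longrightarrow> x \<le> K * (\<rho> powr (r - 1) * n) \<Longrightarrow>
    (\<And>J. x \<le> K * (\<rho> powr (r - 1) * (2 powr (real J * (a - \<gamma> * (r - 1))) * e + 2 powr (- real J * (\<gamma> * (r - 1))) * n))) \<Longrightarrow>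
    x \<le> \<kappa> * n powr r + c * \<rho> powr (r * a / (a + \<gamma>)) * e powr (r * \<gamma> / (a + \<gamma>))"
    using balance_cutoff[OF r_ge(4) \<gamma>(1) \<gamma>' K(1) \<kappa>_pos] by blast
  define c' where "c' = c * L powr (r * \<gamma> / (a + \<gamma>))"
  have "u (f_dag - f) \<le> 1 / 2 * bregman R u f f_dag + c' * \<rho> powr (r * a / (a + \<gamma>)) * E powr (r * \<gamma> / (a + \<gamma>))"
    if fd: "f_dag \<in> X" "f_dag \<in> besov \<theta> s (ennreal p) \<infinity>" and \<rho>: "N s (ennreal p) \<infinity> f_dag \<le> \<rho>"
      and u: "u \<in> subdifferential X Nx R f_dag" and f: "f \<in> X" and E: "0 \<le> E" "Nm (f_dag - f) \<le> L * E"
    for f_dag u \<rho> f E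
  proof -
    have h: "f_dag - f \<in> X" by (intro X_ops fd f)
    have W: "Wn (f_dag - f) = Wn (f - f_dag)"
      using lv_lincomb[OF fd(1) f, of _ 1 "-1"]
    proof -
      have "lv j (f_dag - f) = lv j (f - f_dag)" for j
        using lv_lincomb[OF h h, of j "-1" 0] lv_lincomb[OF X_ops(2)[OF f fd(1)] h, of j "-1" 0] by simp
      then show ?thesis by (simp add: Wn_def)
    qed
    have br: "\<kappa> * Wn (f_dag - f) powr r \<le> 1 / 2 * bregman R u f f_dag"
      using bregman_lower[OF u f fd(1)] by (simp add: W)
    have br0: "0 \<le> 1 / 2 * bregman R u f f_dag"
      by (rule order_trans[OF _ br]) (use \<kappa>_pos in simp)
    have N0: "0 \<le> N s (ennreal p) \<infinity> f_dag"
      using norms_at[OF p_q_le(1), of \<infinity>] fd(2) unfolding norm_on_def by auto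
    have ps0: "0 \<le> c' * \<rho> powr (r * a / (a + \<gamma>)) * E powr (r * \<gamma> / (a + \<gamma>))" using c(1) by (simp add: c'_def)
    \<comment> \<open>\<open>balance_cutoff\<close> needs positive \<rho> and e. For \<rho> = 0 all
      levels of f_dag vanish, and with them the subgradient bound; for E = 0 the two points
      coincide.\<close>
    consider "\<rho> = 0" | "E = 0" | "0 < \<rho>" "0 < E" using N0 \<rho> E by linarith
    then show ?thesis
    proof cases
      case 1
      then have "N s (ennreal p) \<infinity> f_dag = 0" using N0 \<rho> by linarith
      then have "lv j f_dag \<le> 0" for j using C(2)[OF fd(2), of j] by simp
      then have "lv j f_dag = 0" for j using slev_nonneg[of 0 p j "cf f_dag"] by (simp add: order_antisym)
      then have "u (f_dag - f) \<le> 0" using subgradient_bound[OF u fd(1) h] by simp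
      then show ?thesis using br0 ps0 by linarith
    next
      case 2
      then have "Nm (f_dag - f) = 0" using E(2) Nm_ge_0[OF h] by simp
      then have "f_dag - f = 0" by (rule Nm_eq_0[OF h])
      moreover have "u 0 = 0" using subgrad_ops(3)[OF u fd(1) fd(1), of 0] by simp
      ultimately show ?thesis using br0 ps0 by simp
    next
      case 3
      have "u (f_dag - f) \<le> \<kappa> * Wn (f_dag - f) powr r + c * \<rho> powr (r * a / (a + \<gamma>)) * (L * E) powr (r * \<gamma> / (a + \<gamma>))"
        using K(2)[OF fd \<rho> 3(1) u h E(2)] 3 L Wn_nonneg unfolding \<gamma>(2)[symmetric] by (intro c(2)) auto
      also have "c * \<rho> powr (r * a / (a + \<gamma>)) * (L * E) powr (r * \<gamma> / (a + \<gamma>)) = c' * \<rho> powr (r * a / (a + \<gamma>)) * E powr (r * \<gamma> / (a + \<gamma>))"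
        by (simp add: c'_def powr_mult mult_ac)
      finally show ?thesis using br by linarith
    qed
  qed
  moreover have "0 < c'" using c(1) L by (simp add: c'_def)
  ultimately show ?thesis using that by blast
qed

text \<open>Coefficients converge along a diagonal subsequence, and Tannery's theorem exchanges the
  limit with the sum over levels: the squared weak level norms have the summable majorant (2B)^2
  2^(-2j\<open>\<epsilon>0\<close>).\<close>

lemma Nm_compact:
  fixes f :: "nat \<Rightarrow> 'd distribution"
  assumes f: "\<And>n. f n \<in> X" and B: "\<And>n. Wn (f n) \<le> B"
  obtains k :: "nat \<Rightarrow> nat" where "strict_mono k" "\<forall>\<epsilon>>0. \<exists>M. \<forall>m\<ge>M. \<forall>n\<ge>M. Nm (f (k m) - f (k n)) \<le> \<epsilon>"
proof -
  have lvB: "lv j (f n) \<le> B" for j n by (rule order_trans[OF lv_le_Wn[OF f] B])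
  have B0: "0 \<le> B" using Wn_nonneg B order_trans by blast
  \<comment> \<open>The diagonal argument wants one bound for all indices; the factor 2^(-ja)
    provides it and is removed in \<open>cv\<close>.\<close>
  have cfB: "\<bar>2 powr (- (j * a)) * cf (f n) j l\<bar> \<le> B" if l: "l \<in> I j" for j l n
  proof -
    have "\<bar>cf (f n) j l\<bar> = (\<bar>cf (f n) j l\<bar> powr 2) powr (1 / 2)" by (simp only: powr_powr) simp
    also have "\<dots> \<le> lpn 2 (I j) (cf (f n) j)"
      unfolding lpn_def using l by (intro powr_mono2 member_le_sum) auto
    finally have "2 powr (- (j * a)) * \<bar>cf (f n) j l\<bar> \<le> slev (- a) 2 j (cf (f n))"
      by (simp add: slev_def)
    also have "\<dots> \<le> 2 powr (- (j * \<epsilon>0)) * B" by (rule order_trans[OF slev_neg_le]) (simp add: lvB)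
    also have "\<dots> \<le> 1 * B"
    proof (intro mult_right_mono B0)
      show "2 powr (- (j * \<epsilon>0)) \<le> (1::real)" using powr_mono[of "- (j * \<epsilon>0)" 0 "2::real"] \<epsilon>0_pos by simp
    qed
    finally show ?thesis by (simp add: abs_mult)
  qed
  have cnt: "countable (Sigma UNIV I)" by (intro countable_SIGMA) (auto intro: countable_finite)
  obtain k where k: "strict_mono k" "\<And>z. z \<in> Sigma UNIV I \<Longrightarrow>
      \<exists>c. (\<lambda>n. 2 powr (- (real (fst z) * a)) * cf (f (k n)) (fst z) (snd z)) \<longlonglongrightarrow> c"
  proof (rule function_convergent_subsequence[OF cnt, of "\<lambda>n z. 2 powr (- (real (fst z) * a)) * cf (f n) (fst z) (snd z)" B])
    show "norm (2 powr (- (real (fst z) * a)) * cf (f n) (fst z) (snd z)) \<le> B" if "z \<in> Sigma UNIV I" for n z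
      using cfB that by auto
  qed blast
  have cv: "\<exists>c. (\<lambda>n. cf (f (k n)) j l) \<longlonglongrightarrow> c" if l: "l \<in> I j" for j l
  proof -
    obtain c where "(\<lambda>n. 2 powr (- (real j * a)) * cf (f (k n)) j l) \<longlonglongrightarrow> c" using k(2)[of "(j, l)"] l by auto
    then have "(\<lambda>n. 2 powr (real j * a) * (2 powr (- (real j * a)) * cf (f (k n)) j l)) \<longlonglongrightarrow> 2 powr (real j * a) * c"
      by (intro tendsto_mult tendsto_const)
    moreover have "2 powr (real j * a) * (2 powr (- (real j * a)) * z) = z" for z by (simp add: powr_minus)
    ultimately show ?thesis by auto
  qed
  define c where "c j l = lim (\<lambda>n. cf (f (k n)) j l)" for j l
  have c: "(\<lambda>n. cf (f (k n)) j l) \<longlonglongrightarrow> c j l" if "l \<in> I j" for j l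
    using cv[OF that] by (auto simp: c_def limI)
  define D where "D n j l = cf (f (k n)) j l - c j l" for n j l
  have D0: "(\<lambda>n. lpn p' (I j) (D n j)) \<longlonglongrightarrow> 0" if p': "0 < p'" for p' j
  proof -
    have "(\<lambda>n. (\<Sum>l\<in>I j. \<bar>D n j l\<bar> powr p') powr (1 / p')) \<longlonglongrightarrow> (\<Sum>l\<in>I j. \<bar>0\<bar> powr p') powr (1 / p')"
      unfolding D_def using p'
      by (intro tendsto_powr' tendsto_sum tendsto_rabs tendsto_const LIM_zero c) (auto intro!: always_eventually sum_nonneg)
    then show ?thesis using p' by (simp add: lpn_def)
  qed
  have sl0: "(\<lambda>n. slev s' p' j (D n)) \<longlonglongrightarrow> 0" if p': "0 < p'" for s' p' j
    unfolding slev_def using tendsto_mult[OF tendsto_const D0[OF p']] by simp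
  \<comment> \<open>Triangle inequality through \<open>f (k m)\<close>, then m tends to
    infinity.\<close>
  have DB: "slev 0 p j (D n) \<le> 2 * B" for j n
  proof (rule LIMSEQ_le)
    have le: "slev 0 p j (D n) \<le> 1 * slev 0 p j (D m) + 2 * B" for m
    proof -
      have "slev 0 p j (D n) = slev 0 p j (\<lambda>j l. 1 * D m j l + (-1) * (cf (f (k m)) j l - cf (f (k n)) j l))"
        by (rule arg_cong[where f = "slev 0 p j"]) (simp add: D_def fun_eq_iff)
      also have "\<dots> \<le> \<bar>1\<bar> * slev 0 p j (D m) + \<bar>-1\<bar> * slev 0 p j (\<lambda>j l. cf (f (k m)) j l - cf (f (k n)) j l)"
        by (rule slev_lincomb)
      also have "slev 0 p j (\<lambda>j l. cf (f (k m)) j l - cf (f (k n)) j l) \<le> lv j (f (k m)) + lv j (f (k n))"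
        using slev_lincomb[of j 1 "cf (f (k m))" "-1" "cf (f (k n))"] by simp
      finally show ?thesis using lvB[of j "k m"] lvB[of j "k n"] by simp
    qed
    show "(\<lambda>m. slev 0 p j (D n)) \<longlonglongrightarrow> slev 0 p j (D n)" by (rule tendsto_const)
    show "(\<lambda>m. 1 * slev 0 p j (D m) + 2 * B) \<longlonglongrightarrow> 2 * B"
      using tendsto_add[OF sl0[of p 0 j] tendsto_const[of "2 * B"]] p by simp
    show "\<exists>N. \<forall>m\<ge>N. slev 0 p j (D n) \<le> 1 * slev 0 p j (D m) + 2 * B" using le by blast
  qed
  have smD: "summable (\<lambda>j. slev (- a) 2 j (D n) powr 2)" for n by (rule slev_neg_summable[OF DB])
  have W0: "(\<lambda>n. Wm2 (D n)) \<longlonglongrightarrow> (\<Sum>j. 0)"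
    unfolding Wm2_def
  proof (rule tannerys_theorem[THEN conjunct2, THEN conjunct2])
    show "((\<lambda>n. slev (- a) 2 j (D n) powr 2) \<longlongrightarrow> 0) sequentially" for j
    proof -
      have "((\<lambda>n. slev (- a) 2 j (D n) powr 2) \<longlongrightarrow> 0 powr 2) sequentially"
        by (intro tendsto_powr' tendsto_const sl0) auto
      then show ?thesis by simp
    qed
    show "\<forall>\<^sub>F (j, n) in at_top \<times>\<^sub>F sequentially. norm (slev (- a) 2 j (D n) powr 2) \<le> (2 * B) powr 2 * 2 powr (- (real j * (2 * \<epsilon>0)))"
      using slev_neg_square_le[OF DB] by (intro always_eventually) auto
    show "summable (\<lambda>j. (2 * B) powr 2 * 2 powr (- (real j * (2 * \<epsilon>0))))"
      using \<epsilon>0_pos by (intro summable_mult neg_powr_summable) simp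
  qed auto
  obtain C where C: "0 < C" "\<And>f. f \<in> X \<Longrightarrow> Nm f \<le> C * Wm2 (cf f) powr (1 / 2)" using Nm_equiv by metis
  have cau: "\<exists>M. \<forall>m\<ge>M. \<forall>n\<ge>M. Nm (f (k m) - f (k n)) \<le> \<epsilon>" if \<epsilon>: "0 < \<epsilon>" for \<epsilon>
  proof -
    \<comment> \<open>So that 4\<eta> = (\<epsilon>/C)^2, where 4\<eta> bounds 2 Wm2 (D m) + 2 Wm2
      (D n).\<close>
    define \<eta> where "\<eta> = (\<epsilon> / C)\<^sup>2 / 4"
    have \<eta>: "0 < \<eta>" using \<epsilon> C(1) by (simp add: \<eta>_def)
    have "\<forall>\<^sub>F n in sequentially. Wm2 (D n) < \<eta>" using order_tendstoD(2)[OF W0, of \<eta>] \<eta> by simp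
    then obtain M where M: "\<And>n. n \<ge> M \<Longrightarrow> Wm2 (D n) < \<eta>" by (auto simp: eventually_sequentially)
    have "Nm (f (k m) - f (k n)) \<le> \<epsilon>" if mn: "m \<ge> M" "n \<ge> M" for m n
    proof -
      have X: "f (k m) - f (k n) \<in> X" by (intro X_ops f)
      have sl: "slev (- a) 2 j (cf (f (k m) - f (k n))) powr 2 \<le> 2 * slev (- a) 2 j (D m) powr 2 + 2 * slev (- a) 2 j (D n) powr 2" for j
      proof -
        define w :: real where "w = 2 powr (- (j * a))"
        have lw: "slev (- a) 2 j c = w * lpn 2 (I j) (c j)" for c by (simp add: slev_def w_def)
        have w: "0 \<le> w" by (simp add: w_def)
        have "lpn 2 (I j) (\<lambda>l. D m j l + (-1) * D n j l) \<le> lpn 2 (I j) (D m j) + lpn 2 (I j) (\<lambda>l. (-1) * D n j l)"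
          by (rule lpn_minkowski) auto
        also have "lpn 2 (I j) (\<lambda>l. (-1) * D n j l) = lpn 2 (I j) (D n j)" by (subst lpn_scale) auto
        finally have le: "lpn 2 (I j) (\<lambda>l. D m j l + (-1) * D n j l) \<le> lpn 2 (I j) (D m j) + lpn 2 (I j) (D n j)" .
        have eqD: "(\<lambda>l. cf (f (k m)) j l - cf (f (k n)) j l) = (\<lambda>l. D m j l + (-1) * D n j l)"
          by (simp add: D_def)
        have "slev (- a) 2 j (cf (f (k m) - f (k n))) \<le> slev (- a) 2 j (D m) + slev (- a) 2 j (D n)"
          unfolding slev_cf_diff[OF f f] lw eqD distrib_left[symmetric] by (rule mult_left_mono[OF le w])
        then have "(slev (- a) 2 j (cf (f (k m) - f (k n))))\<^sup>2 \<le> (slev (- a) 2 j (D m) + slev (- a) 2 j (D n))\<^sup>2"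
          by (intro power_mono) auto
        also have "\<dots> \<le> 2 * (slev (- a) 2 j (D m))\<^sup>2 + 2 * (slev (- a) 2 j (D n))\<^sup>2"
          using sum_squares_bound[of "slev (- a) 2 j (D m)" "slev (- a) 2 j (D n)"] by (simp add: power2_sum)
        finally show ?thesis by simp
      qed
      have "Wm2 (cf (f (k m) - f (k n))) \<le> (\<Sum>j. 2 * slev (- a) 2 j (D m) powr 2 + 2 * slev (- a) 2 j (D n) powr 2)"
        unfolding Wm2_def by (intro suminf_le sl slev_neg_summable[OF lv_le_Wn[OF X]] summable_add summable_mult smD)
      also have "\<dots> = 2 * Wm2 (D m) + 2 * Wm2 (D n)"
        unfolding Wm2_def by (simp only: suminf_add[OF summable_mult[OF smD] summable_mult[OF smD], symmetric] suminf_mult[OF smD])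
      also have "\<dots> \<le> 4 * \<eta>" using M[OF mn(1)] M[OF mn(2)] by linarith
      finally have "Wm2 (cf (f (k m) - f (k n))) powr (1 / 2) \<le> (4 * \<eta>) powr (1 / 2)"
        by (intro powr_mono2) (simp_all add: Wm2_def suminf_nonneg slev_neg_summable[OF lv_le_Wn[OF X]] del: powr_numeral)
      also have "\<dots> = \<epsilon> / C" using \<epsilon> C(1) by (simp add: \<eta>_def powr_half_sqrt)
      finally have "C * Wm2 (cf (f (k m) - f (k n))) powr (1 / 2) \<le> C * (\<epsilon> / C)"
        using C(1) by (intro mult_left_mono) auto
      then show ?thesis using C(2)[OF X] C(1) by simp
    qed
    then show ?thesis by blast
  qed
  then show ?thesis by (intro that[OF k(1)]) blast
qed

end

section \<open>Tikhonov regularization\<close>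

lemma L2_integrable_mult:
  assumes "u \<in> L2" "v \<in> L2"
  shows "integrable torus (\<lambda>x. u x * v x)"
proof (rule Bochner_Integration.integrable_bound)
  show "integrable torus (\<lambda>x. (u x)\<^sup>2 + (v x)\<^sup>2)"
    using assms by (intro Bochner_Integration.integrable_add) (auto simp: L2_def)
  show "(\<lambda>x. u x * v x) \<in> borel_measurable torus"
    using assms by (intro borel_measurable_times) (auto simp: L2_def)
  have "\<bar>y * z\<bar> \<le> y\<^sup>2 + z\<^sup>2" for y z :: real
    using sum_squares_bound[of "\<bar>y\<bar>" "\<bar>z\<bar>"] zero_le_power2[of y] zero_le_power2[of z]
    unfolding abs_mult power2_abs by linarith
  then show "AE x in torus. norm (u x * v x) \<le> norm ((u x)\<^sup>2 + (v x)\<^sup>2)" by (intro AE_I2) auto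
qed

lemma L2_lincomb:
  assumes "u \<in> L2" "v \<in> L2"
  shows "(\<lambda>x. b * u x + c * v x) \<in> L2"
proof -
  have "integrable torus (\<lambda>x. b\<^sup>2 * (u x * u x) + 2 * b * c * (u x * v x) + c\<^sup>2 * (v x * v x))"
    by (intro Bochner_Integration.integrable_add integrable_mult_right L2_integrable_mult assms)
  moreover have "(\<lambda>x. (b * u x + c * v x)\<^sup>2) = (\<lambda>x. b\<^sup>2 * (u x * u x) + 2 * b * c * (u x * v x) + c\<^sup>2 * (v x * v x))"
    by (auto simp: power2_eq_square algebra_simps)
  ultimately show ?thesis using assms by (auto simp: L2_def)
qed

lemma L2_ops:
  assumes "u \<in> L2" "v \<in> L2"
  shows "(\<lambda>x. u x + v x) \<in> L2" and "(\<lambda>x. u x - v x) \<in> L2"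
  using L2_lincomb[OF assms, of 1 1] L2_lincomb[OF assms, of 1 "-1"] by simp_all

lemma L2_inner_lincomb:
  assumes "u \<in> L2" "v \<in> L2" "w \<in> L2"
  shows "L2_inner (\<lambda>x. b * u x + c * v x) w = b * L2_inner u w + c * L2_inner v w"
proof -
  have "L2_inner (\<lambda>x. b * u x + c * v x) w = (LINT x|torus. b * (u x * w x) + c * (v x * w x))"
    unfolding L2_inner_def by (intro arg_cong[where f = "integral\<^sup>L torus"]) (auto simp: algebra_simps)
  then show ?thesis
    using L2_integrable_mult[OF assms(1,3)] L2_integrable_mult[OF assms(2,3)] by (simp add: L2_inner_def)
qed

lemma L2_inner_commute: "L2_inner u v = L2_inner v u"
  by (simp add: L2_inner_def mult.commute)

lemma L2_inner_nonneg: "0 \<le> L2_inner u u"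
  by (simp add: L2_inner_def)

lemma L2_norm_nonneg [simp]: "0 \<le> L2_norm u"
  by (simp add: L2_norm_def L2_inner_nonneg)

lemma L2_norm_square: "(L2_norm u)\<^sup>2 = L2_inner u u"
  by (simp add: L2_norm_def L2_inner_nonneg)

lemma L2_norm_lincomb_square:
  assumes "u \<in> L2" "v \<in> L2"
  shows "(L2_norm (\<lambda>x. b * u x + c * v x))\<^sup>2 = b\<^sup>2 * (L2_norm u)\<^sup>2 + 2 * b * c * L2_inner u v + c\<^sup>2 * (L2_norm v)\<^sup>2"
  unfolding L2_norm_square L2_inner_lincomb[OF assms L2_lincomb[OF assms]]
    L2_inner_commute[of _ "\<lambda>x. b * u x + c * v x"] L2_inner_lincomb[OF assms assms(1)] L2_inner_lincomb[OF assms assms(2)]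
  using L2_inner_commute[of u v] by (simp add: power2_eq_square algebra_simps)

lemma L2_cauchy_schwarz:
  assumes "u \<in> L2" "v \<in> L2"
  shows "\<bar>L2_inner u v\<bar> \<le> L2_norm u * L2_norm v"
proof -
  define A B C where "A = (L2_norm u)\<^sup>2" and "B = L2_inner u v" and "C = (L2_norm v)\<^sup>2"
  have nn: "0 \<le> A + 2 * t * B + t\<^sup>2 * C" for t
    using L2_norm_lincomb_square[OF assms, of 1 t] zero_le_power2[of "L2_norm (\<lambda>x. 1 * u x + t * v x)"]
    by (simp add: A_def B_def C_def)
  have "B\<^sup>2 \<le> A * C"
  proof (cases "C = 0")
    case True
    have "B = 0"
    proof (rule ccontr)
      assume "B \<noteq> 0"
      \<comment> \<open>With C = 0 this t makes the quadratic equal to -1.\<close>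
      then show False using nn[of "- (A + 1) / (2 * B)"] True by (simp add: field_simps)
    qed
    then show ?thesis using True by simp
  next
    case False
    then have C: "0 < C" by (simp add: C_def)
    have "0 \<le> C * (A + 2 * (- B / C) * B + (- B / C)\<^sup>2 * C)" using nn[of "- B / C"] C by (intro mult_nonneg_nonneg) auto
    also have "\<dots> = A * C - B\<^sup>2" using C by (simp add: power2_eq_square field_simps)
    finally show ?thesis by simp
  qed
  then have "\<bar>B\<bar>\<^sup>2 \<le> (L2_norm u * L2_norm v)\<^sup>2" by (simp add: A_def C_def power_mult_distrib)
  then show ?thesis unfolding B_def by (rule power2_le_imp_le) simp
qed

lemma L2_triangle:
  assumes "u \<in> L2" "v \<in> L2"
  shows "L2_norm (\<lambda>x. u x + v x) \<le> L2_norm u + L2_norm v"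
proof (rule power2_le_imp_le)
  have "(L2_norm (\<lambda>x. u x + v x))\<^sup>2 = (L2_norm u)\<^sup>2 + 2 * L2_inner u v + (L2_norm v)\<^sup>2"
    using L2_norm_lincomb_square[OF assms, of 1 1] by simp
  also have "\<dots> \<le> (L2_norm u + L2_norm v)\<^sup>2"
    using L2_cauchy_schwarz[OF assms] by (simp add: power2_sum)
  finally show "(L2_norm (\<lambda>x. u x + v x))\<^sup>2 \<le> (L2_norm u + L2_norm v)\<^sup>2" .
qed simp

lemma L2_norm_minus_commute: "L2_norm (\<lambda>x. u x - v x) = L2_norm (\<lambda>x. v x - u x)"
  by (simp add: L2_norm_def L2_inner_def algebra_simps)

lemma L2_norm_diff_le:
  assumes "u \<in> L2" "v \<in> L2" "g \<in> L2"
  shows "\<bar>L2_norm (\<lambda>x. u x - g x) - L2_norm (\<lambda>x. v x - g x)\<bar> \<le> L2_norm (\<lambda>x. u x - v x)"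
proof -
  have *: "L2_norm (\<lambda>x. u x - g x) \<le> L2_norm (\<lambda>x. u x - v x) + L2_norm (\<lambda>x. v x - g x)" if "u \<in> L2" "v \<in> L2" for u v
    using L2_triangle[OF L2_ops(2)[OF that] L2_ops(2)[OF that(2) assms(3)]] by simp
  show ?thesis
    using *[OF assms(1,2)] *[OF assms(2,1)] L2_norm_minus_commute[of u v] by linarith
qed

lemma L2_norm_AE_cong:
  assumes "u \<in> L2" "v \<in> L2" "AE x in torus. u x = v x"
  shows "L2_norm u = L2_norm v"
proof -
  have "(LINT x|torus. u x * u x) = (LINT x|torus. v x * v x)"
    using assms by (intro integral_cong_AE borel_measurable_times) (auto simp: L2_def)
  then show ?thesis by (simp add: L2_norm_def L2_inner_def)
qed

lemma lim_inverse_Suc: "(\<lambda>n. 1 / real (Suc n)) \<longlonglongrightarrow> 0"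
  using LIMSEQ_inverse_real_of_nat by (simp only: inverse_eq_divide)

text \<open>Completion of the square: up to a constant the data term is a squared distance to
  g.\<close>

lemma tikhonov_eq:
  assumes "F f \<in> L2" "g \<in> L2"
  shows "tikhonov F R g \<alpha> f = 1 / 2 * (L2_norm (\<lambda>x. F f x - g x))\<^sup>2 - 1 / 2 * (L2_norm g)\<^sup>2 + \<alpha> * R f"
proof -
  have "(L2_norm (\<lambda>x. F f x - g x))\<^sup>2 = (L2_norm (F f))\<^sup>2 - 2 * L2_inner g (F f) + (L2_norm g)\<^sup>2"
    using L2_norm_lincomb_square[OF assms, of 1 "-1"] L2_inner_commute[of g "F f"] by simp
  then show ?thesis by (simp add: tikhonov_def field_simps)
qed

section \<open>Existence, uniqueness and convergence rate of minimizers\<close>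

context tik_setting
begin

lemma lv_tendsto:
  assumes g: "\<And>n. g n \<in> X" and G: "G \<in> X" and lim: "(\<lambda>n. Nx (g n - G)) \<longlonglongrightarrow> 0"
  shows "(\<lambda>n. lv j (g n)) \<longlonglongrightarrow> lv j G"
proof -
  obtain C where C: "0 < C" "\<And>f. f \<in> X \<Longrightarrow> Wn f \<le> C * Nx f" using N_Wn_equiv by metis
  have "\<bar>lv j (g n) - lv j G\<bar> \<le> C * Nx (g n - G)" for n
  proof -
    have X: "g n - G \<in> X" by (intro X_ops g G)
    have "lv j (g n) \<le> lv j (g n - G) + lv j G" using lv_lincomb[OF X G, of j 1 1] by simp
    moreover have "lv j G \<le> lv j (g n) + lv j (g n - G)" using lv_lincomb[OF g[of n] X, of j 1 "-1"] by simp
    ultimately have "\<bar>lv j (g n) - lv j G\<bar> \<le> lv j (g n - G)" by linarith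
    also have "\<dots> \<le> C * Nx (g n - G)" by (rule order_trans[OF lv_le_Wn[OF X] C(2)[OF X]])
    finally show ?thesis .
  qed
  moreover have "(\<lambda>n. C * Nx (g n - G)) \<longlonglongrightarrow> 0" using tendsto_mult[OF tendsto_const lim, of C] by simp
  ultimately have "(\<lambda>n. lv j (g n) - lv j G) \<longlonglongrightarrow> 0"
    by (intro Lim_null_comparison[of "\<lambda>n. lv j (g n) - lv j G"] always_eventually) auto
  then show ?thesis by (rule LIM_zero_cancel)
qed

text \<open>Level norms converge, so each partial sum of the limit inherits the bound.\<close>

lemma Wn_lsc:
  assumes g: "\<And>n. g n \<in> X" and G: "G \<in> X" and lim: "(\<lambda>n. Nx (g n - G)) \<longlonglongrightarrow> 0"
    and K: "\<And>n. n \<ge> M \<Longrightarrow> Wn (g n) \<le> K"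
  shows "Wn G \<le> K"
proof -
  have K0: "0 \<le> K" using K[of M] Wn_nonneg[of "g M"] by linarith
  have q0: "0 < q" using q by simp
  have "(\<Sum>j<J. lv j G powr q) \<le> K powr q" for J
  proof (rule LIMSEQ_le_const2)
    show "(\<lambda>n. \<Sum>j<J. lv j (g n) powr q) \<longlonglongrightarrow> (\<Sum>j<J. lv j G powr q)"
      using q0 by (intro tendsto_sum tendsto_powr' lv_tendsto g G lim tendsto_const) auto
    have "(\<Sum>j<J. lv j (g n) powr q) \<le> K powr q" if "n \<ge> M" for n
      using suminf_powr_le_iff[OF q0 K0, of "\<lambda>j. lv j (g n)"] X_summable[OF g, of n] K[OF that] by (simp add: Wn_def)
    then show "\<exists>N. \<forall>n\<ge>N. (\<Sum>j<J. lv j (g n) powr q) \<le> K powr q" by blast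
  qed
  then show ?thesis using suminf_powr_le_iff[OF q0 K0, of "\<lambda>j. lv j G"] by (simp add: Wn_def)
qed

lemma R_nonneg: "0 \<le> R f"
  using r_ge by (simp add: penalty_def)

text \<open>Near-minimizers of \<open>R\<close> on the convex hulls of the tails form a norm Cauchy sequence by uniform
  convexity; this takes the place of weak compactness and Mazur's lemma.\<close>

lemma convex_tail_limit:
  fixes f :: "nat \<Rightarrow> 'd distribution"
  assumes D: "D \<subseteq> X" "convex D" "closed_in_norm X Nx D" and f: "\<And>n. f n \<in> D"
    and \<rho>: "(\<lambda>n. R (f n)) \<longlonglongrightarrow> \<rho>"
    and cauchy: "\<And>\<epsilon>. 0 < \<epsilon> \<Longrightarrow> \<exists>M. \<forall>m\<ge>M. \<forall>n\<ge>M. Nm (f m - f n) \<le> \<epsilon>"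
  obtains G where "G \<in> D" "R G \<le> \<rho>" "(\<lambda>n. Nm (f n - G)) \<longlonglongrightarrow> 0"
proof -
  define K where "K n = convex hull (f ` {n..})" for n
  have KD: "K n \<subseteq> D" for n unfolding K_def using f D by (intro hull_minimal) auto
  have Kf: "f k \<in> K n" if "n \<le> k" for n k unfolding K_def using that by (intro hull_inc) auto
  have Kmono: "K m \<subseteq> K n" if "n \<le> m" for m n unfolding K_def using that by (intro hull_mono) auto
  \<comment> \<open>Increasing in n because the hulls shrink, and at most \<rho> because they
    contain the tails; hence convergent.\<close>
  define mm where "mm n = Inf (R ` K n)" for n
  have bdd: "bdd_below (R ` K n)" for n using R_nonneg by (intro bdd_belowI[of _ 0]) auto
  have mmle: "mm n \<le> R x" if "x \<in> K n" for n x
    unfolding mm_def using that bdd by (intro cInf_lower) auto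
  have "\<exists>x\<in>K n. R x < mm n + 1 / real (Suc n)" for n
    using cInf_lessD[of "R ` K n" "mm n + 1 / real (Suc n)"] Kf[of n n] by (auto simp: mm_def)
  then obtain g where g: "\<And>n. g n \<in> K n" "\<And>n. R (g n) < mm n + 1 / real (Suc n)" by metis
  have gX: "g n \<in> X" for n using g KD D by blast
  have fX: "f n \<in> X" for n using f D by blast
  have inc: "mm n \<le> mm m" if "n \<le> m" for n m
    unfolding mm_def using Kmono[OF that] Kf[of m m] bdd by (intro cInf_superset_mono) auto
  have mm\<rho>: "mm n \<le> \<rho>" for n
    using Kf mmle by (intro LIMSEQ_le_const[OF \<rho>]) blast
  have "convergent mm"
  proof (intro Bseq_mono_convergent BseqI')
    show "norm (mm n) \<le> \<bar>mm 0\<bar> + \<bar>\<rho>\<bar>" for n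
      using inc[of 0 n] mm\<rho>[of n] by simp
  qed (use inc in blast)
  then obtain m\<^sub>0 where m0: "mm \<longlonglongrightarrow> m\<^sub>0" by (auto simp: convergent_def)
  have mm0: "mm n \<le> m\<^sub>0" for n using inc by (intro LIMSEQ_le_const[OF m0]) blast
  obtain C where C: "0 < C" "\<And>f. f \<in> X \<Longrightarrow> Nx f \<le> C * Wn f" using N_Wn_equiv by metis
  have Cau: "\<exists>M. \<forall>m\<ge>M. \<forall>n\<ge>M. Nx (g m - g n) \<le> \<epsilon>" if \<epsilon>: "0 < \<epsilon>" for \<epsilon>
  proof -
    \<comment> \<open>The midpoint of two near-minimizers stays in \<open>K M\<close>, so R there is
      at least \<open>mm M\<close>, while both values of R are at most \<open>m\<^sub>0\<close> +
      1/(M+1). The gap, below \<eta>, bounds \<kappa> Wn^r.\<close>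
    define \<eta> where "\<eta> = \<kappa> * (\<epsilon> / C) powr r"
    have \<eta>: "0 < \<eta>" using \<epsilon> C(1) \<kappa>_pos by (simp add: \<eta>_def)
    have "(\<lambda>n. (m\<^sub>0 - mm n) + 1 / real (Suc n)) \<longlonglongrightarrow> (m\<^sub>0 - m\<^sub>0) + 0"
      by (intro tendsto_add tendsto_diff tendsto_const m0 lim_inverse_Suc)
    then have "\<forall>\<^sub>F n in sequentially. (m\<^sub>0 - mm n) + 1 / real (Suc n) < \<eta>"
      using \<eta> by (intro order_tendstoD(2)) auto
    then obtain M where M: "(m\<^sub>0 - mm M) + 1 / real (Suc M) < \<eta>" by (auto simp: eventually_sequentially)
    have "Nx (g m - g n) \<le> \<epsilon>" if mn: "m \<ge> M" "n \<ge> M" for m n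
    proof -
      have "convex (K M)" by (simp add: K_def)
      then have "(1 / 2) *\<^sub>R g m + (1 / 2) *\<^sub>R g n \<in> K M"
        using g(1)[of m] g(1)[of n] Kmono[OF mn(1)] Kmono[OF mn(2)] by (intro convexD) auto
      then have "mm M \<le> R ((1 / 2) *\<^sub>R g m + (1 / 2) *\<^sub>R g n)" by (rule mmle)
      moreover have "R (g k) \<le> m\<^sub>0 + 1 / real (Suc M)" if "k \<ge> M" for k
      proof -
        have "1 / real (Suc k) \<le> 1 / real (Suc M)" using that by (intro divide_left_mono) auto
        then show ?thesis using g(2)[of k] mm0[of k] by linarith
      qed
      moreover have "z < \<eta>" if "mm M \<le> t" "t + z \<le> (x + y) / 2" "x \<le> m\<^sub>0 + i" "y \<le> m\<^sub>0 + i" "(m\<^sub>0 - mm M) + i < \<eta>"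
        for t x y z i :: real using that by simp
      ultimately have "\<kappa> * Wn (g m - g n) powr r < \<eta>"
        using R_uniformly_convex[OF gX gX, of m n] M mn by blast
      then have "Wn (g m - g n) powr r < (\<epsilon> / C) powr r" using \<kappa>_pos by (simp add: \<eta>_def)
      then have "\<not> \<epsilon> / C \<le> Wn (g m - g n)"
        using powr_mono2[of r "\<epsilon> / C" "Wn (g m - g n)"] r_ge \<epsilon> C(1) by auto
      then have "Wn (g m - g n) \<le> \<epsilon> / C" by simp
      then have "C * Wn (g m - g n) \<le> C * (\<epsilon> / C)" using C(1) by (intro mult_left_mono) auto
      then show ?thesis using C(2)[OF X_ops(2)[OF gX gX], of m n] C(1) by simp
    qed
    then show ?thesis by blast
  qed
  obtain G where G: "G \<in> X" "(\<lambda>n. Nx (g n - G)) \<longlonglongrightarrow> 0"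
    using X_complete[OF gX Cau] by blast
  have "g n \<in> D" for n using g KD by blast
  then have GD: "G \<in> D" using D(3) G unfolding closed_in_norm_def by blast
  \<comment> \<open>The slack e absorbs the error 1/(n+1) of the near-minimizers; the bound is
    rewritten as one on Wn so that \<open>Wn_lsc\<close> applies.\<close>
  have "R G \<le> \<rho> + e" if e: "0 < e" for e
  proof -
    have "0 \<le> \<rho>" using R_nonneg by (intro LIMSEQ_le_const[OF \<rho>]) blast
    obtain M where M: "1 / real (Suc M) < e" using nat_approx_posE[OF e] by blast
    have "Wn G \<le> (r * (\<rho> + e)) powr (1 / r)"
    proof (rule Wn_lsc[OF gX G])
      fix n assume n: "n \<ge> M"
      have "1 / real (Suc n) \<le> 1 / real (Suc M)" using n by (intro divide_left_mono) auto
      then have "R (g n) \<le> \<rho> + e" using g(2)[of n] mm\<rho>[of n] M by linarith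
      then have "Wn (g n) powr r \<le> r * (\<rho> + e)" using r_ge by (simp add: R_eq[OF gX] field_simps)
      then have "(Wn (g n) powr r) powr (1 / r) \<le> (r * (\<rho> + e)) powr (1 / r)" using r_ge by (intro powr_mono2) auto
      then show "Wn (g n) \<le> (r * (\<rho> + e)) powr (1 / r)" using r_ge Wn_nonneg by (simp add: powr_powr)
    qed
    then have "Wn G powr r \<le> ((r * (\<rho> + e)) powr (1 / r)) powr r" using r_ge Wn_nonneg by (intro powr_mono2) auto
    also have "\<dots> = r * (\<rho> + e)" using r_ge e \<open>0 \<le> \<rho>\<close> by (simp add: powr_powr)
    finally show ?thesis using r_ge by (simp add: R_eq[OF G(1)] field_simps)
  qed
  then have RG: "R G \<le> \<rho>" by (rule field_le_epsilon)
  obtain C' where C': "0 < C'" "\<And>f. f \<in> X \<Longrightarrow> Nm f \<le> C' * Nx f" using Nm_le_Nx by metis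
  have "(\<lambda>n. Nm (f n - G)) \<longlonglongrightarrow> 0"
  proof (rule LIMSEQ_I)
    fix e :: real assume e: "0 < e"
    obtain M1 where M1: "\<And>m n. m \<ge> M1 \<Longrightarrow> n \<ge> M1 \<Longrightarrow> Nm (f m - f n) \<le> e / 3" using cauchy[of "e / 3"] e by auto
    have "\<forall>\<^sub>F n in sequentially. Nx (g n - G) < e / (3 * C')" using e C'(1) by (intro order_tendstoD(2)[OF G(2)]) auto
    then obtain M2 where M2: "\<And>n. n \<ge> M2 \<Longrightarrow> Nx (g n - G) < e / (3 * C')" by (auto simp: eventually_sequentially)
    have "norm (Nm (f n - G) - 0) < e" if n: "n \<ge> max M1 M2" for n
    proof -
      \<comment> \<open>The ball about f n in the weak norm is convex and contains the tail, hence
        also g n. Thus f n and g n have the same weak limit.\<close>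
      have "K n \<subseteq> {x \<in> X. Nm (x - f n) \<le> e / 3}"
        unfolding K_def
      proof (rule hull_minimal)
        show "f ` {n..} \<subseteq> {x \<in> X. Nm (x - f n) \<le> e / 3}" using fX M1 n by auto
        show "convex {x \<in> X. Nm (x - f n) \<le> e / 3}"
        proof (rule convexI)
          fix x y and u v :: real
          assume xy: "x \<in> {x \<in> X. Nm (x - f n) \<le> e / 3}" "y \<in> {x \<in> X. Nm (x - f n) \<le> e / 3}" and uv: "0 \<le> u" "0 \<le> v" "u + v = 1"
          have X: "x - f n \<in> X" "y - f n \<in> X" using xy fX by (auto intro: X_ops)
          have "u *\<^sub>R (x - f n) + v *\<^sub>R (y - f n) = u *\<^sub>R x + v *\<^sub>R y - (u + v) *\<^sub>R f n"
            by (simp add: scaleR_diff_right scaleR_add_left)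
          then have "u *\<^sub>R x + v *\<^sub>R y - f n = u *\<^sub>R (x - f n) + v *\<^sub>R (y - f n)" using uv(3) by simp
          then have "Nm (u *\<^sub>R x + v *\<^sub>R y - f n) \<le> u * Nm (x - f n) + v * Nm (y - f n)"
            using Nm_add[OF X_ops(3)[OF X(1) X(1), of u] X_ops(3)[OF X(2) X(2), of v]] Nm_scale[OF X(1), of u] Nm_scale[OF X(2), of v] uv by simp
          also have "\<dots> \<le> u * (e / 3) + v * (e / 3)" using xy uv by (intro add_mono mult_left_mono) auto
          also have "\<dots> = e / 3" using uv(3) by (simp flip: distrib_right)
          finally show "u *\<^sub>R x + v *\<^sub>R y \<in> {x \<in> X. Nm (x - f n) \<le> e / 3}" using xy X_lincomb by auto
        qed
      qed
      then have 1: "Nm (g n - f n) \<le> e / 3" using g(1) by blast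
      have gfX: "g n - f n \<in> X" and gGX: "g n - G \<in> X" and fGX: "f n - G \<in> X" by (intro X_ops gX fX G)+
      have "Nm (g n - G) \<le> C' * Nx (g n - G)" by (rule C'(2)[OF gGX])
      also have "\<dots> \<le> C' * (e / (3 * C'))" using M2[of n] n C'(1) by (intro mult_left_mono) auto
      finally have 2: "Nm (g n - G) \<le> e / 3" using C'(1) by simp
      have "Nm (f n - G) = Nm (- (g n - f n) + (g n - G))" by simp
      also have "\<dots> \<le> Nm (- (g n - f n)) + Nm (g n - G)"
        using X_ops(3)[OF gfX gfX, of "-1"] gGX by (intro Nm_add) auto
      finally show ?thesis using 1 2 Nm_uminus[OF gfX] Nm_ge_0[OF fGX] e by simp
    qed
    then show "\<exists>no. \<forall>n\<ge>no. norm (Nm (f n - G) - 0) < e" by blast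
  qed
  with GD RG show ?thesis by (rule that)
qed

text \<open>Along a subsequence of a minimizing sequence the residual norms d converge, hence so do
  the penalties. \<open>convex_tail_limit\<close> gives G with R G at most their limit; G is also
  the weak limit of the sequence itself, where d is continuous, so d G is the limit of d even for
  nonlinear F.\<close>

lemma tikhonov_minimizer_exists:
  fixes F :: "'d distribution \<Rightarrow> real^'d \<Rightarrow> real"
  assumes D: "D \<noteq> {}" "D \<subseteq> X" "convex D" "closed_in_norm X Nx D" and F: "\<And>f. f \<in> D \<Longrightarrow> F f \<in> L2"
    and L: "0 < L" "\<And>f1 f2. f1 \<in> D \<Longrightarrow> f2 \<in> D \<Longrightarrow> L2_norm (\<lambda>x. F f1 x - F f2 x) \<le> L * Nm (f1 - f2)"
    and g: "g \<in> L2" and \<alpha>: "0 < \<alpha>"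
  shows "\<exists>f. is_arg_min (tikhonov F R g \<alpha>) (\<lambda>f. f \<in> D) f"
proof -
  define T where "T = tikhonov F R g \<alpha>"
  define d where "d f = L2_norm (\<lambda>x. F f x - g x)" for f
  define c0 where "c0 = 1 / 2 * (L2_norm g)\<^sup>2"
  have T: "T f = 1 / 2 * (d f)\<^sup>2 - c0 + \<alpha> * R f" if "f \<in> D" for f
    unfolding T_def d_def c0_def by (rule tikhonov_eq[where F = F and g = g, OF F[OF that] g])
  have d_diff: "\<bar>d f1 - d f2\<bar> \<le> L * Nm (f1 - f2)" if "f1 \<in> D" "f2 \<in> D" for f1 f2
    unfolding d_def using L2_norm_diff_le[OF F F g, OF that] L(2)[OF that] by linarith
  \<comment> \<open>Up to -c0 the data term is nonnegative, so T is bounded below and controls R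
    along minimizing sequences.\<close>
  have Tlow: "\<alpha> * R f - c0 \<le> T f" if "f \<in> D" for f using T[OF that] zero_le_power2[of "d f"] by linarith
  define m where "m = Inf (T ` D)"
  have "- c0 \<le> T f" if "f \<in> D" for f using Tlow[OF that] mult_nonneg_nonneg[OF less_imp_le[OF \<alpha>] R_nonneg[of f]] by linarith
  then have bdd: "bdd_below (T ` D)" by (intro bdd_belowI[of _ "- c0"]) auto
  have mT: "m \<le> T f" if "f \<in> D" for f unfolding m_def using that bdd by (intro cInf_lower) auto
  have "\<exists>f\<in>D. T f < m + 1 / real (Suc n)" for n
    using cInf_lessD[of "T ` D" "m + 1 / real (Suc n)"] D(1) by (auto simp: m_def)
  then obtain f where f: "\<And>n. f n \<in> D" "\<And>n. T (f n) < m + 1 / real (Suc n)" by metis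
  have fX: "f n \<in> X" for n using f D by blast
  have WB: "Wn (f n) \<le> (r * ((m + 1 + c0) / \<alpha>)) powr (1 / r)" for n
  proof -
    have "1 / real (Suc n) \<le> 1" by simp
    then have "\<alpha> * R (f n) \<le> m + 1 + c0" using Tlow[OF f(1)[of n]] f(2)[of n] by linarith
    then have "R (f n) \<le> (m + 1 + c0) / \<alpha>" using \<alpha> by (simp add: field_simps)
    then have "r * R (f n) \<le> r * ((m + 1 + c0) / \<alpha>)" using r_ge by (intro mult_left_mono) auto
    then have "Wn (f n) powr r \<le> r * ((m + 1 + c0) / \<alpha>)" using r_ge by (simp add: R_eq[OF fX])
    then have "(Wn (f n) powr r) powr (1 / r) \<le> (r * ((m + 1 + c0) / \<alpha>)) powr (1 / r)" using r_ge by (intro powr_mono2) auto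
    then show ?thesis using r_ge Wn_nonneg by (simp add: powr_powr)
  qed
  obtain k :: "nat \<Rightarrow> nat" where k: "strict_mono k" "\<forall>\<epsilon>>0. \<exists>M. \<forall>m\<ge>M. \<forall>n\<ge>M. Nm (f (k m) - f (k n)) \<le> \<epsilon>"
    by (rule Nm_compact[OF fX WB])
  define h where "h n = f (k n)" for n
  have hD: "h n \<in> D" for n by (simp add: h_def f)
  have "Cauchy (\<lambda>n. d (h n))"
    unfolding Cauchy_def dist_real_def
  proof (intro allI impI)
    fix e :: real assume e: "0 < e"
    then obtain M where M: "\<And>m n. m \<ge> M \<Longrightarrow> n \<ge> M \<Longrightarrow> Nm (h m - h n) \<le> e / (2 * L)"
      using k(2)[rule_format, of "e / (2 * L)"] L(1) unfolding h_def by auto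
    have "\<bar>d (h m) - d (h n)\<bar> < e" if "m \<ge> M" "n \<ge> M" for m n
    proof -
      have "L * Nm (h m - h n) \<le> L * (e / (2 * L))" using M[OF that] L(1) by (intro mult_left_mono) auto
      then show ?thesis using d_diff[OF hD hD, of m n] L(1) e by simp
    qed
    then show "\<exists>M. \<forall>m\<ge>M. \<forall>n\<ge>M. \<bar>d (h m) - d (h n)\<bar> < e" by blast
  qed
  then obtain \<delta> where \<delta>: "(\<lambda>n. d (h n)) \<longlonglongrightarrow> \<delta>" by (auto simp: Cauchy_convergent_iff convergent_def)
  have Tm: "(\<lambda>n. T (h n)) \<longlonglongrightarrow> m"
  proof (rule tendsto_sandwich[of "\<lambda>_. m" _ _ "\<lambda>n. m + 1 / real (Suc n)"])
    have "T (h n) \<le> m + 1 / real (Suc n)" for n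
    proof -
      have "1 / real (Suc (k n)) \<le> 1 / real (Suc n)" using seq_suble[OF k(1), of n] by (intro divide_left_mono) auto
      then show ?thesis using f(2)[of "k n"] unfolding h_def by linarith
    qed
    then show "\<forall>\<^sub>F n in sequentially. T (h n) \<le> m + 1 / real (Suc n)" by simp
    show "(\<lambda>n. m + 1 / real (Suc n)) \<longlonglongrightarrow> m"
      using tendsto_add[OF tendsto_const lim_inverse_Suc, of m] by simp
  qed (use mT hD in auto)
  \<comment> \<open>Forced by T = d^2/2 - c0 + \<alpha> R, since T and d converge.\<close>
  define \<rho> where "\<rho> = (m - 1 / 2 * \<delta>\<^sup>2 + c0) / \<alpha>"
  have R\<rho>: "(\<lambda>n. R (h n)) \<longlonglongrightarrow> \<rho>"
  proof -
    have "R (h n) = (T (h n) - 1 / 2 * (d (h n))\<^sup>2 + c0) / \<alpha>" for n using T[OF hD, of n] \<alpha> by simp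
    moreover have "(\<lambda>n. (T (h n) - 1 / 2 * (d (h n))\<^sup>2 + c0) / \<alpha>) \<longlonglongrightarrow> \<rho>"
      unfolding \<rho>_def using \<alpha> by (intro tendsto_intros Tm \<delta>) auto
    ultimately show ?thesis by simp
  qed
  obtain G where G: "G \<in> D" "R G \<le> \<rho>" "(\<lambda>n. Nm (h n - G)) \<longlonglongrightarrow> 0"
  proof (rule convex_tail_limit[OF D(2-4) hD R\<rho>])
    show "\<exists>M. \<forall>m\<ge>M. \<forall>n\<ge>M. Nm (h m - h n) \<le> \<epsilon>" if "0 < \<epsilon>" for \<epsilon>
      using k(2) that by (simp add: h_def)
  qed blast
  have "(\<lambda>n. d (h n) - d G) \<longlonglongrightarrow> 0"
  proof (rule Lim_null_comparison)
    show "\<forall>\<^sub>F n in sequentially. norm (d (h n) - d G) \<le> L * Nm (h n - G)" using d_diff[OF hD G(1)] by simp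
    show "(\<lambda>n. L * Nm (h n - G)) \<longlonglongrightarrow> 0" using tendsto_mult[OF tendsto_const G(3), of L] by simp
  qed
  then have "(\<lambda>n. d (h n)) \<longlonglongrightarrow> d G" by (rule LIM_zero_cancel)
  from LIMSEQ_unique[OF this \<delta>] have "d G = \<delta>" .
  then have "T G = 1 / 2 * \<delta>\<^sup>2 - c0 + \<alpha> * R G" using T[OF G(1)] by simp
  also have "\<dots> \<le> 1 / 2 * \<delta>\<^sup>2 - c0 + \<alpha> * \<rho>" using G(2) \<alpha> by simp
  also have "\<dots> = m" using \<alpha> by (simp add: \<rho>_def)
  finally have "T G \<le> T y" if "y \<in> D" for y using mT[OF that] by linarith
  then have "is_arg_min T (\<lambda>f. f \<in> D) G" unfolding is_arg_min_def using G(1) by (auto simp: not_less)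
  then show ?thesis unfolding T_def by blast
qed

text \<open>At the midpoint of two minimizers the data term is at most its mean, by linearity almost
  everywhere and Cauchy--Schwarz, while the penalty lies below its mean by at least \<kappa> Wn^r of
  the difference.\<close>

lemma tikhonov_minimizer_unique:
  fixes F :: "'d distribution \<Rightarrow> real^'d \<Rightarrow> real"
  assumes D: "D \<subseteq> X" "convex D" and F: "\<And>f. f \<in> D \<Longrightarrow> F f \<in> L2" and lin: "linear_into_L2 X D F"
    and g: "g \<in> L2" and \<alpha>: "0 < \<alpha>"
    and f1: "is_arg_min (tikhonov F R g \<alpha>) (\<lambda>f. f \<in> D) f1" and f2: "is_arg_min (tikhonov F R g \<alpha>) (\<lambda>f. f \<in> D) f2"
  shows "f1 = f2"
proof -
  define T where "T = tikhonov F R g \<alpha>"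
  have fD: "f1 \<in> D" "f2 \<in> D" and min: "\<And>y. y \<in> D \<Longrightarrow> T f1 \<le> T y" "\<And>y. y \<in> D \<Longrightarrow> T f2 \<le> T y"
    using f1 f2 unfolding is_arg_min_def T_def by (auto simp: not_less)
  have fX: "f1 \<in> X" "f2 \<in> X" using fD D by auto
  let ?h = "(1 / 2) *\<^sub>R f1 + (1 / 2) *\<^sub>R f2"
  have hD: "?h \<in> D" using D(2) fD by (intro convexD) auto
  obtain A where A: "\<forall>f\<in>X. \<forall>g\<in>X. \<forall>b c. AE x in torus. A (b *\<^sub>R f + c *\<^sub>R g) x = b * A f x + c * A g x"
    "\<forall>f\<in>D. AE x in torus. F f x = A f x"
    using lin unfolding linear_into_L2_def by blast
  define u1 where "u1 x = F f1 x - g x" for x define u2 where "u2 x = F f2 x - g x" for x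
  have u: "u1 \<in> L2" "u2 \<in> L2" unfolding u1_def u2_def by (intro L2_ops F fD g)+
  have "AE x in torus. A ?h x = 1 / 2 * A f1 x + 1 / 2 * A f2 x" using A(1) fX by blast
  moreover have "AE x in torus. F f1 x = A f1 x" "AE x in torus. F f2 x = A f2 x" "AE x in torus. F ?h x = A ?h x"
    using A(2) fD hD by blast+
  ultimately have "AE x in torus. F ?h x - g x = 1 / 2 * u1 x + 1 / 2 * u2 x"
    by eventually_elim (simp add: u1_def u2_def field_simps)
  then have "L2_norm (\<lambda>x. F ?h x - g x) = L2_norm (\<lambda>x. 1 / 2 * u1 x + 1 / 2 * u2 x)"
    by (intro L2_norm_AE_cong L2_ops F hD g L2_lincomb u)
  then have "(L2_norm (\<lambda>x. F ?h x - g x))\<^sup>2 = 1 / 4 * (L2_norm u1)\<^sup>2 + 1 / 2 * L2_inner u1 u2 + 1 / 4 * (L2_norm u2)\<^sup>2"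
    using L2_norm_lincomb_square[OF u, of "1/2" "1/2"] by (simp add: power2_eq_square)
  also have "\<dots> \<le> 1 / 2 * (L2_norm u1)\<^sup>2 + 1 / 2 * (L2_norm u2)\<^sup>2"
    using L2_cauchy_schwarz[OF u] sum_squares_bound[of "L2_norm u1" "L2_norm u2"] by linarith
  finally have sq: "(L2_norm (\<lambda>x. F ?h x - g x))\<^sup>2 \<le> 1 / 2 * (L2_norm u1)\<^sup>2 + 1 / 2 * (L2_norm u2)\<^sup>2" .
  have "\<alpha> * (R ?h + \<kappa> * Wn (f1 - f2) powr r) \<le> \<alpha> * ((R f1 + R f2) / 2)"
    using \<alpha> by (intro mult_left_mono R_uniformly_convex fX) auto
  then have "T ?h + \<alpha> * (\<kappa> * Wn (f1 - f2) powr r) \<le> (T f1 + T f2) / 2"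
    using sq unfolding T_def tikhonov_eq[where F = F and g = g, OF F[OF hD] g]
      tikhonov_eq[where F = F and g = g, OF F[OF fD(1)] g] tikhonov_eq[where F = F and g = g, OF F[OF fD(2)] g]
      u1_def u2_def distrib_left by argo
  moreover have "T f1 = T f2" using min fD by (simp add: order_antisym)
  moreover have "x \<le> 0" if "th + x \<le> (t1 + t2) / 2" "t1 = t2" "t1 \<le> th" for x th t1 t2 :: real
    using that by simp
  ultimately have "\<alpha> * (\<kappa> * Wn (f1 - f2) powr r) \<le> 0" using min(1)[OF hD] by blast
  then have "Wn (f1 - f2) powr r \<le> 0" using \<alpha> \<kappa>_pos by (simp add: mult_le_0_iff)
  then have W: "Wn (f1 - f2) = 0" by simp
  obtain C where C: "0 < C" "\<And>f. f \<in> X \<Longrightarrow> Nx f \<le> C * Wn f" using N_Wn_equiv by metis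
  have X: "f1 - f2 \<in> X" by (intro X_ops fX)
  have "Nx (f1 - f2) = 0" using C(2)[OF X] W Nx_ge_0[OF X] by simp
  then have "f1 - f2 = 0" by (rule Nx_eq_0[OF X])
  then show ?thesis by simp
qed

text \<open>The choice of \<open>\<alpha>\<close> makes \<open>4\<delta>\<^sup>2\<close> a maximizer of \<open>\<psi>(\<tau>) - \<tau>/(4\<alpha>)\<close>, which bounds the Bregman distance
  by \<open>2\<psi>(4\<delta>\<^sup>2)\<close>.\<close>

lemma tikhonov_bregman_bound:
  fixes F :: "'d distribution \<Rightarrow> real^'d \<Rightarrow> real"
  assumes F: "\<And>f. f \<in> D \<Longrightarrow> F f \<in> L2" and \<xi>: "\<xi> \<in> L2" "L2_norm \<xi> \<le> \<delta>" and \<alpha>: "0 < \<alpha>"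
    and D: "D \<subseteq> X" "f_dag \<in> D" and u: "u \<in> subdifferential X Nx R f_dag"
    and vsc: "\<And>f. f \<in> D \<Longrightarrow> u (f_dag - f) \<le> 1 / 2 * bregman R u f f_dag + \<psi> ((L2_norm (\<lambda>x. F f_dag x - F f x))\<^sup>2)"
    and sub: "- 1 / (4 * \<alpha>) \<in> ereal_subdifferential (neg_ext \<psi>) (4 * \<delta>\<^sup>2)"
    and f: "is_arg_min (tikhonov F R (\<lambda>x. F f_dag x + \<xi> x) \<alpha>) (\<lambda>f. f \<in> D) f"
  shows "bregman R u f f_dag \<le> 2 * \<psi> (4 * \<delta>\<^sup>2)"
proof -
  have fD: "f \<in> D" and min: "tikhonov F R (\<lambda>x. F f_dag x + \<xi> x) \<alpha> f \<le> tikhonov F R (\<lambda>x. F f_dag x + \<xi> x) \<alpha> f_dag"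
    using f D unfolding is_arg_min_def by (auto simp: not_less)
  have fX: "f \<in> X" "f_dag \<in> X" using fD D by auto
  define v where "v x = F f_dag x - F f x" for x
  have v: "v \<in> L2" unfolding v_def by (intro L2_ops F fD D)
  define E where "E = L2_norm v"
  have g: "(\<lambda>x. F f_dag x + \<xi> x) \<in> L2" by (intro L2_ops F D \<xi>)
  have "(L2_norm (\<lambda>x. F f x - (F f_dag x + \<xi> x)))\<^sup>2 = (L2_norm (\<lambda>x. (-1) * v x + (-1) * \<xi> x))\<^sup>2"
    by (simp add: v_def algebra_simps)
  also have "\<dots> = E\<^sup>2 + 2 * L2_inner v \<xi> + (L2_norm \<xi>)\<^sup>2"
    using L2_norm_lincomb_square[OF v \<xi>(1), of "-1" "-1"] by (simp add: E_def)
  finally have 1: "(L2_norm (\<lambda>x. F f x - (F f_dag x + \<xi> x)))\<^sup>2 = E\<^sup>2 + 2 * L2_inner v \<xi> + (L2_norm \<xi>)\<^sup>2" .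
  have 2: "(L2_norm (\<lambda>x. F f_dag x - (F f_dag x + \<xi> x)))\<^sup>2 = (L2_norm \<xi>)\<^sup>2"
    by (simp add: L2_norm_square L2_inner_def)
  have "1 / 2 * (E\<^sup>2 + 2 * L2_inner v \<xi>) + \<alpha> * R f \<le> \<alpha> * R f_dag"
    using min unfolding tikhonov_eq[where F = F and g = "\<lambda>x. F f_dag x + \<xi> x", OF F[OF fD] g]
      tikhonov_eq[where F = F and g = "\<lambda>x. F f_dag x + \<xi> x", OF F[OF D(2)] g] 1 2 by argo
  moreover have "\<bar>L2_inner v \<xi>\<bar> \<le> E * \<delta>"
    using L2_cauchy_schwarz[OF v \<xi>(1)] mult_left_mono[OF \<xi>(2), of E] by (simp add: E_def)
  \<comment> \<open>With this weight half of E^2 minus E\<delta> stays above E^2/4 - \<delta>^2,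
    which makes \<delta>^2 the effective noise level.\<close>
  moreover have "E * \<delta> \<le> \<delta>\<^sup>2 + 1 / 4 * E\<^sup>2"
    using zero_le_power2[of "1 / 2 * E - \<delta>"] by (simp add: power2_eq_square algebra_simps)
  moreover have "1 / 4 * e - y \<le> rd - rf" if "1 / 2 * (e + 2 * b) + rf \<le> rd" "\<bar>b\<bar> \<le> z" "z \<le> y + 1 / 4 * e"
    for e y b z rd rf :: real using that by argo
  ultimately have "1 / 4 * E\<^sup>2 - \<delta>\<^sup>2 \<le> \<alpha> * (R f_dag - R f)"
    unfolding right_diff_distrib by blast
  also have "R f_dag - R f = u (f_dag - f) - bregman R u f f_dag"
    using subgrad_ops(2)[OF u X_ops(2)[OF fX] fX(1)] by (simp add: bregman_def)
  finally have 3: "1 / 4 * E\<^sup>2 - \<delta>\<^sup>2 \<le> \<alpha> * (u (f_dag - f) - bregman R u f f_dag)" .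
  also have "\<dots> \<le> \<alpha> * (\<psi> (E\<^sup>2) - 1 / 2 * bregman R u f f_dag)"
    using vsc[OF fD] \<alpha> unfolding E_def v_def[abs_def] by (intro mult_left_mono) auto
  finally have "1 / 2 * bregman R u f f_dag \<le> \<psi> (E\<^sup>2) - (1 / 4 * E\<^sup>2 - \<delta>\<^sup>2) / \<alpha>"
    using \<alpha> by (simp add: field_simps)
  also have "\<dots> \<le> \<psi> (4 * \<delta>\<^sup>2)"
  proof -
    \<comment> \<open>Since (E^2/4 - \<delta>^2)/\<alpha> = (E^2 - 4\<delta>^2)/(4\<alpha>), the
      subgradient inequality of -\<psi> at 4\<delta>^2, taken at E^2, is precisely the bound
      needed.\<close>
    have "neg_ext \<psi> (4 * \<delta>\<^sup>2) + ereal (- 1 / (4 * \<alpha>) * (E\<^sup>2 - 4 * \<delta>\<^sup>2)) \<le> neg_ext \<psi> (E\<^sup>2)"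
      using sub unfolding ereal_subdifferential_def by blast
    then have "- \<psi> (4 * \<delta>\<^sup>2) + - 1 / (4 * \<alpha>) * (E\<^sup>2 - 4 * \<delta>\<^sup>2) \<le> - \<psi> (E\<^sup>2)"
      by (simp add: neg_ext_def)
    moreover have "- 1 / (4 * \<alpha>) * (E\<^sup>2 - 4 * \<delta>\<^sup>2) = - ((1 / 4 * E\<^sup>2 - \<delta>\<^sup>2) / \<alpha>)"
      using \<alpha> by (simp add: field_simps)
    ultimately show ?thesis by linarith
  qed
  finally show ?thesis by simp
qed

text \<open>\<psi> is evaluated at squared distances, which doubles \<open>\<mu>_exp\<close>; in
  terms of r and \<gamma> the two cases of the exponents become one.\<close>

lemma psi_fun_eq:
  assumes "0 \<le> E"
  shows "\<psi>_fun q a s c \<rho> (E\<^sup>2) = c * \<rho> powr (r * a / (a + \<gamma>)) * E powr (r * \<gamma> / (a + \<gamma>))"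
proof -
  have "\<nu>_exp q a s = r * a / (a + \<gamma>)" using r by (auto simp: \<nu>_exp_def \<gamma>_def)
  moreover have "(E\<^sup>2) powr \<mu>_exp q a s = E powr (r * \<gamma> / (a + \<gamma>))"
  proof -
    have "2 * \<mu>_exp q a s = r * \<gamma> / (a + \<gamma>)"
      using r by (auto simp: \<mu>_exp_def \<gamma>_def simp del: distrib_left_numeral)
    moreover have "(E\<^sup>2) powr \<mu>_exp q a s = E powr (2 * \<mu>_exp q a s)"
      using assms by (cases "E = 0") (auto simp: powr_powr simp flip: powr_numeral)
    ultimately show ?thesis by simp
  qed
  ultimately show ?thesis by (simp add: \<psi>_fun_def)
qed

text \<open>The r-th root of the Bregman bound; 4\<delta>^2 = (2\<delta>)^2 produces the factor
  2^(\<gamma>/(a+\<gamma>)).\<close>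

lemma Wn_rate:
  assumes c: "0 < c" and \<delta>: "0 < \<delta>" and W: "0 \<le> W" "2 * \<kappa> * W powr r \<le> 2 * \<psi>_fun q a s c \<rho> (4 * \<delta>\<^sup>2)"
  shows "W \<le> (c / \<kappa>) powr (1 / r) * 2 powr (\<gamma> / (a + \<gamma>)) * rate q a s \<rho> \<delta>"
proof -
  have rt: "rate q a s \<rho> \<delta> = \<rho> powr (a / (a + \<gamma>)) * \<delta> powr (\<gamma> / (a + \<gamma>))"
    by (simp add: rate_def \<gamma>_def)
  have "4 * \<delta>\<^sup>2 = (2 * \<delta>)\<^sup>2" by (simp add: power2_eq_square)
  then have "\<psi>_fun q a s c \<rho> (4 * \<delta>\<^sup>2) = c * \<rho> powr (r * a / (a + \<gamma>)) * (2 * \<delta>) powr (r * \<gamma> / (a + \<gamma>))"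
    using psi_fun_eq[of "2 * \<delta>" c \<rho>] \<delta> by simp
  then have "W powr r \<le> c / \<kappa> * (\<rho> powr (r * a / (a + \<gamma>)) * (2 * \<delta>) powr (r * \<gamma> / (a + \<gamma>)))"
    using W(2) \<kappa>_pos by (simp add: field_simps)
  then have "(W powr r) powr (1 / r) \<le> (c / \<kappa> * (\<rho> powr (r * a / (a + \<gamma>)) * (2 * \<delta>) powr (r * \<gamma> / (a + \<gamma>)))) powr (1 / r)"
    using r_ge by (intro powr_mono2) auto
  also have "\<dots> = (c / \<kappa>) powr (1 / r) * (\<rho> powr (a / (a + \<gamma>)) * (2 powr (\<gamma> / (a + \<gamma>)) * \<delta> powr (\<gamma> / (a + \<gamma>))))"
    using r_ge unfolding powr_mult powr_powr by simp
  finally show ?thesis using r_ge W(1) by (simp add: rt powr_powr mult_ac)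
qed

end

theorem theorem4p2:
  fixes \<theta> :: "real^'d \<Rightarrow> real"
    and I :: "nat \<Rightarrow> 'i set"
    and \<phi> :: "nat \<Rightarrow> 'i \<Rightarrow> real^'d \<Rightarrow> real"
    and N :: "real \<Rightarrow> ennreal \<Rightarrow> ennreal \<Rightarrow> 'd distribution \<Rightarrow> real"
    and \<sigma> p q a s r L :: real
    and X :: "'d distribution set"
    and R :: "'d distribution \<Rightarrow> real"
  assumes "lp_cutoff \<theta>"
    and "besov_norms \<theta> N"
    and "wavelet_system \<theta> \<sigma> I \<phi>"
    and "a < \<sigma>" and "s < \<sigma>"
    and "1 < p" and "p \<le> 2" and "1 < q"
    and "0 < a" and "real CARD('d) / p - real CARD('d) / 2 < a"
    and "0 < s" and "s < a / (q - 1)"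
    and "0 < L"
    and r_def: "r = Max {2, p, q}"
    and X_def: "X = besov \<theta> 0 (ennreal p) (ennreal q)"
    and R_def: "R = penalty \<theta> I \<phi> p q r"
  shows "\<exists>c>0. \<exists>c'>0. \<forall>D (F :: 'd distribution \<Rightarrow> real^'d \<Rightarrow> real) f_dag \<rho> f_star.
     D \<noteq> {} \<and> D \<subseteq> X \<and> convex D \<and> closed_in_norm X (N 0 (ennreal p) (ennreal q)) D \<and>
     (\<forall>f\<in>D. F f \<in> L2) \<and>
     (\<forall>f1\<in>D. \<forall>f2\<in>D.
        distr_of (\<lambda>x. F f1 x - F f2 x) \<in> besov \<theta> a (ennreal p) (ennreal q) \<and>
        N a (ennreal p) (ennreal q) (distr_of (\<lambda>x. F f1 x - F f2 x))
          \<le> L * N 0 (ennreal p) (ennreal q) (f1 - f2) \<and>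
        1 / L * N (- a) 2 2 (f1 - f2) \<le> L2_norm (\<lambda>x. F f1 x - F f2 x) \<and>
        L2_norm (\<lambda>x. F f1 x - F f2 x) \<le> L * N (- a) 2 2 (f1 - f2)) \<and>
     f_dag \<in> D \<and> f_dag \<in> besov \<theta> s (ennreal p) \<infinity> \<and> N s (ennreal p) \<infinity> f_dag \<le> \<rho> \<and>
     f_star \<in> subdifferential X (N 0 (ennreal p) (ennreal q)) R f_dag
     \<longrightarrow>
     (\<forall>f\<in>D. f_star (f_dag - f)
        \<le> 1 / 2 * bregman R f_star f f_dag
          + \<psi>_fun q a s c \<rho> ((L2_norm (\<lambda>x. F f_dag x - F f x))\<^sup>2)) \<and>
     (\<forall>\<delta> \<xi> g_obs.
        0 < \<delta> \<and> \<xi> \<in> L2 \<and> L2_norm \<xi> \<le> \<delta> \<and> g_obs = (\<lambda>x. F f_dag x + \<xi> x)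
        \<longrightarrow>
        (\<forall>\<alpha>>0.
           (\<exists>f_hat. is_arg_min (tikhonov F R g_obs \<alpha>) (\<lambda>f. f \<in> D) f_hat) \<and>
           (linear_into_L2 X D F \<longrightarrow>
              (\<exists>!f_hat. is_arg_min (tikhonov F R g_obs \<alpha>) (\<lambda>f. f \<in> D) f_hat)) \<and>
           (- 1 / (4 * \<alpha>) \<in> ereal_subdifferential (neg_ext (\<psi>_fun q a s c \<rho>)) (4 * \<delta>\<^sup>2) \<longrightarrow>
              (\<forall>f_hat. is_arg_min (tikhonov F R g_obs \<alpha>) (\<lambda>f. f \<in> D) f_hat \<longrightarrow>
                 N 0 (ennreal p) (ennreal q) (f_hat - f_dag) \<le> c' * rate q a s \<rho> \<delta>))))"
proof -
  \<comment> \<open>p \<le> 2 removes p from the maximum.\<close>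
  have "r = max 2 q" using r_def \<open>p \<le> 2\<close> by simp
  then interpret tik_setting \<theta> N \<sigma> I \<phi> p q a s r
    using assms by unfold_locales auto
  obtain c where c: "0 < c" and vsc: "\<And>f_dag u \<rho> f E. f_dag \<in> X \<Longrightarrow> f_dag \<in> besov \<theta> s (ennreal p) \<infinity> \<Longrightarrow> N s (ennreal p) \<infinity> f_dag \<le> \<rho> \<Longrightarrow>
    u \<in> subdifferential X (N 0 (ennreal p) (ennreal q)) R f_dag \<Longrightarrow> f \<in> X \<Longrightarrow> 0 \<le> E \<Longrightarrow> N (- a) 2 2 (f_dag - f) \<le> L * E \<Longrightarrow>
    u (f_dag - f) \<le> 1 / 2 * bregman R u f f_dag + c * \<rho> powr (r * a / (a + \<gamma>)) * E powr (r * \<gamma> / (a + \<gamma>))"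
    using variational_source_condition[OF \<open>0 < L\<close>] unfolding X_def R_def by metis
  obtain C where C: "0 < C" "\<And>f. f \<in> X \<Longrightarrow> N 0 (ennreal p) (ennreal q) f \<le> C * Wn f"
    using N_Wn_equiv unfolding X_def by metis
  define c' where "c' = C * ((c / \<kappa>) powr (1 / r) * 2 powr (\<gamma> / (a + \<gamma>)))"
  have c': "0 < c'" using C(1) c \<kappa>_pos by (simp add: c'_def)
  show ?thesis
  \<comment> \<open>Both constants are fixed before D, F, f_dag, \<rho>, \<delta> and \<alpha> are
    introduced, which is the claimed independence.\<close>
  proof (rule exI[of _ c], intro conjI c, rule exI[of _ c'], intro conjI c' allI impI)
    fix D and F :: "'d distribution \<Rightarrow> real^'d \<Rightarrow> real" and f_dag \<rho> f_star
    assume *: "D \<noteq> {} \<and> D \<subseteq> X \<and> convex D \<and> closed_in_norm X (N 0 (ennreal p) (ennreal q)) D \<and>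
     (\<forall>f\<in>D. F f \<in> L2) \<and>
     (\<forall>f1\<in>D. \<forall>f2\<in>D.
        distr_of (\<lambda>x. F f1 x - F f2 x) \<in> besov \<theta> a (ennreal p) (ennreal q) \<and>
        N a (ennreal p) (ennreal q) (distr_of (\<lambda>x. F f1 x - F f2 x))
          \<le> L * N 0 (ennreal p) (ennreal q) (f1 - f2) \<and>
        1 / L * N (- a) 2 2 (f1 - f2) \<le> L2_norm (\<lambda>x. F f1 x - F f2 x) \<and>
        L2_norm (\<lambda>x. F f1 x - F f2 x) \<le> L * N (- a) 2 2 (f1 - f2)) \<and>
     f_dag \<in> D \<and> f_dag \<in> besov \<theta> s (ennreal p) \<infinity> \<and> N s (ennreal p) \<infinity> f_dag \<le> \<rho> \<and>
     f_star \<in> subdifferential X (N 0 (ennreal p) (ennreal q)) R f_dag"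
    then have D: "D \<noteq> {}" "D \<subseteq> X" "convex D" "closed_in_norm X (N 0 (ennreal p) (ennreal q)) D"
      and F: "\<And>f. f \<in> D \<Longrightarrow> F f \<in> L2"
      and up: "\<And>f1 f2. f1 \<in> D \<Longrightarrow> f2 \<in> D \<Longrightarrow> L2_norm (\<lambda>x. F f1 x - F f2 x) \<le> L * N (- a) 2 2 (f1 - f2)"
      and dag: "f_dag \<in> D" "f_dag \<in> besov \<theta> s (ennreal p) \<infinity>" "N s (ennreal p) \<infinity> f_dag \<le> \<rho>"
      and star: "f_star \<in> subdifferential X (N 0 (ennreal p) (ennreal q)) R f_dag"
      by simp_all
    have low: "N (- a) 2 2 (f1 - f2) \<le> L * L2_norm (\<lambda>x. F f1 x - F f2 x)" if "f1 \<in> D" "f2 \<in> D" for f1 f2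
    proof -
      have "1 / L * N (- a) 2 2 (f1 - f2) \<le> L2_norm (\<lambda>x. F f1 x - F f2 x)" using * that by blast
      then show ?thesis using \<open>0 < L\<close> by (simp add: field_simps)
    qed
    show V: "\<forall>f\<in>D. f_star (f_dag - f)
        \<le> 1 / 2 * bregman R f_star f f_dag
          + \<psi>_fun q a s c \<rho> ((L2_norm (\<lambda>x. F f_dag x - F f x))\<^sup>2)"
    proof
      fix f assume f: "f \<in> D"
      have "f_dag \<in> X" "f \<in> X" using f dag D by auto
      then show "f_star (f_dag - f) \<le> 1 / 2 * bregman R f_star f f_dag
          + \<psi>_fun q a s c \<rho> ((L2_norm (\<lambda>x. F f_dag x - F f x))\<^sup>2)"
        unfolding psi_fun_eq[OF L2_norm_nonneg] by (intro vsc dag star L2_norm_nonneg low f)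
    qed
    fix \<delta> \<alpha> :: real and \<xi> g_obs
    assume \<delta>: "0 < \<delta> \<and> \<xi> \<in> L2 \<and> L2_norm \<xi> \<le> \<delta> \<and> g_obs = (\<lambda>x. F f_dag x + \<xi> x)" and \<alpha>: "0 < \<alpha>"
    then have \<xi>: "\<xi> \<in> L2" "L2_norm \<xi> \<le> \<delta>" and g_obs: "g_obs = (\<lambda>x. F f_dag x + \<xi> x)" by simp_all
    have g: "g_obs \<in> L2" unfolding g_obs by (intro L2_ops F dag \<xi>)
    show ex: "\<exists>f_hat. is_arg_min (tikhonov F R g_obs \<alpha>) (\<lambda>f. f \<in> D) f_hat"
      using tikhonov_minimizer_exists[OF D(1) D(2-4)[unfolded X_def] F \<open>0 < L\<close> up g \<alpha>] unfolding R_def .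
    show "\<exists>!f_hat. is_arg_min (tikhonov F R g_obs \<alpha>) (\<lambda>f. f \<in> D) f_hat" if lin: "linear_into_L2 X D F"
      using ex tikhonov_minimizer_unique[OF D(2,3)[unfolded X_def] F lin[unfolded X_def] g \<alpha>] unfolding R_def by blast
    fix f_hat
    assume sub: "- 1 / (4 * \<alpha>) \<in> ereal_subdifferential (neg_ext (\<psi>_fun q a s c \<rho>)) (4 * \<delta>\<^sup>2)"
      and f_hat: "is_arg_min (tikhonov F R g_obs \<alpha>) (\<lambda>f. f \<in> D) f_hat"
    have X: "f_hat \<in> X" "f_dag \<in> X" using f_hat dag D by (auto simp: is_arg_min_def)
    have "bregman R f_star f_hat f_dag \<le> 2 * \<psi>_fun q a s c \<rho> (4 * \<delta>\<^sup>2)"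
      unfolding R_def
      by (rule tikhonov_bregman_bound[OF F \<xi> \<alpha> D(2)[unfolded X_def] dag(1) star[unfolded X_def R_def]
            V[unfolded R_def, rule_format] sub f_hat[unfolded g_obs R_def]])
    moreover have "2 * \<kappa> * Wn (f_hat - f_dag) powr r \<le> bregman R f_star f_hat f_dag"
      using bregman_lower[OF star[unfolded X_def R_def]] X unfolding X_def R_def by blast
    ultimately have "Wn (f_hat - f_dag) \<le> (c / \<kappa>) powr (1 / r) * 2 powr (\<gamma> / (a + \<gamma>)) * rate q a s \<rho> \<delta>"
      using \<delta> by (intro Wn_rate c Wn_nonneg) auto
    then have "C * Wn (f_hat - f_dag) \<le> c' * rate q a s \<rho> \<delta>"
      unfolding c'_def mult.assoc using C(1) by (intro mult_left_mono) auto
    moreover have "N 0 (ennreal p) (ennreal q) (f_hat - f_dag) \<le> C * Wn (f_hat - f_dag)"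
      using X unfolding X_def by (intro C(2)[unfolded X_def] X_ops)
    ultimately show "N 0 (ennreal p) (ennreal q) (f_hat - f_dag) \<le> c' * rate q a s \<rho> \<delta>" by linarith
  qed
qed


end
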